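(* Let $(u^n)_{0\le n\le N}$, $u^n=p^n+\mathbf i q^n$ with $p^n,q^n$ real-valued functions on $\mathbb R$, be given by the Lie splitting scheme $$\tilde u^n=\exp\!\left(\mathbf i\,\delta t\,|u^n|^{2\sigma}\right)u^n,\qquad u^{n+1}=\exp\!\left(\mathbf i\,\delta W_n\,\Delta\right)\tilde u^n .$$ Put $\bar\omega^n:=\int_{\mathbb R}dp^n\wedge dq^n\,dx$ and $Q(u^n):=\int_{\mathbb R}|u^n|^2\,dx$. Then the scheme preserves the stochastic symplectic structure and the charge conservation law, i.e. $$\bar\omega^{n+1}=\bar\omega^n,\qquad Q(u^{n+1})=Q(u^n),\qquad 0\le n\le N-1,\quad\text{a.s.}$$
   Context: $W$ is a one-dimensional real-valued Brownian motion on a stochastic basis, $T>0$, $N\ge1$, $\delta t=T/N$, $t_n=n\,\delta t$, $\delta W_n=W(t_{n+1})-W(t_n)$, $\mathbf i$ is the imaginary unit, and $\sigma\le2$ is a positive integer. The scheme is a temporal semi-discretization of $\mathbf i\,du+\Delta u\circ dW(t)+|u|^{2\sigma}u\,dt=0$ on $\mathbb R_+\times\mathbb R$ (Stratonovich noise), started from $u^0=u_0$. $\exp(\mathbf i a\Delta)$, $a\in\mathbb R$, is the free Schrödinger group on $\mathbb R$. $d$ denotes the exterior differential on the phase space, i.e. differentiation with respect to the initial datum: $dp^n$, $dq^n$ evaluated on a variation of the initial datum give the real and imaginary parts of the corresponding variation of $u^n$ (at the point $x$), and $(dp^n\wedge dq^n)(\xi,\eta)=dp^n(\xi)\,dq^n(\eta)-dp^n(\eta)\,dq^n(\xi)$.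 Numerical solutions are understood to be regular enough that these objects make sense. *)

theory Defs
  imports "HOL-Probability.Probability"
begin

section \<open>The complex space \<open>L\<^sup>2(\<real>;\<complex>)\<close>, as a real inner product space\<close>

definition square_integrable :: "(real \<Rightarrow> complex) \<Rightarrow> bool" where
  "square_integrable f \<longleftrightarrow>
     f \<in> borel_measurable lborel \<and> integrable lborel (\<lambda>x. (cmod (f x))\<^sup>2)"

definition L2_rel :: "(real \<Rightarrow> complex) \<Rightarrow> (real \<Rightarrow> complex) \<Rightarrow> bool" where
  "L2_rel f g \<longleftrightarrow> square_integrable f \<and> square_integrable g \<and> (AE x in lborel. f x = g x)"

lemma square_integrable_zero: "square_integrable (\<lambda>x. 0)"
  by (simp add: square_integrable_def)

lemma square_integrable_bounded:
  assumes "f \<in> borel_measurable lborel" "integrable lborel h" "\<And>x. (cmod (f x))\<^sup>2 \<le> h x"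
  shows "square_integrable f"
  unfolding square_integrable_def
proof
  show "integrable lborel (\<lambda>x. (cmod (f x))\<^sup>2)"
    by (rule Bochner_Integration.integrable_bound[OF assms(2)])
       (use assms(1,3) in \<open>auto intro!: AE_I2 order_trans[OF assms(3)]\<close>)
qed fact

lemma square_integrable_add:
  assumes "square_integrable f" "square_integrable g"
  shows "square_integrable (\<lambda>x. f x + g x)"
proof (rule square_integrable_bounded)
  show "(\<lambda>x. f x + g x) \<in> borel_measurable lborel"
    using assms unfolding square_integrable_def by (intro borel_measurable_add) auto
  show "integrable lborel (\<lambda>x. 2 * (cmod (f x))\<^sup>2 + 2 * (cmod (g x))\<^sup>2)"
    using assms unfolding square_integrable_def by simp
  fix x
  have "(cmod (f x + g x))\<^sup>2 \<le> (cmod (f x) + cmod (g x))\<^sup>2"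
    by (intro power_mono norm_triangle_ineq) simp
  also have "\<dots> \<le> 2 * (cmod (f x))\<^sup>2 + 2 * (cmod (g x))\<^sup>2"
    using sum_squares_bound[of "cmod (f x)" "cmod (g x)"] by (simp add: power2_sum)
  finally show "(cmod (f x + g x))\<^sup>2 \<le> 2 * (cmod (f x))\<^sup>2 + 2 * (cmod (g x))\<^sup>2" .
qed

lemma square_integrable_scaleR:
  assumes "square_integrable f"
  shows "square_integrable (\<lambda>x. c *\<^sub>R f x)"
  using assms unfolding square_integrable_def by (auto simp: power_mult_distrib)

lemma square_integrable_uminus: "square_integrable f \<Longrightarrow> square_integrable (\<lambda>x. - f x)"
  unfolding square_integrable_def by auto

lemma square_integrable_diff:
  assumes "square_integrable f" "square_integrable g"
  shows "square_integrable (\<lambda>x. f x - g x)"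
  using square_integrable_add[OF assms(1) square_integrable_uminus[OF assms(2)]] by simp

lemma square_integrable_inner:
  assumes "square_integrable f" "square_integrable g"
  shows "integrable lborel (\<lambda>x. f x \<bullet> g x)"
proof (rule Bochner_Integration.integrable_bound)
  show "integrable lborel (\<lambda>x. (cmod (f x))\<^sup>2 + (cmod (g x))\<^sup>2)"
    using assms unfolding square_integrable_def by simp
  show "(\<lambda>x. f x \<bullet> g x) \<in> borel_measurable lborel"
    using assms unfolding square_integrable_def by (intro borel_measurable_inner) auto
  have "\<bar>f x \<bullet> g x\<bar> \<le> (cmod (f x))\<^sup>2 + (cmod (g x))\<^sup>2" for x
  proof -
    have "\<bar>f x \<bullet> g x\<bar> \<le> cmod (f x) * cmod (g x)" by (rule Cauchy_Schwarz_ineq2)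
    moreover have "2 * (cmod (f x) * cmod (g x)) \<le> (cmod (f x))\<^sup>2 + (cmod (g x))\<^sup>2"
      using sum_squares_bound[of "cmod (f x)" "cmod (g x)"] by simp
    moreover have "0 \<le> cmod (f x) * cmod (g x)" by simp
    ultimately show ?thesis by linarith
  qed
  then show "AE x in lborel. norm (f x \<bullet> g x) \<le> norm ((cmod (f x))\<^sup>2 + (cmod (g x))\<^sup>2)"
    by (intro AE_I2) simp
qed

lemma square_integrable_phase:
  assumes "square_integrable f" "g \<in> borel_measurable lborel" "\<And>x. cmod (g x) = cmod (f x)"
  shows "square_integrable g"
  using assms by (simp add: square_integrable_def)

quotient_type L2 = "real \<Rightarrow> complex" / partial: L2_rel
proof (rule part_equivpI)
  show "\<exists>x. L2_rel x x"
    using square_integrable_zero by (auto simp: L2_rel_def)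
  show "symp L2_rel"
    by (rule sympI) (auto simp: L2_rel_def)
  show "transp L2_rel"
    by (rule transpI) (auto simp: L2_rel_def)
qed

instantiation L2 :: real_vector
begin

lift_definition zero_L2 :: L2 is "\<lambda>x. 0"
  by (simp add: L2_rel_def square_integrable_zero)

lift_definition plus_L2 :: "L2 \<Rightarrow> L2 \<Rightarrow> L2" is "\<lambda>f g x. f x + g x"
  by (auto simp: L2_rel_def square_integrable_add)

lift_definition minus_L2 :: "L2 \<Rightarrow> L2 \<Rightarrow> L2" is "\<lambda>f g x. f x - g x"
  by (auto simp: L2_rel_def square_integrable_diff)

lift_definition uminus_L2 :: "L2 \<Rightarrow> L2" is "\<lambda>f x. - f x"
  by (auto simp: L2_rel_def square_integrable_uminus)

lift_definition scaleR_L2 :: "real \<Rightarrow> L2 \<Rightarrow> L2" is "\<lambda>c f x. c *\<^sub>R f x"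
  by (auto simp: L2_rel_def square_integrable_scaleR)

instance
proof
  fix a b :: real and u v w :: L2
  show "u + v + w = u + (v + w)"
    by transfer (auto simp: L2_rel_def add.assoc square_integrable_add)
  show "u + v = v + u"
    by transfer (auto simp: L2_rel_def add.commute square_integrable_add)
  show "0 + u = u"
    by transfer (auto simp: L2_rel_def)
  show "- u + u = 0"
    by transfer (auto simp: L2_rel_def square_integrable_zero)
  show "u - v = u + - v"
    by transfer (auto simp: L2_rel_def square_integrable_diff)
  show "a *\<^sub>R (u + v) = a *\<^sub>R u + a *\<^sub>R v"
    by transfer (auto simp: L2_rel_def scaleR_add_right intro!: square_integrable_add square_integrable_scaleR)
  show "(a + b) *\<^sub>R u = a *\<^sub>R u + b *\<^sub>R u"
    by transfer (auto simp: L2_rel_def scaleR_add_left intro!: square_integrable_add square_integrable_scaleR)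
  show "a *\<^sub>R b *\<^sub>R u = (a * b) *\<^sub>R u"
    by transfer (auto simp: L2_rel_def intro!: square_integrable_scaleR)
  show "1 *\<^sub>R u = u"
    by transfer (auto simp: L2_rel_def)
qed

end

instantiation L2 :: real_inner
begin

lift_definition inner_L2 :: "L2 \<Rightarrow> L2 \<Rightarrow> real" is "\<lambda>f g. \<integral>x. f x \<bullet> g x \<partial>lborel"
proof -
  fix f f' g g' assume "L2_rel f f'" "L2_rel g g'"
  then show "(\<integral>x. f x \<bullet> g x \<partial>lborel) = (\<integral>x. f' x \<bullet> g' x \<partial>lborel)"
    by (intro integral_cong_AE) (auto simp: L2_rel_def square_integrable_def)
qed

definition norm_L2 :: "L2 \<Rightarrow> real" where "norm_L2 u = sqrt (u \<bullet> u)"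
definition sgn_L2 :: "L2 \<Rightarrow> L2" where "sgn_L2 u = u /\<^sub>R norm u"
definition dist_L2 :: "L2 \<Rightarrow> L2 \<Rightarrow> real" where "dist_L2 u v = norm (u - v)"
definition uniformity_L2 :: "(L2 \<times> L2) filter" where
  "uniformity_L2 = (INF e\<in>{0<..}. principal {(x, y). dist x y < e})"
definition open_L2 :: "L2 set \<Rightarrow> bool" where
  "open_L2 S \<longleftrightarrow> (\<forall>x\<in>S. \<forall>\<^sub>F (x', y) in uniformity. x' = x \<longrightarrow> y \<in> S)"

instance
proof
  fix a :: real and u v w :: L2
  show "sgn u = u /\<^sub>R norm u" by (rule sgn_L2_def)
  show "dist u v = norm (u - v)" by (rule dist_L2_def)
  show "u \<bullet> v = v \<bullet> u"
    by transfer (simp add: inner_commute)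
  show "(u + v) \<bullet> w = u \<bullet> w + v \<bullet> w"
    by transfer (auto simp: L2_rel_def inner_add_left square_integrable_inner
      intro!: Bochner_Integration.integral_add)
  show "(a *\<^sub>R u) \<bullet> v = a * (u \<bullet> v)"
    by transfer simp
  show "0 \<le> u \<bullet> u"
    by transfer (auto intro!: Bochner_Integration.integral_nonneg)
  show "u \<bullet> u = 0 \<longleftrightarrow> u = 0"
  proof transfer
    fix f assume f: "L2_rel f f"
    then have "(\<integral>x. f x \<bullet> f x \<partial>lborel) = 0 \<longleftrightarrow> (AE x in lborel. f x \<bullet> f x = 0)"
      by (intro integral_nonneg_eq_0_iff_AE square_integrable_inner)
         (auto simp: L2_rel_def simp del: inner_eq_zero_iff)
    then show "(\<integral>x. f x \<bullet> f x \<partial>lborel) = 0 \<longleftrightarrow> L2_rel f (\<lambda>x. 0)"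
      using f by (simp add: L2_rel_def square_integrable_zero)
  qed
  show "norm u = sqrt (u \<bullet> u)" by (rule norm_L2_def)
qed (rule uniformity_L2_def open_L2_def)+

end

definition L2_class :: "(real \<Rightarrow> complex) \<Rightarrow> L2" where
  "L2_class = abs_L2"

text \<open>A representative of the almost-everywhere class, chosen arbitrarily.\<close>

definition L2_fun :: "L2 \<Rightarrow> real \<Rightarrow> complex" where
  "L2_fun = rep_L2"

section \<open>The free Schroedinger group\<close>

text \<open>The unitary Fourier transform on \<open>L\<^sup>2\<close>, as the mean-square limit of truncated Fourier
  integrals (Plancherel).\<close>

definition fourier_truncated :: "nat \<Rightarrow> L2 \<Rightarrow> real \<Rightarrow> complex" where
  "fourier_truncated R u k =
     (LINT x:{- real R..real R}|lborel. exp (- \<i> * of_real (k * x)) * L2_fun u x)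
       / of_real (sqrt (2 * pi))"

definition fourier_L2 :: "L2 \<Rightarrow> L2" where
  "fourier_L2 u = lim (\<lambda>R. L2_class (fourier_truncated R u))"

lift_definition schroedinger_multiplier :: "real \<Rightarrow> L2 \<Rightarrow> L2" is
  "\<lambda>a f k. exp (- \<i> * of_real (a * k\<^sup>2)) * f k"
proof -
  fix a f g assume "L2_rel f g"
  moreover have "square_integrable (\<lambda>k. exp (- \<i> * of_real (a * k\<^sup>2)) * h k)"
    if "square_integrable h" for h
  proof (rule square_integrable_phase[OF that])
    have "(\<lambda>k::real. exp (- \<i> * of_real (a * k\<^sup>2))) \<in> borel_measurable lborel"
      unfolding measurable_lborel2 by (intro borel_measurable_continuous_onI continuous_intros)
    then show "(\<lambda>k. exp (- \<i> * of_real (a * k\<^sup>2)) * h k) \<in> borel_measurable lborel"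
      using that unfolding square_integrable_def by (intro borel_measurable_times) auto
  qed (simp add: norm_mult)
  ultimately show "L2_rel (\<lambda>k. exp (- \<i> * of_real (a * k\<^sup>2)) * f k)
      (\<lambda>k. exp (- \<i> * of_real (a * k\<^sup>2)) * g k)"
    by (auto simp: L2_rel_def)
qed

text \<open>\<open>exp(i a \<Delta>)\<close>: the symbol of \<open>\<Delta>\<close> is \<open>-k\<^sup>2\<close>.\<close>

definition free_schroedinger :: "real \<Rightarrow> L2 \<Rightarrow> L2" where
  "free_schroedinger a u = inv fourier_L2 (schroedinger_multiplier a (fourier_L2 u))"

definition sobolev_H1 :: "L2 set" where
  "sobolev_H1 = {u. square_integrable (\<lambda>k. of_real k * L2_fun (fourier_L2 u) k)}"

section \<open>The Lie splitting scheme\<close>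

lift_definition nonlinear_step :: "nat \<Rightarrow> real \<Rightarrow> L2 \<Rightarrow> L2" is
  "\<lambda>\<sigma> \<tau> f x. exp (\<i> * of_real (\<tau> * cmod (f x) ^ (2 * \<sigma>))) * f x"
proof -
  fix \<sigma> :: nat and \<tau> :: real and f g assume "L2_rel f g"
  moreover have "square_integrable (\<lambda>x. exp (\<i> * of_real (\<tau> * cmod (h x) ^ (2 * \<sigma>))) * h x)"
    if "square_integrable h" for h
  proof (rule square_integrable_phase[OF that])
    have [measurable]: "h \<in> borel_measurable borel"
      using that by (simp add: square_integrable_def)
    have [measurable]: "(exp :: complex \<Rightarrow> complex) \<in> borel_measurable borel"
      by (intro borel_measurable_continuous_onI continuous_intros)
    show "(\<lambda>x. exp (\<i> * of_real (\<tau> * cmod (h x) ^ (2 * \<sigma>))) * h x) \<in> borel_measurable lborel"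
      by measurable
  qed (simp add: norm_mult)
  ultimately show "L2_rel (\<lambda>x. exp (\<i> * of_real (\<tau> * cmod (f x) ^ (2 * \<sigma>))) * f x)
      (\<lambda>x. exp (\<i> * of_real (\<tau> * cmod (g x) ^ (2 * \<sigma>))) * g x)"
    by (auto simp: L2_rel_def)
qed

text \<open>\<open>lie_splitting \<sigma> T N w n u\<^sub>0\<close> is \<open>u\<^sup>n\<close> for the initial datum \<open>u\<^sub>0\<close> and the path \<open>w\<close> of the
  driving process.\<close>

primrec lie_splitting :: "nat \<Rightarrow> real \<Rightarrow> nat \<Rightarrow> (real \<Rightarrow> real) \<Rightarrow> nat \<Rightarrow> L2 \<Rightarrow> L2" where
  "lie_splitting \<sigma> T N w 0 u0 = u0"
| "lie_splitting \<sigma> T N w (Suc n) u0 =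
     (let \<tau> = T / real N
      in free_schroedinger (w (real (Suc n) * \<tau>) - w (real n * \<tau>))
           (nonlinear_step \<sigma> \<tau> (lie_splitting \<sigma> T N w n u0)))"

section \<open>Charge and symplectic form\<close>

definition charge :: "L2 \<Rightarrow> real" where
  "charge u = (\<integral>x. (cmod (L2_fun u x))\<^sup>2 \<partial>lborel)"

text \<open>In the following, \<open>\<Phi>\<close> maps an initial datum to a numerical solution; \<open>\<xi>\<close> and \<open>\<eta>\<close> are
  variations of the initial datum, and differentiation is in \<open>L\<^sup>2\<close>.
  The nonlinear step is not differentiable along every direction of \<open>L\<^sup>2\<close>, hence the
  predicate \<open>has_variation\<close>.\<close>

definition has_variation :: "(L2 \<Rightarrow> L2) \<Rightarrow> L2 \<Rightarrow> L2 \<Rightarrow> bool" where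
  "has_variation \<Phi> u0 \<xi> \<longleftrightarrow> (\<lambda>\<epsilon>::real. \<Phi> (u0 + \<epsilon> *\<^sub>R \<xi>)) differentiable (at 0)"

definition variation :: "(L2 \<Rightarrow> L2) \<Rightarrow> L2 \<Rightarrow> L2 \<Rightarrow> L2" where
  "variation \<Phi> u0 \<xi> = vector_derivative (\<lambda>\<epsilon>::real. \<Phi> (u0 + \<epsilon> *\<^sub>R \<xi>)) (at 0)"

definition dp :: "(L2 \<Rightarrow> L2) \<Rightarrow> L2 \<Rightarrow> real \<Rightarrow> L2 \<Rightarrow> real" where
  "dp \<Phi> u0 x \<xi> = Re (L2_fun (variation \<Phi> u0 \<xi>) x)"

definition dq :: "(L2 \<Rightarrow> L2) \<Rightarrow> L2 \<Rightarrow> real \<Rightarrow> L2 \<Rightarrow> real" where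
  "dq \<Phi> u0 x \<xi> = Im (L2_fun (variation \<Phi> u0 \<xi>) x)"

definition wedge :: "(L2 \<Rightarrow> real) \<Rightarrow> (L2 \<Rightarrow> real) \<Rightarrow> L2 \<Rightarrow> L2 \<Rightarrow> real" where
  "wedge \<alpha> \<beta> \<xi> \<eta> = \<alpha> \<xi> * \<beta> \<eta> - \<alpha> \<eta> * \<beta> \<xi>"

definition symplectic_form :: "(L2 \<Rightarrow> L2) \<Rightarrow> L2 \<Rightarrow> L2 \<Rightarrow> L2 \<Rightarrow> real" where
  "symplectic_form \<Phi> u0 \<xi> \<eta> = (\<integral>x. wedge (dp \<Phi> u0 x) (dq \<Phi> u0 x) \<xi> \<eta> \<partial>lborel)"

section \<open>Brownian motion on a stochastic basis\<close>

text \<open>The time index is real; only times \<open>t \<ge> 0\<close> are constrained. The usual conditions on the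
  filtration are not required.\<close>

locale stochastic_basis = prob_space M for M :: "'a measure" +
  fixes F :: "real \<Rightarrow> 'a measure"
  assumes subalgebra: "0 \<le> t \<Longrightarrow> subalgebra M (F t)"
    and filtration_mono: "0 \<le> s \<Longrightarrow> s \<le> t \<Longrightarrow> sets (F s) \<subseteq> sets (F t)"

locale brownian_motion = stochastic_basis M F
  for M :: "'a measure" and F :: "real \<Rightarrow> 'a measure" +
  fixes W :: "real \<Rightarrow> 'a \<Rightarrow> real"
  assumes adapted: "0 \<le> t \<Longrightarrow> W t \<in> borel_measurable (F t)"
    and start: "AE \<omega> in M. W 0 \<omega> = 0"
    and continuous_paths: "AE \<omega> in M. continuous_on {0..} (\<lambda>t. W t \<omega>)"
    and gaussian_increments: "0 \<le> s \<Longrightarrow> s < t \<Longrightarrow>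
      distributed M lborel (\<lambda>\<omega>. W t \<omega> - W s \<omega>) (normal_density 0 (sqrt (t - s)))"
    and independent_increments: "0 \<le> s \<Longrightarrow> s < t \<Longrightarrow>
      indep_set (sets (F s)) (sets (vimage_algebra (space M) (\<lambda>\<omega>. W t \<omega> - W s \<omega>) borel))"

end

theory Submission
  imports Defs
begin

text \<open>Both substeps of the splitting are symplectic isometries. The free flow is
  \<open>F\<^sup>-\<^sup>1 exp(-i a k\<^sup>2) F\<close> with \<open>F\<close> the Fourier transform, so Plancherel's theorem makes it unitary and
  complex linear. Plancherel's theorem is obtained as follows: Gaussian regularization and Schur's
  test show that \<open>F\<close> and its adjoint \<open>F\<^sup>*\<close> are contractions; \<open>F\<^sup>* F\<close> is self-adjoint and fixes all
  modulated Gaussians, which form a total set by uniqueness of characteristic functions, so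
  \<open>F\<^sup>* F = 1\<close>. The nonlinear step is a pointwise rotation of \<open>\<complex>\<close> whose differential has determinant
  one.

  For data in \<open>H\<^sup>1\<close> the variations exist: \<open>H\<^sup>1\<close> enters only through the estimate
  \<open>\<parallel>u(\<cdot> + h) - u\<parallel> \<le> K \<bar>h\<bar>\<close>, which passes through both substeps and bounds \<open>u\<close> in \<open>L\<^sup>\<infinity>\<close>, where the
  nonlinear step is differentiable.\<close>

section \<open>The Hilbert space \<open>L\<^sup>2\<close>\<close>

text \<open>\<open>fourier_L2\<close> is given by \<open>lim\<close> and
  \<open>free_schroedinger\<close> by \<open>inv\<close>; each denotes an unspecified value unless
  convergence and bijectivity are proved. Hence completeness of L^2 and a two-sided inverse come
  before any dynamics. The main obstacle is that a variation is a derivative in the L^2 norm, while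
  the nonlinear step acts pointwise and is not Frechet differentiable on L^2. The two claims about
  variations are therefore separated. For conservation of the form, existence of the variations is a
  hypothesis, and only their pointwise values have to be identified, along an almost everywhere
  convergent subsequence of difference quotients. For existence, the translation estimate replaces
  weak derivatives: it calls for no chain rule in Sobolev spaces, and it survives the nonlinear step
  because that step commutes with translations and is Lipschitz on bounded sets of values. The same
  estimate gives a sup bound with a free scale parameter, so that a difference of two curve values
  that is small in L^2 is also uniformly small.\<close>

lemma L2_rel_refl: "L2_rel f f \<longleftrightarrow> square_integrable f"
  by (auto simp: L2_rel_def)

lemma square_integrable_L2_fun: "square_integrable (L2_fun u)"
  using Quotient_rep_reflp[OF Quotient_L2] by (simp add: L2_fun_def L2_rel_refl)

lemma L2_class_L2_fun [simp]: "L2_class (L2_fun u) = u"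
  unfolding L2_class_def L2_fun_def by (rule Quotient_abs_rep[OF Quotient_L2])

lemma L2_fun_measurable [measurable]: "L2_fun u \<in> borel_measurable borel"
  using square_integrable_L2_fun by (simp add: square_integrable_def)

lemma L2_class_eq_iff:
  assumes "square_integrable f" "square_integrable g"
  shows "L2_class f = L2_class g \<longleftrightarrow> (AE x in lborel. f x = g x)"
  using Quotient_rel[OF Quotient_L2, of f g] assms
  by (auto simp: L2_rel_def L2_class_def)

lemma L2_fun_L2_class:
  assumes "square_integrable f"
  shows "AE x in lborel. L2_fun (L2_class f) x = f x"
  using L2_class_eq_iff[OF square_integrable_L2_fun assms, of "L2_class f"] by simp

lemma L2_eq_iff: "u = v \<longleftrightarrow> (AE x in lborel. L2_fun u x = L2_fun v x)"
  using L2_class_eq_iff[OF square_integrable_L2_fun square_integrable_L2_fun, of u v] by simp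

lemma L2_class_zero: "L2_class (\<lambda>x. 0) = 0"
  by (simp add: L2_class_def zero_L2.abs_eq)

lemma L2_class_add:
  "square_integrable f \<Longrightarrow> square_integrable g \<Longrightarrow> L2_class f + L2_class g = L2_class (\<lambda>x. f x + g x)"
  by (simp add: L2_class_def plus_L2.abs_eq L2_rel_refl)

lemma L2_class_diff:
  "square_integrable f \<Longrightarrow> square_integrable g \<Longrightarrow> L2_class f - L2_class g = L2_class (\<lambda>x. f x - g x)"
  by (simp add: L2_class_def minus_L2.abs_eq L2_rel_refl)

lemma L2_class_scaleR:
  "square_integrable f \<Longrightarrow> c *\<^sub>R L2_class f = L2_class (\<lambda>x. c *\<^sub>R f x)"
  by (simp add: L2_class_def scaleR_L2.abs_eq L2_rel_refl)

lemma L2_class_inner: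
  "square_integrable f \<Longrightarrow> square_integrable g \<Longrightarrow> L2_class f \<bullet> L2_class g = (\<integral>x. f x \<bullet> g x \<partial>lborel)"
  by (simp add: L2_class_def inner_L2.abs_eq L2_rel_refl)

lemma L2_fun_add: "AE x in lborel. L2_fun (u + v) x = L2_fun u x + L2_fun v x"
  using L2_fun_L2_class[OF square_integrable_add[OF square_integrable_L2_fun square_integrable_L2_fun, of u v]]
  by (simp flip: L2_class_add add: square_integrable_L2_fun)

lemma L2_fun_diff: "AE x in lborel. L2_fun (u - v) x = L2_fun u x - L2_fun v x"
  using L2_fun_L2_class[OF square_integrable_diff[OF square_integrable_L2_fun square_integrable_L2_fun, of u v]]
  by (simp flip: L2_class_diff add: square_integrable_L2_fun)

lemma L2_fun_scaleR: "AE x in lborel. L2_fun (c *\<^sub>R u) x = c *\<^sub>R L2_fun u x"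
  using L2_fun_L2_class[OF square_integrable_scaleR[OF square_integrable_L2_fun, of c u]]
  by (simp only: L2_class_scaleR[symmetric] square_integrable_L2_fun L2_class_L2_fun)

lemma inner_L2_eq: "u \<bullet> v = (\<integral>x. L2_fun u x \<bullet> L2_fun v x \<partial>lborel)"
  using L2_class_inner[OF square_integrable_L2_fun square_integrable_L2_fun, of u v] by simp

lemma norm_L2_class: "square_integrable f \<Longrightarrow> (norm (L2_class f))\<^sup>2 = (\<integral>x. (cmod (f x))\<^sup>2 \<partial>lborel)"
  by (simp add: power2_norm_eq_inner L2_class_inner)

lemma norm_L2_eq: "(norm u)\<^sup>2 = (\<integral>x. (cmod (L2_fun u x))\<^sup>2 \<partial>lborel)"
  using norm_L2_class[OF square_integrable_L2_fun, of u] by simp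

lemma norm_L2_class_diff:
  "square_integrable f \<Longrightarrow> square_integrable g \<Longrightarrow>
    (norm (L2_class f - L2_class g))\<^sup>2 = (\<integral>x. (cmod (f x - g x))\<^sup>2 \<partial>lborel)"
  by (simp add: L2_class_diff norm_L2_class square_integrable_diff)

lemma norm_L2_diff: "(norm (u - v))\<^sup>2 = (\<integral>x. (cmod (L2_fun u x - L2_fun v x))\<^sup>2 \<partial>lborel)"
  using norm_L2_class_diff[OF square_integrable_L2_fun square_integrable_L2_fun, of u v] by simp

lemma charge_eq: "charge u = (norm u)\<^sup>2"
  by (simp add: charge_def norm_L2_eq)

lemma square_integrable_norm_diff:
  "square_integrable f \<Longrightarrow> square_integrable g \<Longrightarrow> integrable lborel (\<lambda>x. (cmod (f x - g x))\<^sup>2)"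
  using square_integrable_diff[of f g] by (simp add: square_integrable_def)

lemma norm_L2_le:
  assumes "AE x in lborel. cmod (L2_fun u x) \<le> c * cmod (L2_fun v x)" "0 \<le> c"
  shows "norm u \<le> c * norm v"
proof (rule power2_le_imp_le)
  have "(norm u)\<^sup>2 \<le> (\<integral>x. c\<^sup>2 * (cmod (L2_fun v x))\<^sup>2 \<partial>lborel)"
    unfolding norm_L2_eq
  proof (rule integral_mono_AE)
    show "AE x in lborel. (cmod (L2_fun u x))\<^sup>2 \<le> c\<^sup>2 * (cmod (L2_fun v x))\<^sup>2"
      using assms(1) by eventually_elim (metis norm_ge_zero power_mono power_mult_distrib)
  qed (use square_integrable_L2_fun in \<open>auto simp: square_integrable_def\<close>)
  then show "(norm u)\<^sup>2 \<le> (c * norm v)\<^sup>2"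
    by (simp add: norm_L2_eq power_mult_distrib)
qed (use assms in simp)

lemma nonlinear_step_fun:
  "AE x in lborel. L2_fun (nonlinear_step \<sigma> \<tau> u) x
     = exp (\<i> * of_real (\<tau> * cmod (L2_fun u x) ^ (2 * \<sigma>))) * L2_fun u x"
proof -
  let ?f = "\<lambda>x. exp (\<i> * of_real (\<tau> * cmod (L2_fun u x) ^ (2 * \<sigma>))) * L2_fun u x"
  have "nonlinear_step \<sigma> \<tau> u = L2_class ?f"
    using nonlinear_step.abs_eq[of "L2_fun u" \<sigma> \<tau>] square_integrable_L2_fun
    by (simp add: L2_rel_refl flip: L2_class_def)
  moreover have "square_integrable ?f"
  proof (rule square_integrable_phase[OF square_integrable_L2_fun])
    have [measurable]: "(exp :: complex \<Rightarrow> complex) \<in> borel_measurable borel"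
      by (intro borel_measurable_continuous_onI continuous_intros)
    show "?f \<in> borel_measurable lborel" by measurable
  qed (simp add: norm_mult)
  ultimately show ?thesis using L2_fun_L2_class by metis
qed

section \<open>Almost everywhere limits and completeness of L^2\<close>

text \<open>Mean-square convergence is L^1 convergence of the squared differences, so the
  subsequence theorem for L^1 applies. This is the bridge from norm limits to pointwise
  values.\<close>

lemma L2_AE_subseq:
  fixes u :: "nat \<Rightarrow> L2"
  assumes "u \<longlonglongrightarrow> v"
  obtains r where "strict_mono r" "AE x in lborel. (\<lambda>n. L2_fun (u (r n)) x) \<longlonglongrightarrow> L2_fun v x"
proof -
  let ?d = "\<lambda>n x. (cmod (L2_fun (u n) x - L2_fun v x))\<^sup>2"
  have "(\<lambda>n. (norm (u n - v))\<^sup>2) \<longlonglongrightarrow> 0\<^sup>2"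
    using assms by (intro tendsto_power tendsto_norm_zero) (simp add: LIM_zero)
  then have "(\<lambda>n. \<integral>x. norm (?d n x) \<partial>lborel) \<longlonglongrightarrow> 0"
    by (simp add: norm_L2_diff)
  then obtain r where r: "strict_mono r" "AE x in lborel. (\<lambda>n. ?d (r n) x) \<longlonglongrightarrow> 0"
    using tendsto_L1_AE_subseq[of lborel ?d]
      square_integrable_norm_diff[OF square_integrable_L2_fun square_integrable_L2_fun] by auto
  from r(2) have "AE x in lborel. (\<lambda>n. L2_fun (u (r n)) x) \<longlonglongrightarrow> L2_fun v x"
  proof eventually_elim
    case (elim x)
    from tendsto_real_sqrt[OF elim] show ?case
      by (simp add: tendsto_norm_zero_iff LIM_zero_iff)
  qed
  with r(1) show thesis by (rule that)
qed

text \<open>Fatou's lemma. Bounding the distance to a fixed \<open>h\<close> yields at once that the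
  limit is square integrable and, with a term of the sequence as \<open>h\<close>, that a Cauchy
  estimate survives the limit.\<close>

lemma L2_class_limit:
  fixes f :: "nat \<Rightarrow> real \<Rightarrow> complex"
  assumes f: "\<And>n. square_integrable (f n)" and lim: "AE x in lborel. (\<lambda>n. f n x) \<longlonglongrightarrow> g x"
    and g: "g \<in> borel_measurable borel" and h: "square_integrable h"
    and bound: "\<And>n. (\<integral>x. (cmod (f n x - h x))\<^sup>2 \<partial>lborel) \<le> B"
  shows "square_integrable g" "(\<integral>x. (cmod (g x - h x))\<^sup>2 \<partial>lborel) \<le> B"
proof -
  note [measurable] = g
  have [measurable]: "f n \<in> borel_measurable borel" for n
    using f[of n] by (simp add: square_integrable_def)
  have [measurable]: "h \<in> borel_measurable borel"
    using h by (simp add: square_integrable_def)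
  have B: "0 \<le> B" using order_trans[OF Bochner_Integration.integral_nonneg bound[of 0]] by simp
  have "(\<integral>\<^sup>+x. ennreal ((cmod (g x - h x))\<^sup>2) \<partial>lborel)
      = (\<integral>\<^sup>+x. liminf (\<lambda>n. ennreal ((cmod (f n x - h x))\<^sup>2)) \<partial>lborel)"
  proof (intro nn_integral_cong_AE)
    show "AE x in lborel. ennreal ((cmod (g x - h x))\<^sup>2)
      = liminf (\<lambda>n. ennreal ((cmod (f n x - h x))\<^sup>2))"
      using lim
    proof eventually_elim
      case (elim x)
      have "(\<lambda>n. ennreal ((cmod (f n x - h x))\<^sup>2)) \<longlonglongrightarrow> ennreal ((cmod (g x - h x))\<^sup>2)"
        by (intro tendsto_intros elim)
      then show ?case by (metis lim_imp_Liminf sequentially_bot)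
    qed
  qed
  also have "\<dots> \<le> liminf (\<lambda>n. (\<integral>\<^sup>+x. ennreal ((cmod (f n x - h x))\<^sup>2) \<partial>lborel))"
    by (intro nn_integral_liminf) measurable
  also have "\<dots> \<le> ennreal B"
  proof (rule Liminf_le)
    show "\<forall>\<^sub>F n in sequentially. (\<integral>\<^sup>+x. ennreal ((cmod (f n x - h x))\<^sup>2) \<partial>lborel) \<le> ennreal B"
      using bound B by (intro always_eventually allI, subst nn_integral_eq_integral)
        (auto intro!: square_integrable_norm_diff f h ennreal_leI)
  qed simp
  finally have le: "(\<integral>\<^sup>+x. ennreal ((cmod (g x - h x))\<^sup>2) \<partial>lborel) \<le> ennreal B" .
  have i: "integrable lborel (\<lambda>x. (cmod (g x - h x))\<^sup>2)"
    by (rule integrableI_bounded) (use le in \<open>auto simp: le_less_trans\<close>)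
  then have "square_integrable (\<lambda>x. g x - h x)"
    by (simp add: square_integrable_def)
  from square_integrable_add[OF this h] show "square_integrable g" by simp
  show "(\<integral>x. (cmod (g x - h x))\<^sup>2 \<partial>lborel) \<le> B"
    using le i B by (subst (asm) nn_integral_eq_integral) auto
qed

text \<open>The Riesz-Fischer theorem; it is what makes the \<open>lim\<close> in
  \<open>fourier_L2\<close> meaningful.\<close>

lemma L2_Cauchy_convergent:
  fixes u :: "nat \<Rightarrow> L2"
  assumes "Cauchy u"
  shows "convergent u"
proof -
  have "\<exists>N. \<forall>m\<ge>N. \<forall>n\<ge>N. norm (u m - u n) < (1/2)^k" for k
    using assms unfolding Cauchy_iff by (metis zero_less_power half_gt_zero_iff zero_less_one)
  then obtain N where N: "\<And>k m n. m \<ge> N k \<Longrightarrow> n \<ge> N k \<Longrightarrow> norm (u m - u n) < (1/2)^k"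
    by metis
  \<comment> \<open>Partial sums give an index that dominates \<open>N k\<close> and is monotone in
    k.\<close>
  define r where "r k = (\<Sum>i\<le>k. N i)" for k
  have rN: "N k \<le> r k" for k unfolding r_def by (intro member_le_sum) auto
  have rm: "r k \<le> r (Suc k)" for k unfolding r_def by simp
  \<comment> \<open>The squared increments have integral at most 4^(-k). The weight 2^k leaves the
    summable 2^(-k), and boundedness of \<open>d k x\<close> in k then forces the increments at x to
    decay like 2^(-k/2).\<close>
  define d where "d k x = (2^k) * (cmod (L2_fun (u (r (Suc k))) x - L2_fun (u (r k)) x))\<^sup>2" for k x
  have dint: "integrable lborel (d k)" for k
    unfolding d_def by (intro integrable_mult_right square_integrable_norm_diff square_integrable_L2_fun)
  have dle: "(\<integral>x. d k x \<partial>lborel) \<le> (1/2)^k" for k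
  proof -
    have "norm (u (r (Suc k)) - u (r k)) \<le> (1/2)^k"
      using N[of k "r (Suc k)" "r k"] rN[of k] rm[of k] by simp
    then have "(norm (u (r (Suc k)) - u (r k)))\<^sup>2 \<le> ((1/2)^k)\<^sup>2"
      by (intro power_mono) auto
    then have "2^k * (norm (u (r (Suc k)) - u (r k)))\<^sup>2 \<le> 2^k * ((1/2)^k)\<^sup>2"
      by simp
    also have "\<dots> = (1/2)^k"
      by (simp add: power2_eq_square power_divide)
    finally show ?thesis by (simp add: d_def norm_L2_diff)
  qed
  have "(\<integral>\<^sup>+x. (\<Sum>k. ennreal (d k x)) \<partial>lborel) = (\<Sum>k. \<integral>\<^sup>+x. ennreal (d k x) \<partial>lborel)"
    using dint by (intro nn_integral_suminf) auto
  also have "\<dots> \<le> (\<Sum>k. ennreal ((1/2)^k))"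
  proof (intro suminf_le)
    fix k
    have "(\<integral>\<^sup>+x. ennreal (d k x) \<partial>lborel) = ennreal (\<integral>x. d k x \<partial>lborel)"
      by (rule nn_integral_eq_integral[OF dint]) (simp add: d_def)
    also have "\<dots> \<le> ennreal ((1/2)^k)" by (rule ennreal_leI[OF dle])
    finally show "(\<integral>\<^sup>+x. ennreal (d k x) \<partial>lborel) \<le> ennreal ((1/2)^k)" .
  qed auto
  also have "\<dots> = ennreal (\<Sum>k. (1/2)^k)"
    by (intro suminf_ennreal2) (auto intro: summable_geometric)
  also have "\<dots> < \<infinity>" by simp
  finally have "AE x in lborel. (\<Sum>k. ennreal (d k x)) \<noteq> \<infinity>"
    using dint by (intro nn_integral_noteq_infinite) auto
  then have conv: "AE x in lborel. convergent (\<lambda>k. L2_fun (u (r k)) x)"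
  proof eventually_elim
    case (elim x)
    have "summable (\<lambda>k. d k x)"
      using elim by (intro summable_suminf_not_top) (auto simp: d_def)
    then have "(\<lambda>k. d k x) \<longlonglongrightarrow> 0" by (rule summable_LIMSEQ_zero)
    then obtain C where C: "\<And>k. d k x \<le> C"
      using convergent_imp_Bseq[of "\<lambda>k. d k x"] unfolding Bseq_def convergent_def
      by (metis abs_le_D1 real_norm_def)
    have C0: "0 \<le> C" using C[of 0] by (auto simp: d_def intro: order_trans[rotated])
    define q :: real where "q = 1 / sqrt 2"
    have q: "0 < q" "q < 1" "q^2 = 1/2" by (auto simp: q_def power_divide)
    have bound: "cmod (L2_fun (u (r (Suc k))) x - L2_fun (u (r k)) x) \<le> sqrt C * q^k" for k
    proof (rule power2_le_imp_le)
      have "(q^k)^2 = 1/2^k" using q(3) by (metis power_commutes power_mult mult.commute power_one_over)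
      then have "(sqrt C * q^k)^2 = C / 2^k" using C0 by (simp add: power_mult_distrib)
      moreover have "(cmod (L2_fun (u (r (Suc k))) x - L2_fun (u (r k)) x))\<^sup>2 \<le> C / 2^k"
        using C[of k] by (simp add: d_def pos_le_divide_eq mult.commute)
      ultimately show "(cmod (L2_fun (u (r (Suc k))) x - L2_fun (u (r k)) x))\<^sup>2 \<le> (sqrt C * q^k)^2"
        by simp
    qed (use q C0 in auto)
    have geo: "summable (\<lambda>k. sqrt C * q^k)"
      using q by (intro summable_mult summable_geometric) auto
    have "summable (\<lambda>k. L2_fun (u (r (Suc k))) x - L2_fun (u (r k)) x)"
      by (rule summable_comparison_test'[OF geo, of 0]) (rule bound)
    then have "convergent (\<lambda>n. \<Sum>k<n. L2_fun (u (r (Suc k))) x - L2_fun (u (r k)) x)"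
      by (simp add: summable_iff_convergent)
    then have "convergent (\<lambda>n. L2_fun (u (r n)) x - L2_fun (u (r 0)) x)"
      by (simp add: sum_lessThan_telescope[of "\<lambda>k. L2_fun (u (r k)) x"])
    from convergent_add[OF this convergent_const[of "L2_fun (u (r 0)) x"]] show ?case by simp
  qed
  define g where "g x = lim (\<lambda>k. L2_fun (u (r k)) x)" for x
  have g: "g \<in> borel_measurable borel" unfolding g_def by measurable
  have lim: "AE x in lborel. (\<lambda>k. L2_fun (u (r k)) x) \<longlonglongrightarrow> g x"
    using conv by eventually_elim (simp add: g_def convergent_LIMSEQ_iff)
  have tail: "(\<integral>x. (cmod (L2_fun (u (r (n + k))) x - L2_fun (u m) x))\<^sup>2 \<partial>lborel) \<le> ((1/2)^n)^2"
    if "m \<ge> N n" for n k m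
  proof -
    have "r n \<le> r (n + k)" by (induction k) (auto intro: order_trans rm)
    then have "norm (u (r (n + k)) - u m) < (1/2)^n"
      using rN[of n] that by (intro N) auto
    then show ?thesis by (simp flip: norm_L2_diff add: power_mono)
  qed
  have *: "square_integrable g \<and> (norm (L2_class g - u m)) \<le> (1/2)^n" if "m \<ge> N n" for n m
  proof -
    have l: "AE x in lborel. (\<lambda>k. L2_fun (u (r (n + k))) x) \<longlonglongrightarrow> g x"
      using lim by eventually_elim (subst add.commute, rule LIMSEQ_ignore_initial_segment)
    note ** = L2_class_limit[OF square_integrable_L2_fun l g square_integrable_L2_fun tail[OF that]]
    have "(norm (L2_class g - L2_class (L2_fun (u m))))\<^sup>2 \<le> ((1/2)^n)^2"
      using ** by (subst norm_L2_class_diff) (auto simp: square_integrable_L2_fun)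
    then show ?thesis using **(1) by (auto intro: power2_le_imp_le)
  qed
  have "u \<longlonglongrightarrow> L2_class g"
  proof (rule LIMSEQ_I)
    fix e :: real assume "0 < e"
    then obtain n where "(1/2)^n < e" using real_arch_pow_inv[of e "1/2"] by auto
    then show "\<exists>no. \<forall>m\<ge>no. norm (u m - L2_class g) < e"
      using * by (metis norm_minus_commute order_le_less_trans)
  qed
  then show ?thesis by (auto simp: convergent_def)
qed

section \<open>The Fourier transform on \<open>L\<^sup>1 \<inter> L\<^sup>2\<close>\<close>

lemma borel_measurable_exp_complex [measurable]: "(exp :: complex \<Rightarrow> complex) \<in> borel_measurable borel"
  by (intro borel_measurable_continuous_onI continuous_intros)

lemma borel_measurable_cnj [measurable]: "cnj \<in> borel_measurable borel"
  by (intro borel_measurable_continuous_onI continuous_intros)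

lemma (in pair_sigma_finite) tensor_integrable:
  fixes f :: "_ \<Rightarrow> complex" and g :: "_ \<Rightarrow> complex"
  assumes "integrable M1 f" "integrable M2 g"
  shows "integrable (M1 \<Otimes>\<^sub>M M2) (\<lambda>p. f (fst p) * g (snd p))"
proof (rule Fubini_integrable)
  show "(\<lambda>p. f (fst p) * g (snd p)) \<in> borel_measurable (M1 \<Otimes>\<^sub>M M2)"
    using assms[THEN borel_measurable_integrable] by measurable
  show "integrable M1 (\<lambda>x. \<integral>y. norm (f (fst (x, y)) * g (snd (x, y))) \<partial>M2)"
    using assms by (simp add: norm_mult)
  show "AE x in M1. integrable M2 (\<lambda>y. f (fst (x, y)) * g (snd (x, y)))"
    using assms by simp
qed

lemma (in pair_sigma_finite) tensor_integral:
  fixes f :: "_ \<Rightarrow> complex" and g :: "_ \<Rightarrow> complex"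
  assumes "integrable M1 f" "integrable M2 g"
  shows "(\<integral>p. f (fst p) * g (snd p) \<partial>(M1 \<Otimes>\<^sub>M M2)) = (\<integral>x. f x \<partial>M1) * (\<integral>y. g y \<partial>M2)"
  using integral_fst'[OF tensor_integrable[OF assms]] assms by simp

definition fourier_L1 :: "(real \<Rightarrow> complex) \<Rightarrow> real \<Rightarrow> complex" where
  "fourier_L1 f k = (\<integral>x. exp (- \<i> * of_real (k * x)) * f x \<partial>lborel) / of_real (sqrt (2 * pi))"

lemma integrable_character:
  assumes "integrable lborel f"
  shows "integrable lborel (\<lambda>x. exp (\<i> * of_real (k * x)) * f x)"
    and "integrable lborel (\<lambda>x. exp (- \<i> * of_real (k * x)) * f x)"
proof -
  have [measurable]: "f \<in> borel_measurable borel" using assms by auto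
  show "integrable lborel (\<lambda>x. exp (\<i> * of_real (k * x)) * f x)"
    by (rule Bochner_Integration.integrable_bound[OF assms]) (auto simp: norm_mult)
  show "integrable lborel (\<lambda>x. exp (- \<i> * of_real (k * x)) * f x)"
    by (rule Bochner_Integration.integrable_bound[OF assms]) (auto simp: norm_mult)
qed

lemma fourier_L1_measurable [measurable]:
  assumes [measurable]: "f \<in> borel_measurable borel"
  shows "fourier_L1 f \<in> borel_measurable borel"
  unfolding fourier_L1_def by measurable

lemma norm_fourier_L1_le:
  assumes "integrable lborel f"
  shows "cmod (fourier_L1 f k) \<le> (\<integral>x. cmod (f x) \<partial>lborel) / sqrt (2 * pi)"
proof -
  have "cmod (\<integral>x. exp (- \<i> * of_real (k * x)) * f x \<partial>lborel) \<le> (\<integral>x. cmod (exp (- \<i> * of_real (k * x)) * f x) \<partial>lborel)"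
    by (rule integral_norm_bound)
  then show ?thesis
    by (simp add: fourier_L1_def norm_divide norm_mult divide_right_mono)
qed

section \<open>Gaussian regularization and the contraction estimate\<close>

lemma fourier_transform_normal_density:
  assumes "0 < s"
  shows "(\<integral>k. exp (\<i> * of_real (t * k)) * of_real (normal_density 0 s k) \<partial>lborel)
    = of_real (exp (- (t * s)\<^sup>2 / 2))"
proof -
  have "(\<integral>k. exp (\<i> * of_real (t * k)) * of_real (normal_density 0 s k) \<partial>lborel)
     = s *\<^sub>R (\<integral>x. exp (\<i> * of_real (t * (s * x))) * of_real (normal_density 0 s (s * x)) \<partial>lborel)"
    using lborel_integral_real_affine[of s "\<lambda>k. exp (\<i> * of_real (t * k)) * of_real (normal_density 0 s k)" 0] assms by simp
  also have "\<dots> = (\<integral>x. s *\<^sub>R (exp (\<i> * of_real (t * (s * x))) * of_real (normal_density 0 s (s * x))) \<partial>lborel)"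
    by simp
  also have "\<dots> = (\<integral>x. std_normal_density x *\<^sub>R iexp ((t * s) * x) \<partial>lborel)"
    using assms by (intro Bochner_Integration.integral_cong)
      (auto simp: normal_density_def power_mult_distrib real_sqrt_mult scaleR_conv_of_real mult_ac)
  also have "\<dots> = char std_normal_distribution (t * s)"
    unfolding char_def by (subst integral_density) auto
  finally show ?thesis by (simp add: char_std_normal_distribution)
qed

lemma normal_density_shift: "normal_density 0 s (x - y) = normal_density y s x"
  "normal_density 0 s (x - y) = normal_density x s y"
  by (simp_all add: normal_density_def power2_commute)

text \<open>Schur's test for the Gaussian convolution kernel.\<close>

lemma gauss_form_bound:
  assumes f: "square_integrable f" and s: "0 < s"
  shows "cmod (\<integral>p. f (fst p) * cnj (f (snd p)) * of_real (normal_density 0 s (fst p - snd p)) \<partial>(lborel \<Otimes>\<^sub>M lborel))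
    \<le> (\<integral>x. (cmod (f x))\<^sup>2 \<partial>lborel)"
proof -
  have [measurable]: "f \<in> borel_measurable borel" using f by (simp add: square_integrable_def)
  let ?A = "\<integral>x. (cmod (f x))\<^sup>2 \<partial>lborel"
  have nn1: "(\<integral>\<^sup>+x. ennreal (normal_density m s x) \<partial>lborel) = 1" for m
    using s by (subst nn_integral_eq_integral) auto
  have fA: "(\<integral>\<^sup>+x. ennreal ((cmod (f x))\<^sup>2) \<partial>lborel) = ennreal ?A"
    using f by (intro nn_integral_eq_integral) (auto simp: square_integrable_def)
  have 1: "(\<integral>\<^sup>+p. ennreal ((cmod (f (fst p)))\<^sup>2) * ennreal (normal_density 0 s (fst p - snd p)) \<partial>(lborel \<Otimes>\<^sub>M lborel)) = ennreal ?A"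
    by (subst lborel.nn_integral_fst[symmetric], measurable) (auto simp: nn_integral_cmult normal_density_shift(2) nn1 fA)
  have 2: "(\<integral>\<^sup>+p. ennreal ((cmod (f (snd p)))\<^sup>2) * ennreal (normal_density 0 s (fst p - snd p)) \<partial>(lborel \<Otimes>\<^sub>M lborel)) = ennreal ?A"
    by (subst lborel_pair.nn_integral_snd[symmetric], measurable) (auto simp: nn_integral_cmult normal_density_shift(1) nn1 fA)
  have "(\<integral>\<^sup>+p. ennreal (2 * cmod (f (fst p) * cnj (f (snd p)) * of_real (normal_density 0 s (fst p - snd p)))) \<partial>(lborel \<Otimes>\<^sub>M lborel))
    \<le> (\<integral>\<^sup>+p. ennreal ((cmod (f (fst p)))\<^sup>2) * ennreal (normal_density 0 s (fst p - snd p))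
         + ennreal ((cmod (f (snd p)))\<^sup>2) * ennreal (normal_density 0 s (fst p - snd p)) \<partial>(lborel \<Otimes>\<^sub>M lborel))"
  proof (intro nn_integral_mono)
    fix p :: "real \<times> real"
    have "2 * (cmod (f (fst p)) * cmod (f (snd p))) \<le> (cmod (f (fst p)))\<^sup>2 + (cmod (f (snd p)))\<^sup>2"
      using sum_squares_bound[of "cmod (f (fst p))" "cmod (f (snd p))"] by simp
    from mult_right_mono[OF this, of "normal_density 0 s (fst p - snd p)"]
    have "2 * (cmod (f (fst p)) * cmod (f (snd p))) * normal_density 0 s (fst p - snd p)
      \<le> (cmod (f (fst p)))\<^sup>2 * normal_density 0 s (fst p - snd p) + (cmod (f (snd p)))\<^sup>2 * normal_density 0 s (fst p - snd p)"
      by (simp add: distrib_right)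
    then show "ennreal (2 * cmod (f (fst p) * cnj (f (snd p)) * of_real (normal_density 0 s (fst p - snd p))))
      \<le> ennreal ((cmod (f (fst p)))\<^sup>2) * ennreal (normal_density 0 s (fst p - snd p))
         + ennreal ((cmod (f (snd p)))\<^sup>2) * ennreal (normal_density 0 s (fst p - snd p))"
      by (simp flip: ennreal_mult ennreal_plus add: norm_mult mult.assoc)
  qed
  also have "\<dots> = ennreal (2 * ?A)"
    by (subst nn_integral_add) (auto simp: 1 2 simp flip: ennreal_plus)
  finally have "(\<integral>\<^sup>+p. ennreal (2 * cmod (f (fst p) * cnj (f (snd p)) * of_real (normal_density 0 s (fst p - snd p)))) \<partial>(lborel \<Otimes>\<^sub>M lborel)) \<le> ennreal (2 * ?A)" .
  from enn2real_mono[OF this]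
  have "(\<integral>p. 2 * cmod (f (fst p) * cnj (f (snd p)) * of_real (normal_density 0 s (fst p - snd p))) \<partial>(lborel \<Otimes>\<^sub>M lborel)) \<le> 2 * ?A"
    by (subst integral_eq_nn_integral) auto
  then have "(\<integral>p. cmod (f (fst p) * cnj (f (snd p)) * of_real (normal_density 0 s (fst p - snd p))) \<partial>(lborel \<Otimes>\<^sub>M lborel)) \<le> ?A"
    by simp
  then show ?thesis by (rule order_trans[OF integral_norm_bound])
qed

text \<open>The squared modulus of the transform is a double integral of
  \<open>f x * cnj (f y)\<close> against exp(i (y - x) k). The Gaussian weight makes the triple
  integral absolutely convergent, so k can be integrated first. This turns the weight of deviation s
  into sqrt(2 pi) / s times the normal density of deviation 1/s in x - y, to which
  \<open>gauss_form_bound\<close> applies.\<close>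

lemma fourier_L1_gauss_bound:
  assumes f1: "integrable lborel f" and f2: "square_integrable f" and s: "0 < s"
  shows "(\<integral>k. normal_density 0 s k * (cmod (fourier_L1 f k))\<^sup>2 \<partial>lborel)
    \<le> (\<integral>x. (cmod (f x))\<^sup>2 \<partial>lborel) / (s * sqrt (2 * pi))"
proof -
  interpret L: pair_sigma_finite lborel "lborel \<Otimes>\<^sub>M lborel :: (real \<times> real) measure" ..
  let ?P = "lborel \<Otimes>\<^sub>M lborel :: (real \<times> real) measure"
  have [measurable]: "f \<in> borel_measurable borel" using f1 by auto
  define F where "F p = f (fst p) * cnj (f (snd p))" for p
  have Fm [measurable]: "F \<in> borel_measurable ?P"
    unfolding F_def by measurable
  have F: "integrable ?P F"
    unfolding F_def using f1 by (intro lborel_pair.tensor_integrable) auto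
  define E where "E k p = exp (\<i> * of_real ((snd p - fst p) * k))" for k :: real and p :: "real \<times> real"
  have sq: "of_real ((cmod (fourier_L1 f k))\<^sup>2) = (\<integral>p. E k p * F p \<partial>?P) / of_real (2 * pi)" for k
  proof -
    have "(\<integral>p. E k p * F p \<partial>?P)
      = (\<integral>p. (exp (- \<i> * of_real (k * fst p)) * f (fst p)) * cnj (exp (- \<i> * of_real (k * snd p)) * f (snd p)) \<partial>?P)"
    proof (intro Bochner_Integration.integral_cong refl)
      fix p :: "real \<times> real"
      have "E k p = exp (- \<i> * of_real (k * fst p)) * cnj (exp (- \<i> * of_real (k * snd p)))"
        by (simp add: E_def exp_cnj flip: exp_add) (simp add: algebra_simps)
      then show "E k p * F p = (exp (- \<i> * of_real (k * fst p)) * f (fst p)) * cnj (exp (- \<i> * of_real (k * snd p)) * f (snd p))"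
        by (simp add: F_def mult_ac)
    qed
    also have "\<dots> = (\<integral>x. exp (- \<i> * of_real (k * x)) * f x \<partial>lborel) * (\<integral>x. cnj (exp (- \<i> * of_real (k * x)) * f x) \<partial>lborel)"
      using integrable_character(2)[OF f1, of k]
      by (intro lborel_pair.tensor_integral integrable_cnj)
    also have "\<dots> = (\<integral>x. exp (- \<i> * of_real (k * x)) * f x \<partial>lborel) * cnj (\<integral>x. exp (- \<i> * of_real (k * x)) * f x \<partial>lborel)"
      by (rule arg_cong[where f = "\<lambda>z. _ * z"], rule Bochner_Integration.integral_cnj)
    also have "\<dots> = of_real (2 * pi) * (fourier_L1 f k * cnj (fourier_L1 f k))"
      by (simp add: fourier_L1_def field_simps flip: of_real_mult)
    finally show ?thesis by (simp add: complex_norm_square flip: complex_norm_square)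
  qed
  have N: "integrable lborel (\<lambda>k. complex_of_real (normal_density 0 s k))" using s by auto
  have int: "integrable (lborel \<Otimes>\<^sub>M ?P) (\<lambda>q. E (fst q) (snd q) * (complex_of_real (normal_density 0 s (fst q)) * F (snd q)))"
    by (rule Bochner_Integration.integrable_bound[OF L.tensor_integrable[OF N F]])
      (auto simp: norm_mult E_def)
  have "complex_of_real (\<integral>k. normal_density 0 s k * (cmod (fourier_L1 f k))\<^sup>2 \<partial>lborel)
    = (\<integral>k. of_real (normal_density 0 s k) * of_real ((cmod (fourier_L1 f k))\<^sup>2) \<partial>lborel)"
    by (simp flip: integral_complex_of_real)
  also have "\<dots> = (\<integral>k. (\<integral>p. E k p * (of_real (normal_density 0 s k) * F p) \<partial>?P) / of_real (2 * pi) \<partial>lborel)"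
  proof (intro Bochner_Integration.integral_cong refl)
    fix k
    have "(\<integral>p. E k p * (of_real (normal_density 0 s k) * F p) \<partial>?P) = of_real (normal_density 0 s k) * (\<integral>p. E k p * F p \<partial>?P)"
      by (simp add: mult.left_commute[of _ "complex_of_real (normal_density 0 s k)"])
    then show "of_real (normal_density 0 s k) * of_real ((cmod (fourier_L1 f k))\<^sup>2)
      = (\<integral>p. E k p * (of_real (normal_density 0 s k) * F p) \<partial>?P) / of_real (2 * pi)"
      unfolding sq by simp
  qed
  also have "\<dots> = (\<integral>k. (\<integral>p. E k p * (of_real (normal_density 0 s k) * F p) \<partial>?P) \<partial>lborel) / of_real (2 * pi)"
    by simp
  also have "(\<integral>k. (\<integral>p. E k p * (of_real (normal_density 0 s k) * F p) \<partial>?P) \<partial>lborel)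
    = (\<integral>p. (\<integral>k. E k p * (of_real (normal_density 0 s k) * F p) \<partial>lborel) \<partial>?P)"
    using L.Fubini_integral[of "\<lambda>k p. E k p * (of_real (normal_density 0 s k) * F p)"] int
    by (simp add: case_prod_beta')
  also have "\<dots> = (\<integral>p. (\<integral>k. E k p * of_real (normal_density 0 s k) \<partial>lborel) * F p \<partial>?P)"
    by (simp flip: mult.assoc)
  also have "\<dots> = (\<integral>p. of_real (sqrt (2 * pi) / s) * (F p * of_real (normal_density 0 (1/s) (fst p - snd p))) \<partial>?P)"
    unfolding E_def fourier_transform_normal_density[OF s] using s
    by (intro Bochner_Integration.integral_cong refl)
      (simp add: normal_density_def power_mult_distrib power_divide real_sqrt_mult real_sqrt_divide power2_commute mult_ac)
  also have "\<dots> = of_real (sqrt (2 * pi) / s) * (\<integral>p. F p * of_real (normal_density 0 (1/s) (fst p - snd p)) \<partial>?P)"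
    by simp
  finally have eq: "complex_of_real (\<integral>k. normal_density 0 s k * (cmod (fourier_L1 f k))\<^sup>2 \<partial>lborel)
    = of_real (sqrt (2 * pi) / s) * (\<integral>p. F p * of_real (normal_density 0 (1/s) (fst p - snd p)) \<partial>?P) / of_real (2 * pi)" .
  have "(\<integral>k. normal_density 0 s k * (cmod (fourier_L1 f k))\<^sup>2 \<partial>lborel)
    \<le> cmod (complex_of_real (\<integral>k. normal_density 0 s k * (cmod (fourier_L1 f k))\<^sup>2 \<partial>lborel))"
    by simp
  also have "\<dots> = sqrt (2 * pi) / s * cmod (\<integral>p. F p * of_real (normal_density 0 (1/s) (fst p - snd p)) \<partial>?P) / (2 * pi)"
    unfolding eq using s by (simp add: norm_mult norm_divide)
  also have "\<dots> \<le> sqrt (2 * pi) / s * (\<integral>x. (cmod (f x))\<^sup>2 \<partial>lborel) / (2 * pi)"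
    using gauss_form_bound[OF f2, of "1/s"] s unfolding F_def
    by (intro divide_right_mono mult_left_mono) auto
  also have "\<dots> = (\<integral>x. (cmod (f x))\<^sup>2 \<partial>lborel) / (s * sqrt (2 * pi))"
    using s real_sqrt_mult_self[of "2 * pi"] by (simp add: field_simps)
  finally show ?thesis .
qed

text \<open>Let the weight in \<open>fourier_L1_gauss_bound\<close> spread out to the constant 1 and
  apply Fatou's lemma.\<close>

lemma fourier_L1_contraction:
  assumes f1: "integrable lborel f" and f2: "square_integrable f"
  shows "square_integrable (fourier_L1 f)"
    and "(\<integral>k. (cmod (fourier_L1 f k))\<^sup>2 \<partial>lborel) \<le> (\<integral>x. (cmod (f x))\<^sup>2 \<partial>lborel)"
proof -
  let ?A = "\<integral>x. (cmod (f x))\<^sup>2 \<partial>lborel"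
  have [measurable]: "f \<in> borel_measurable borel" using f1 by auto
  \<comment> \<open>The uniform bound makes the weighted square integrable before square
    integrability of the transform is known.\<close>
  define B where "B = (\<integral>x. cmod (f x) \<partial>lborel) / sqrt (2 * pi)"
  have B: "(cmod (fourier_L1 f k))\<^sup>2 \<le> B\<^sup>2" for k
    using norm_fourier_L1_le[OF f1, of k] by (intro power_mono) (auto simp: B_def)
  \<comment> \<open>The normal density rescaled to the value 1 at the origin; the scaling factor
    cancels the constant in \<open>fourier_L1_gauss_bound\<close>, so the resulting bound is uniform
    in n.\<close>
  define w where "w n k = exp (- (k / real (Suc n))\<^sup>2 / 2)" for n k
  have w: "w n k = (real (Suc n) * sqrt (2 * pi)) * normal_density 0 (real (Suc n)) k" for n k
    by (simp add: w_def normal_density_def power_divide real_sqrt_mult divide_simps)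
  have le: "(\<integral>\<^sup>+k. ennreal (w n k * (cmod (fourier_L1 f k))\<^sup>2) \<partial>lborel) \<le> ennreal ?A" for n
  proof -
    have i: "integrable lborel (\<lambda>k. normal_density 0 (real (Suc n)) k * (cmod (fourier_L1 f k))\<^sup>2)"
      by (rule Bochner_Integration.integrable_bound[where f = "\<lambda>k. normal_density 0 (real (Suc n)) k * B\<^sup>2"])
        (auto intro!: mult_left_mono B)
    have "(\<integral>k. w n k * (cmod (fourier_L1 f k))\<^sup>2 \<partial>lborel)
      = (real (Suc n) * sqrt (2 * pi)) * (\<integral>k. normal_density 0 (real (Suc n)) k * (cmod (fourier_L1 f k))\<^sup>2 \<partial>lborel)"
      unfolding w mult.assoc by simp
    also have "\<dots> \<le> (real (Suc n) * sqrt (2 * pi)) * (?A / (real (Suc n) * sqrt (2 * pi)))"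
      by (intro mult_left_mono fourier_L1_gauss_bound f1 f2) auto
    also have "\<dots> = ?A" by simp
    finally have "(\<integral>k. w n k * (cmod (fourier_L1 f k))\<^sup>2 \<partial>lborel) \<le> ?A" .
    moreover have "integrable lborel (\<lambda>k. w n k * (cmod (fourier_L1 f k))\<^sup>2)"
      unfolding w mult.assoc by (intro integrable_mult_right i)
    ultimately show ?thesis
      by (subst nn_integral_eq_integral) (auto simp: w_def intro: ennreal_leI)
  qed
  have "(\<integral>\<^sup>+k. ennreal ((cmod (fourier_L1 f k))\<^sup>2) \<partial>lborel)
    = (\<integral>\<^sup>+k. liminf (\<lambda>n. ennreal (w n k * (cmod (fourier_L1 f k))\<^sup>2)) \<partial>lborel)"
  proof (intro nn_integral_cong)
    fix k
    have "(\<lambda>n. k * inverse (real (Suc n))) \<longlonglongrightarrow> k * 0"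
      by (intro tendsto_intros LIMSEQ_inverse_real_of_nat)
    then have t: "(\<lambda>n. k / real (Suc n)) \<longlonglongrightarrow> k * 0"
      by (simp add: divide_inverse)
    have "(\<lambda>n. - (k / real (Suc n))\<^sup>2 / 2) \<longlonglongrightarrow> - (k * 0)\<^sup>2 / 2"
      by (intro tendsto_divide tendsto_minus tendsto_power tendsto_const t) simp
    from this have "(\<lambda>n. ennreal (w n k * (cmod (fourier_L1 f k))\<^sup>2)) \<longlonglongrightarrow> ennreal (exp (- (k * 0)\<^sup>2 / 2) * (cmod (fourier_L1 f k))\<^sup>2)"
      unfolding w_def by (intro tendsto_ennrealI tendsto_mult tendsto_exp tendsto_const)
    then show "ennreal ((cmod (fourier_L1 f k))\<^sup>2) = liminf (\<lambda>n. ennreal (w n k * (cmod (fourier_L1 f k))\<^sup>2))"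
      using lim_imp_Liminf[OF sequentially_bot] by fastforce
  qed
  also have "\<dots> \<le> liminf (\<lambda>n. \<integral>\<^sup>+k. ennreal (w n k * (cmod (fourier_L1 f k))\<^sup>2) \<partial>lborel)"
    by (intro nn_integral_liminf) (auto simp: w_def)
  also have "\<dots> \<le> ennreal ?A"
    using le by (intro Liminf_le) auto
  finally have *: "(\<integral>\<^sup>+k. ennreal ((cmod (fourier_L1 f k))\<^sup>2) \<partial>lborel) \<le> ennreal ?A" .
  have i: "integrable lborel (\<lambda>k. (cmod (fourier_L1 f k))\<^sup>2)"
    by (rule integrableI_bounded) (use * in \<open>auto simp: le_less_trans\<close>)
  then show "square_integrable (fourier_L1 f)" by (simp add: square_integrable_def)
  show "(\<integral>k. (cmod (fourier_L1 f k))\<^sup>2 \<partial>lborel) \<le> ?A"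
    using * i by (subst (asm) nn_integral_eq_integral) auto
qed

section \<open>The Fourier transform on \<open>L\<^sup>2\<close>\<close>

lemma fourier_L1_diff:
  assumes "integrable lborel f" "integrable lborel g"
  shows "fourier_L1 (\<lambda>x. f x - g x) k = fourier_L1 f k - fourier_L1 g k"
  using integrable_character(2)[OF assms(1), of k] integrable_character(2)[OF assms(2), of k]
  by (simp add: fourier_L1_def right_diff_distrib diff_divide_distrib)

lemma fourier_L1_add:
  assumes "integrable lborel f" "integrable lborel g"
  shows "fourier_L1 (\<lambda>x. f x + g x) k = fourier_L1 f k + fourier_L1 g k"
  using integrable_character(2)[OF assms(1), of k] integrable_character(2)[OF assms(2), of k]
  by (simp add: fourier_L1_def distrib_left add_divide_distrib)

lemma fourier_L1_cmult: "fourier_L1 (\<lambda>x. c * f x) k = c * fourier_L1 f k"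
  by (simp add: fourier_L1_def mult.left_commute[of _ c])

lemma fourier_L1_cong:
  assumes "AE x in lborel. f x = g x" "f \<in> borel_measurable borel" "g \<in> borel_measurable borel"
  shows "fourier_L1 f = fourier_L1 g"
proof
  note [measurable] = assms(2,3)
  fix k
  show "fourier_L1 f k = fourier_L1 g k"
    unfolding fourier_L1_def using assms(1)
    by (intro arg_cong2[where f = "(/)"] integral_cong_AE refl) auto
qed

text \<open>Fubini for a symmetric kernel; this is the bilinear precursor of the adjoint relation
  \<open>fourier_L2_inner\<close>.\<close>

lemma multiplication_formula:
  assumes f: "integrable lborel f" and g: "integrable lborel g"
  shows "(\<integral>k. fourier_L1 f k * g k \<partial>lborel) = (\<integral>x. f x * fourier_L1 g x \<partial>lborel)"
proof -
  have [measurable]: "f \<in> borel_measurable borel" "g \<in> borel_measurable borel" using f g by auto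
  let ?E = "\<lambda>x k :: real. exp (- \<i> * of_real (k * x)) :: complex"
  have "integrable (lborel \<Otimes>\<^sub>M lborel) (\<lambda>p. ?E (fst p) (snd p) * (f (fst p) * g (snd p)))"
    by (rule Bochner_Integration.integrable_bound[OF lborel_pair.tensor_integrable[OF f g]])
      (auto simp: norm_mult)
  then have "(\<integral>k. (\<integral>x. ?E x k * (f x * g k) \<partial>lborel) \<partial>lborel) = (\<integral>x. (\<integral>k. ?E x k * (f x * g k) \<partial>lborel) \<partial>lborel)"
    by (intro lborel_pair.Fubini_integral) (simp add: case_prod_beta')
  moreover have "(\<integral>x. ?E x k * (f x * g k) \<partial>lborel) = of_real (sqrt (2 * pi)) * (fourier_L1 f k * g k)" for k
    by (simp add: fourier_L1_def flip: mult.assoc)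
  moreover have "(\<integral>k. ?E x k * (f x * g k) \<partial>lborel) = of_real (sqrt (2 * pi)) * (f x * fourier_L1 g x)" for x
    by (simp add: fourier_L1_def mult.left_commute[of _ "f x"] mult.commute[of x])
  ultimately show ?thesis by simp
qed

section \<open>Truncation and extension to L^2 by density\<close>

definition cutoff :: "nat \<Rightarrow> L2 \<Rightarrow> real \<Rightarrow> complex" where
  "cutoff R u x = indicator {- real R..real R} x *\<^sub>R L2_fun u x"

lemma cutoff_measurable [measurable]: "cutoff R u \<in> borel_measurable borel"
  unfolding cutoff_def by measurable

lemma square_integrable_cutoff: "square_integrable (cutoff R u)"
proof (rule square_integrable_bounded)
  show "integrable lborel (\<lambda>x. (cmod (L2_fun u x))\<^sup>2)"
    using square_integrable_L2_fun by (simp add: square_integrable_def)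
qed (auto simp: cutoff_def indicator_def)

lemma integrable_cutoff: "integrable lborel (cutoff R u)"
proof (rule Bochner_Integration.integrable_bound)
  show "integrable lborel (\<lambda>x. indicator {- real R..real R} x + (cmod (L2_fun u x))\<^sup>2)"
    using square_integrable_L2_fun by (intro Bochner_Integration.integrable_add) (auto simp: square_integrable_def)
  have "y \<le> 1 + y\<^sup>2" for y :: real
    using sum_squares_bound[of 1 y] zero_le_power2[of y] by (cases "y \<ge> 0") (simp, linarith)
  then show "AE x in lborel. norm (cutoff R u x) \<le> norm (indicator {- real R..real R} x + (cmod (L2_fun u x))\<^sup>2)"
    by (auto simp: cutoff_def indicator_def)
qed simp

lemma cutoff_tendsto: "(\<lambda>R. L2_class (cutoff R u)) \<longlonglongrightarrow> u"
proof -
  have "(\<lambda>R. \<integral>x. (cmod (cutoff R u x - L2_fun u x))\<^sup>2 \<partial>lborel) \<longlonglongrightarrow> (\<integral>x. 0 \<partial>(lborel :: real measure))"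
  proof (rule integral_dominated_convergence)
    show "integrable lborel (\<lambda>x. (cmod (L2_fun u x))\<^sup>2)"
      using square_integrable_L2_fun by (simp add: square_integrable_def)
    show "AE x in lborel. (\<lambda>R. (cmod (cutoff R u x - L2_fun u x))\<^sup>2) \<longlonglongrightarrow> 0"
    proof (intro AE_I2 tendsto_eventually)
      fix x :: real
      show "\<forall>\<^sub>F R in sequentially. (cmod (cutoff R u x - L2_fun u x))\<^sup>2 = 0"
        using eventually_ge_at_top[of "nat \<lceil>\<bar>x\<bar>\<rceil>"]
        by eventually_elim (auto simp: cutoff_def indicator_def)
    qed
  qed (auto simp: cutoff_def indicator_def)
  then have "(\<lambda>R. (norm (L2_class (cutoff R u) - L2_class (L2_fun u)))\<^sup>2) \<longlonglongrightarrow> 0"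
    by (subst norm_L2_class_diff) (auto simp: square_integrable_cutoff square_integrable_L2_fun)
  then have "(\<lambda>R. norm (L2_class (cutoff R u) - u)) \<longlonglongrightarrow> 0"
    using tendsto_real_sqrt by fastforce
  then show ?thesis by (simp add: LIM_zero_iff tendsto_norm_zero_iff)
qed

text \<open>Truncations are dense and lie in L^1, so identities between continuous maps need only be
  checked where \<open>fourier_L2\<close> is an explicit integral.\<close>

lemma L2_continuous_eqI:
  fixes A B :: "L2 \<Rightarrow> 'b::t2_space"
  assumes "continuous_on UNIV A" "continuous_on UNIV B"
    and "\<And>f. integrable lborel f \<Longrightarrow> square_integrable f \<Longrightarrow> A (L2_class f) = B (L2_class f)"
  shows "A u = B u"
proof (rule LIMSEQ_unique)
  show "(\<lambda>R. A (L2_class (cutoff R u))) \<longlonglongrightarrow> A u"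
    using assms(1) cutoff_tendsto by (auto intro: continuous_on_tendsto_compose)
  show "(\<lambda>R. A (L2_class (cutoff R u))) \<longlonglongrightarrow> B u"
    using assms(2) cutoff_tendsto
    by (auto simp: assms(3) integrable_cutoff square_integrable_cutoff intro: continuous_on_tendsto_compose)
qed

lemma fourier_truncated_eq: "fourier_truncated R u = fourier_L1 (cutoff R u)"
  by (simp add: fun_eq_iff fourier_truncated_def fourier_L1_def cutoff_def set_lebesgue_integral_def)

lemma norm_fourier_L1_diff_le:
  assumes "integrable lborel f" "square_integrable f" "integrable lborel g" "square_integrable g"
  shows "norm (L2_class (fourier_L1 f) - L2_class (fourier_L1 g)) \<le> norm (L2_class f - L2_class g)"
proof (rule power2_le_imp_le)
  have "(norm (L2_class (fourier_L1 f) - L2_class (fourier_L1 g)))\<^sup>2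
    = (\<integral>k. (cmod (fourier_L1 (\<lambda>x. f x - g x) k))\<^sup>2 \<partial>lborel)"
    using assms by (subst norm_L2_class_diff) (auto simp: fourier_L1_contraction fourier_L1_diff)
  also have "\<dots> \<le> (\<integral>k. (cmod (f k - g k))\<^sup>2 \<partial>lborel)"
    using assms by (intro fourier_L1_contraction) (auto intro: square_integrable_diff)
  also have "\<dots> = (norm (L2_class f - L2_class g))\<^sup>2"
    using assms by (subst norm_L2_class_diff) auto
  finally show "(norm (L2_class (fourier_L1 f) - L2_class (fourier_L1 g)))\<^sup>2 \<le> (norm (L2_class f - L2_class g))\<^sup>2" .
qed simp

text \<open>Contraction makes the transforms of the truncations a Cauchy sequence, and completeness
  provides the limit that \<open>lim\<close> names.\<close>

lemma fourier_L2_tendsto: "(\<lambda>R. L2_class (fourier_L1 (cutoff R u))) \<longlonglongrightarrow> fourier_L2 u"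
proof -
  have "Cauchy (\<lambda>R. L2_class (cutoff R u))"
    using cutoff_tendsto by (rule LIMSEQ_imp_Cauchy)
  then have "Cauchy (\<lambda>R. L2_class (fourier_L1 (cutoff R u)))"
    unfolding Cauchy_iff
    by (meson integrable_cutoff norm_fourier_L1_diff_le order_le_less_trans square_integrable_cutoff)
  then show ?thesis
    by (simp add: L2_Cauchy_convergent fourier_L2_def fourier_truncated_eq flip: convergent_LIMSEQ_iff)
qed

text \<open>Truncation errors are not enlarged by the transform, so the mean-square limit agrees
  with the Fourier integral where the latter converges absolutely.\<close>

lemma fourier_L2_class:
  assumes "integrable lborel f" "square_integrable f"
  shows "fourier_L2 (L2_class f) = L2_class (fourier_L1 f)"
proof (rule LIMSEQ_unique[OF fourier_L2_tendsto])
  show "(\<lambda>R. L2_class (fourier_L1 (cutoff R (L2_class f)))) \<longlonglongrightarrow> L2_class (fourier_L1 f)"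
  proof (rule Lim_transform_bound[of _ "\<lambda>R. norm (L2_class (cutoff R (L2_class f)) - L2_class f)", THEN LIM_zero_cancel])
    show "\<forall>\<^sub>F R in sequentially. norm (L2_class (fourier_L1 (cutoff R (L2_class f))) - L2_class (fourier_L1 f))
      \<le> norm (norm (L2_class (cutoff R (L2_class f)) - L2_class f))"
      using assms by (auto intro!: always_eventually norm_fourier_L1_diff_le simp: integrable_cutoff square_integrable_cutoff)
    show "(\<lambda>R. norm (L2_class (cutoff R (L2_class f)) - L2_class f)) \<longlonglongrightarrow> 0"
      by (intro tendsto_norm_zero LIM_zero cutoff_tendsto)
  qed
qed

lemma norm_fourier_L2_le: "norm (fourier_L2 u) \<le> norm u"
proof (rule LIMSEQ_le[OF tendsto_norm[OF fourier_L2_tendsto] tendsto_norm[OF cutoff_tendsto]])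
  show "\<exists>N. \<forall>n\<ge>N. norm (L2_class (fourier_L1 (cutoff n u))) \<le> norm (L2_class (cutoff n u))"
  proof (intro exI allI impI)
    fix n
    have "(norm (L2_class (fourier_L1 (cutoff n u))))\<^sup>2 \<le> (norm (L2_class (cutoff n u)))\<^sup>2"
      using fourier_L1_contraction[OF integrable_cutoff square_integrable_cutoff, of n u]
      by (simp add: norm_L2_class square_integrable_cutoff)
    then show "norm (L2_class (fourier_L1 (cutoff n u))) \<le> norm (L2_class (cutoff n u))"
      by (rule power2_le_imp_le) simp
  qed
qed

lemma fourier_L2_add: "fourier_L2 (u + v) = fourier_L2 u + fourier_L2 v"
proof (rule LIMSEQ_unique[OF fourier_L2_tendsto])
  have "L2_class (fourier_L1 (cutoff R (u + v)))
      = L2_class (fourier_L1 (cutoff R u)) + L2_class (fourier_L1 (cutoff R v))" for R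
  proof -
    have "fourier_L1 (cutoff R (u + v)) = fourier_L1 (\<lambda>x. cutoff R u x + cutoff R v x)"
      using L2_fun_add[of u v] by (intro fourier_L1_cong) (auto simp: cutoff_def scaleR_add_right)
    then have "fourier_L1 (cutoff R (u + v)) = (\<lambda>k. fourier_L1 (cutoff R u) k + fourier_L1 (cutoff R v) k)"
      by (simp add: fun_eq_iff fourier_L1_add integrable_cutoff)
    then show ?thesis
      by (simp add: L2_class_add fourier_L1_contraction integrable_cutoff square_integrable_cutoff)
  qed
  then show "(\<lambda>R. L2_class (fourier_L1 (cutoff R (u + v)))) \<longlonglongrightarrow> fourier_L2 u + fourier_L2 v"
    by (simp add: tendsto_add fourier_L2_tendsto)
qed

lemma fourier_L2_scaleR: "fourier_L2 (c *\<^sub>R u) = c *\<^sub>R fourier_L2 u"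
proof (rule LIMSEQ_unique[OF fourier_L2_tendsto])
  have "L2_class (fourier_L1 (cutoff R (c *\<^sub>R u))) = c *\<^sub>R L2_class (fourier_L1 (cutoff R u))" for R
  proof -
    have "fourier_L1 (cutoff R (c *\<^sub>R u)) = fourier_L1 (\<lambda>x. of_real c * cutoff R u x)"
      using L2_fun_scaleR[of c u] by (intro fourier_L1_cong) (auto simp: cutoff_def scaleR_conv_of_real)
    then have "fourier_L1 (cutoff R (c *\<^sub>R u)) = (\<lambda>k. c *\<^sub>R fourier_L1 (cutoff R u) k)"
      by (simp add: fun_eq_iff fourier_L1_cmult scaleR_conv_of_real)
    then show ?thesis
      by (simp add: L2_class_scaleR fourier_L1_contraction integrable_cutoff square_integrable_cutoff)
  qed
  then show "(\<lambda>R. L2_class (fourier_L1 (cutoff R (c *\<^sub>R u)))) \<longlonglongrightarrow> c *\<^sub>R fourier_L2 u"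
    by (simp add: tendsto_scaleR fourier_L2_tendsto)
qed

lemma bounded_linear_fourier_L2: "bounded_linear fourier_L2"
  by (rule bounded_linear_intro[where K = 1])
    (auto simp: fourier_L2_add fourier_L2_scaleR norm_fourier_L2_le)

section \<open>Complex conjugation and the adjoint transform\<close>

definition L2_cnj :: "L2 \<Rightarrow> L2" where
  "L2_cnj u = L2_class (\<lambda>x. cnj (L2_fun u x))"

lemma square_integrable_cnj: "square_integrable f \<Longrightarrow> square_integrable (\<lambda>x. cnj (f x))"
  by (rule square_integrable_phase) (auto simp: square_integrable_def)

lemma L2_fun_cnj: "AE x in lborel. L2_fun (L2_cnj u) x = cnj (L2_fun u x)"
  unfolding L2_cnj_def by (intro L2_fun_L2_class square_integrable_cnj square_integrable_L2_fun)

lemma L2_cnj_class: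
  assumes "square_integrable f"
  shows "L2_cnj (L2_class f) = L2_class (\<lambda>x. cnj (f x))"
  unfolding L2_cnj_def
  using L2_fun_L2_class[OF assms] assms
  by (subst L2_class_eq_iff) (auto intro: square_integrable_cnj square_integrable_L2_fun)

lemma L2_cnj_cnj [simp]: "L2_cnj (L2_cnj u) = u"
  unfolding L2_eq_iff using L2_fun_cnj[of u] L2_fun_cnj[of "L2_cnj u"] by eventually_elim simp

lemma orthogonal_L2_cnj: "orthogonal_transformation L2_cnj"
  unfolding orthogonal_transformation
proof (intro conjI allI linearI)
  fix u v :: L2 and c :: real
  show "L2_cnj (u + v) = L2_cnj u + L2_cnj v"
    unfolding L2_eq_iff
    using L2_fun_cnj[of u] L2_fun_cnj[of v] L2_fun_cnj[of "u + v"] L2_fun_add[of u v] L2_fun_add[of "L2_cnj u" "L2_cnj v"]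
    by eventually_elim simp
  show "L2_cnj (c *\<^sub>R u) = c *\<^sub>R L2_cnj u"
    unfolding L2_eq_iff
    using L2_fun_cnj[of u] L2_fun_cnj[of "c *\<^sub>R u"] L2_fun_scaleR[of c u] L2_fun_scaleR[of c "L2_cnj u"]
    by eventually_elim (simp add: scaleR_conv_of_real)
  show "norm (L2_cnj v) = norm v"
    using L2_fun_cnj[of v] by (intro antisym norm_L2_le[of _ 1, simplified]) auto
qed

lemma orthogonal_continuous:
  assumes "orthogonal_transformation A"
  shows "continuous_on S A"
proof -
  have "bounded_linear A"
    using assms unfolding orthogonal_transformation
    by (intro bounded_linear_intro[where K = 1]) (auto simp: linear_add linear_cmul)
  then show ?thesis by (rule linear_continuous_on)
qed

text \<open>Conjugation turns the kernel exp(-ikx) into exp(ikx), so this is the inverse Fourier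
  integral. Writing it through \<open>fourier_L2\<close> gives continuity and isometry without a
  second limit construction.\<close>

definition fourier_adjoint :: "L2 \<Rightarrow> L2" where
  "fourier_adjoint u = L2_cnj (fourier_L2 (L2_cnj u))"

lemma continuous_fourier_L2: "continuous_on S fourier_L2"
  by (rule linear_continuous_on[OF bounded_linear_fourier_L2])

lemma continuous_fourier_adjoint: "continuous_on S fourier_adjoint"
  unfolding fourier_adjoint_def
  by (intro continuous_on_compose2[OF orthogonal_continuous[OF orthogonal_L2_cnj, of UNIV]]
      continuous_on_compose2[OF continuous_fourier_L2[of UNIV]] orthogonal_continuous[OF orthogonal_L2_cnj]) auto

lemma inner_complex_Re: "(a::complex) \<bullet> b = Re (a * cnj b)"
  by (simp add: inner_complex_def)

lemma L2_class_inner_Re: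
  "square_integrable f \<Longrightarrow> square_integrable g \<Longrightarrow> integrable lborel (\<lambda>x. f x * cnj (g x)) \<Longrightarrow>
    L2_class f \<bullet> L2_class g = Re (\<integral>x. f x * cnj (g x) \<partial>lborel)"
  by (simp only: L2_class_inner inner_complex_Re Bochner_Integration.integral_Re)

lemma square_integrable_mult:
  assumes "square_integrable f" "square_integrable g"
  shows "integrable lborel (\<lambda>x. f x * g x)"
proof (rule Bochner_Integration.integrable_bound)
  show "integrable lborel (\<lambda>x. (cmod (f x))\<^sup>2 + (cmod (g x))\<^sup>2)"
    using assms unfolding square_integrable_def by simp
  show "(\<lambda>x. f x * g x) \<in> borel_measurable lborel"
    using assms unfolding square_integrable_def by (intro borel_measurable_times) auto
  have "a * b \<le> a\<^sup>2 + b\<^sup>2" if "0 \<le> a" "0 \<le> b" for a b :: real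
    using sum_squares_bound[of a b] mult_nonneg_nonneg[OF that] by linarith
  then show "AE x in lborel. norm (f x * g x) \<le> norm ((cmod (f x))\<^sup>2 + (cmod (g x))\<^sup>2)"
    by (auto simp: norm_mult)
qed

text \<open>Density in each argument separately reduces the claim to integrable functions, where it
  is \<open>multiplication_formula\<close> with \<open>cnj g\<close> in place of g.\<close>

lemma fourier_L2_inner: "fourier_L2 u \<bullet> v = u \<bullet> fourier_adjoint v"
proof (rule L2_continuous_eqI[of "\<lambda>v. fourier_L2 u \<bullet> v" "\<lambda>v. u \<bullet> fourier_adjoint v"])
  fix g assume g: "integrable lborel g" "square_integrable g"
  show "fourier_L2 u \<bullet> L2_class g = u \<bullet> fourier_adjoint (L2_class g)"
  proof (rule L2_continuous_eqI[of "\<lambda>u. fourier_L2 u \<bullet> L2_class g" "\<lambda>u. u \<bullet> fourier_adjoint (L2_class g)"])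
    fix f assume f: "integrable lborel f" "square_integrable f"
    note g' = integrable_cnj[OF g(1)] square_integrable_cnj[OF g(2)]
    have "fourier_L2 (L2_class f) \<bullet> L2_class g = Re (\<integral>k. fourier_L1 f k * cnj (g k) \<partial>lborel)"
      using f g g' by (simp add: fourier_L2_class L2_class_inner_Re fourier_L1_contraction square_integrable_mult)
    also have "\<dots> = Re (\<integral>x. f x * fourier_L1 (\<lambda>x. cnj (g x)) x \<partial>lborel)"
      using f g' by (simp add: multiplication_formula)
    also have "\<dots> = L2_class f \<bullet> fourier_adjoint (L2_class g)"
      unfolding fourier_adjoint_def using f g g'
      by (simp add: L2_cnj_class fourier_L2_class fourier_L1_contraction L2_class_inner_Re
          square_integrable_mult square_integrable_cnj)
    finally show "fourier_L2 (L2_class f) \<bullet> L2_class g = L2_class f \<bullet> fourier_adjoint (L2_class g)" .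
  qed (intro continuous_intros continuous_fourier_L2)+
qed (intro continuous_intros continuous_fourier_adjoint)+

section \<open>Uniqueness of Fourier transforms\<close>

text \<open>The positive and negative parts have the same characteristic function. Frequency 0 gives
  them the same mass; after normalization \<open>Levy_uniqueness\<close> identifies the two
  probability densities.\<close>

lemma real_fourier_zero:
  fixes a :: "real \<Rightarrow> real"
  assumes a: "integrable lborel a" and zero: "\<And>t. (\<integral>x. a x *\<^sub>R iexp (t * x) \<partial>lborel) = 0"
  shows "AE x in lborel. a x = 0"
proof -
  have [measurable]: "a \<in> borel_measurable borel" using a by auto
  define p where "p x = max 0 (a x)" for x
  define q where "q x = max 0 (- a x)" for x
  have [measurable]: "p \<in> borel_measurable borel" "q \<in> borel_measurable borel"
    unfolding p_def q_def by measurable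
  have p0: "0 \<le> p x" and q0: "0 \<le> q x" and apq: "a x = p x - q x" for x
    by (auto simp: p_def q_def)
  have p: "integrable lborel p" and q: "integrable lborel q"
    unfolding p_def q_def using a by auto
  have char_eq: "(\<integral>x. p x *\<^sub>R iexp (t * x) \<partial>lborel) = (\<integral>x. q x *\<^sub>R iexp (t * x) \<partial>lborel)" for t
  proof -
    have "integrable lborel (\<lambda>x. p x *\<^sub>R iexp (t * x))" "integrable lborel (\<lambda>x. q x *\<^sub>R iexp (t * x))"
      by (rule Bochner_Integration.integrable_bound[OF p], auto)
        (rule Bochner_Integration.integrable_bound[OF q], auto)
    then show ?thesis using zero[of t] by (simp add: apq scaleR_diff_left)
  qed
  define m where "m = (\<integral>x. p x \<partial>lborel)"
  have m: "m = (\<integral>x. q x \<partial>lborel)"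
  proof -
    have "complex_of_real m = of_real (\<integral>x. q x \<partial>lborel)"
      using char_eq[of 0] by (simp add: m_def scaleR_conv_of_real)
    then show ?thesis by (simp only: of_real_eq_iff)
  qed
  show ?thesis
  \<comment> \<open>Normalization by m requires positive mass; for mass zero both parts vanish
    outright.\<close>
  proof (cases "m = 0")
    case True
    then have "AE x in lborel. p x = 0" "AE x in lborel. q x = 0"
      using integral_nonneg_eq_0_iff_AE[OF p] integral_nonneg_eq_0_iff_AE[OF q] p0 q0 m m_def by auto
    then show ?thesis by eventually_elim (simp add: apq)
  next
    case False
    then have m0: "0 < m" using p0 by (simp add: m_def order_less_le)
    have dist: "real_distribution (density lborel (\<lambda>x. ennreal (h x / m)))"
      if "integrable lborel h" "\<And>x. 0 \<le> h x" "(\<integral>x. h x \<partial>lborel) = m" for h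
    proof -
      have "(\<integral>\<^sup>+x. ennreal (h x / m) \<partial>lborel) = ennreal (\<integral>x. h x / m \<partial>lborel)"
        using that m0 by (intro nn_integral_eq_integral) auto
      then have "prob_space (density lborel (\<lambda>x. ennreal (h x / m)))"
        using that m0 by (intro prob_spaceI) (simp add: emeasure_density)
      then show ?thesis by (simp add: real_distribution_def real_distribution_axioms_def)
    qed
    have ch: "char (density lborel (\<lambda>x. ennreal (h x / m))) t = (\<integral>x. h x *\<^sub>R iexp (t * x) \<partial>lborel) /\<^sub>R m"
      if "integrable lborel h" "\<And>x. 0 \<le> h x" for h t
    proof -
      have [measurable]: "h \<in> borel_measurable borel" using that by auto
      have "char (density lborel (\<lambda>x. ennreal (h x / m))) t = (\<integral>x. (h x / m) *\<^sub>R iexp (t * x) \<partial>lborel)"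
        unfolding char_def using that m0 by (subst integral_density) auto
      also have "\<dots> = (\<integral>x. inverse m *\<^sub>R (h x *\<^sub>R iexp (t * x)) \<partial>lborel)"
        by (simp add: divide_inverse mult.commute)
      finally show ?thesis by (simp only: Bochner_Integration.integral_scaleR_right)
    qed
    have "density lborel (\<lambda>x. ennreal (p x / m)) = density lborel (\<lambda>x. ennreal (q x / m))"
    proof (rule Levy_uniqueness)
      show "char (density lborel (\<lambda>x. ennreal (p x / m))) = char (density lborel (\<lambda>x. ennreal (q x / m)))"
        by (simp only: fun_eq_iff ch[OF p p0] ch[OF q q0] char_eq simp_thms)
    qed (rule dist[OF p p0 m_def[symmetric]] dist[OF q q0 m[symmetric]])+
    then have "AE x in lborel. ennreal (p x / m) = ennreal (q x / m)"
      by (rule sigma_finite_measure.density_unique[OF sigma_finite_lborel, rotated 2]) auto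
    then show ?thesis
      by eventually_elim (use m0 p0 q0 in \<open>simp add: apq\<close>)

  qed
qed

text \<open>Conjugating the hypothesis at frequency -t shows that the transform of
  \<open>cnj h\<close> vanishes as well, hence so do those of the real and imaginary parts.\<close>

lemma fourier_zero:
  assumes h: "integrable lborel h" and zero: "\<And>t. (\<integral>x. exp (\<i> * of_real (t * x)) * h x \<partial>lborel) = 0"
  shows "AE x in lborel. h x = 0"
proof -
  have zero': "(\<integral>x. exp (\<i> * of_real (t * x)) * cnj (h x) \<partial>lborel) = 0" for t
  proof -
    have "(\<integral>x. exp (\<i> * of_real (t * x)) * cnj (h x) \<partial>lborel) = (\<integral>x. cnj (exp (\<i> * of_real (- t * x)) * h x) \<partial>lborel)"
      by (simp add: exp_cnj)
    also have "\<dots> = cnj (\<integral>x. exp (\<i> * of_real (- t * x)) * h x \<partial>lborel)"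
      by (rule Bochner_Integration.integral_cnj)
    finally show ?thesis using zero[of "- t"] by simp
  qed
  have i: "integrable lborel (\<lambda>x. exp (\<i> * of_real (t * x)) * h x)"
    "integrable lborel (\<lambda>x. exp (\<i> * of_real (t * x)) * cnj (h x))" for t
    by (intro integrable_character integrable_cnj h)+
  have "AE x in lborel. Re (h x) = 0"
  proof (rule real_fourier_zero)
    fix t
    have "(\<integral>x. Re (h x) *\<^sub>R iexp (t * x) \<partial>lborel)
      = (\<integral>x. (exp (\<i> * of_real (t * x)) * h x + exp (\<i> * of_real (t * x)) * cnj (h x)) / 2 \<partial>lborel)"
      by (intro Bochner_Integration.integral_cong refl)
        (simp only: distrib_left[symmetric] complex_add_cnj, simp add: scaleR_conv_of_real)
    also have "\<dots> = 0" using i zero zero' by simp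
    finally show "(\<integral>x. Re (h x) *\<^sub>R iexp (t * x) \<partial>lborel) = 0" .
  qed (use h in auto)
  moreover have "AE x in lborel. Im (h x) = 0"
  proof (rule real_fourier_zero)
    fix t
    have "(\<integral>x. Im (h x) *\<^sub>R iexp (t * x) \<partial>lborel)
      = (\<integral>x. (exp (\<i> * of_real (t * x)) * h x - exp (\<i> * of_real (t * x)) * cnj (h x)) / (2 * \<i>) \<partial>lborel)"
      by (intro Bochner_Integration.integral_cong refl)
        (simp only: right_diff_distrib[symmetric] complex_diff_cnj, simp add: scaleR_conv_of_real mult_ac flip: mult.assoc[of \<i> \<i>])
    also have "\<dots> = 0" using i zero zero' by simp
    finally show "(\<integral>x. Im (h x) *\<^sub>R iexp (t * x) \<partial>lborel) = 0" .
  qed (use h in auto)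
  ultimately show ?thesis by eventually_elim (simp add: complex_eq_iff)
qed

section \<open>Plancherel's theorem and the free Schroedinger group\<close>

text \<open>The complex amplitude compensates for \<open>inner\<close> being only the real part of
  the Hermitian product: c = 1 and c = i together recover the complex pairing.\<close>

definition gauss_packet :: "complex \<Rightarrow> real \<Rightarrow> real \<Rightarrow> complex" where
  "gauss_packet c t x = c * (exp (\<i> * of_real (t * x)) * of_real (exp (- x\<^sup>2 / 2)))"

lemma gauss_packet_measurable [measurable]: "gauss_packet c t \<in> borel_measurable borel"
  unfolding gauss_packet_def by measurable

lemma gauss_shift_integrable: "integrable lborel (\<lambda>x. exp (- (x - m :: real)\<^sup>2 / 2))"
proof -
  have "integrable lborel (\<lambda>x. sqrt (2 * pi) * normal_density m 1 x)"
    by (intro integrable_mult_right) simp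
  then show ?thesis by (simp add: normal_density_def)
qed

lemma integrable_gauss_packet: "integrable lborel (gauss_packet c t)"
  by (rule Bochner_Integration.integrable_bound[OF integrable_mult_right[OF gauss_shift_integrable[of 0], of "cmod c"]])
    (auto simp: gauss_packet_def norm_mult)

lemma square_integrable_gauss_shift: "square_integrable (\<lambda>x. c * of_real (exp (- (x - m)\<^sup>2 / 2)))"
proof (rule square_integrable_bounded[OF _ integrable_mult_right[OF gauss_shift_integrable[of m], of "(cmod c)\<^sup>2"]])
  fix x
  have "(exp (- (x - m)\<^sup>2 / 2))\<^sup>2 \<le> exp (- (x - m)\<^sup>2 / 2) * 1"
    unfolding power2_eq_square[of "exp _"] by (intro mult_left_mono) auto
  then show "(cmod (c * of_real (exp (- (x - m)\<^sup>2 / 2))))\<^sup>2 \<le> (cmod c)\<^sup>2 * exp (- (x - m)\<^sup>2 / 2)"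
    by (simp add: norm_mult power_mult_distrib mult_left_mono)
qed measurable

lemma square_integrable_gauss_packet: "square_integrable (gauss_packet c t)"
  by (rule square_integrable_phase[OF square_integrable_gauss_shift[of c 0]])
    (auto simp: gauss_packet_def norm_mult)

lemma fourier_L1_gauss: "fourier_L1 (\<lambda>x. of_real (exp (- x\<^sup>2 / 2))) k = of_real (exp (- k\<^sup>2 / 2))"
proof -
  have "(\<integral>x. exp (- \<i> * of_real (k * x)) * complex_of_real (exp (- x\<^sup>2 / 2)) \<partial>lborel)
    = of_real (sqrt (2 * pi)) * (\<integral>x. exp (\<i> * of_real (- k * x)) * of_real (normal_density 0 1 x) \<partial>lborel)"
    by (subst integral_mult_right_zero[symmetric], intro Bochner_Integration.integral_cong refl)
      (simp add: normal_density_def)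
  also have "\<dots> = of_real (sqrt (2 * pi)) * of_real (exp (- k\<^sup>2 / 2))"
    by (subst fourier_transform_normal_density) auto
  finally show ?thesis by (simp add: fourier_L1_def)
qed

lemma fourier_L1_gauss_packet:
  "fourier_L1 (gauss_packet c t) k = c * of_real (exp (- (k - t)\<^sup>2 / 2))"
proof -
  have "fourier_L1 (gauss_packet c t) k = c * fourier_L1 (\<lambda>x. exp (\<i> * of_real (t * x)) * of_real (exp (- x\<^sup>2 / 2))) k"
    unfolding gauss_packet_def by (rule fourier_L1_cmult)
  also have "fourier_L1 (\<lambda>x. exp (\<i> * of_real (t * x)) * of_real (exp (- x\<^sup>2 / 2))) k
    = fourier_L1 (\<lambda>x. of_real (exp (- x\<^sup>2 / 2))) (k - t)"
    unfolding fourier_L1_def mult.assoc[symmetric] exp_add[symmetric] by (simp add: algebra_simps)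
  finally show ?thesis by (simp only: fourier_L1_gauss)
qed

lemma fourier_L1_gauss_shift:
  "fourier_L1 (\<lambda>x. c * of_real (exp (- (x - t)\<^sup>2 / 2))) k = gauss_packet c (- t) k"
proof -
  have "(\<integral>x. exp (- \<i> * of_real (k * x)) * complex_of_real (exp (- (x - t)\<^sup>2 / 2)) \<partial>lborel)
    = (\<integral>x. exp (- \<i> * of_real (k * (t + x))) * of_real (exp (- x\<^sup>2 / 2)) \<partial>lborel)"
    using lborel_integral_real_affine[of 1 "\<lambda>x. exp (- \<i> * of_real (k * x)) * complex_of_real (exp (- (x - t)\<^sup>2 / 2))" t]
    by simp
  also have "\<dots> = exp (- \<i> * of_real (k * t)) * (\<integral>x. exp (- \<i> * of_real (k * x)) * of_real (exp (- x\<^sup>2 / 2)) \<partial>lborel)"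
  proof (subst integral_mult_right_zero[symmetric], intro Bochner_Integration.integral_cong refl)
    fix x
    have "exp (- \<i> * complex_of_real (k * (t + x))) = exp (- \<i> * of_real (k * t)) * exp (- \<i> * of_real (k * x))"
      unfolding exp_add[symmetric] by (simp add: algebra_simps)
    then show "exp (- \<i> * of_real (k * (t + x))) * complex_of_real (exp (- x\<^sup>2 / 2))
      = exp (- \<i> * of_real (k * t)) * (exp (- \<i> * of_real (k * x)) * of_real (exp (- x\<^sup>2 / 2)))"
      by (simp only: mult.assoc)
  qed
  finally have "fourier_L1 (\<lambda>x. of_real (exp (- (x - t)\<^sup>2 / 2))) k
    = exp (- \<i> * of_real (k * t)) * of_real (exp (- k\<^sup>2 / 2))"
    using fourier_L1_gauss[of k] by (simp only: fourier_L1_def times_divide_eq_right[symmetric])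
  then show ?thesis
    by (simp add: fourier_L1_cmult gauss_packet_def mult.commute)
qed

text \<open>The transform exchanges modulation and translation, and exp(-x^2/2) is its own
  transform. So the packet of frequency t goes to a Gaussian centred at t, and the adjoint, whose
  conjugations restore the sign of the frequency, brings it back.\<close>

lemma fourier_adjoint_gauss_packet:
  "fourier_adjoint (fourier_L2 (L2_class (gauss_packet c t))) = L2_class (gauss_packet c t)"
proof -
  let ?g = "\<lambda>k. c * of_real (exp (- (k - t)\<^sup>2 / 2))"
  have "fourier_L1 (gauss_packet c t) = ?g"
    by (rule ext) (rule fourier_L1_gauss_packet)
  then have F: "fourier_L2 (L2_class (gauss_packet c t)) = L2_class ?g"
    by (simp only: fourier_L2_class integrable_gauss_packet square_integrable_gauss_packet)
  have "L2_cnj (L2_class ?g) = L2_class (\<lambda>k. cnj c * of_real (exp (- (k - t)\<^sup>2 / 2)))"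
    by (simp only: L2_cnj_class square_integrable_gauss_shift complex_cnj_mult complex_cnj_complex_of_real)
  moreover have "integrable lborel (\<lambda>k. cnj c * of_real (exp (- (k - t)\<^sup>2 / 2)))"
    by (intro integrable_mult_right integrable_of_real gauss_shift_integrable)
  moreover have "fourier_L1 (\<lambda>k. cnj c * of_real (exp (- (k - t)\<^sup>2 / 2))) = gauss_packet (cnj c) (- t)"
    by (rule ext) (rule fourier_L1_gauss_shift)
  ultimately have "fourier_L2 (L2_cnj (L2_class ?g)) = L2_class (gauss_packet (cnj c) (- t))"
    using square_integrable_gauss_shift[of "cnj c" t]
    by (simp only: fourier_L2_class)
  then have "fourier_adjoint (L2_class ?g) = L2_class (\<lambda>x. cnj (gauss_packet (cnj c) (- t) x))"
    by (simp add: fourier_adjoint_def L2_cnj_class square_integrable_gauss_packet)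
  also have "(\<lambda>x. cnj (gauss_packet (cnj c) (- t) x)) = gauss_packet c t"
    by (simp add: fun_eq_iff gauss_packet_def exp_cnj)
  finally show ?thesis by (simp only: F)
qed

text \<open>Orthogonality to all \<open>gauss_packet c t\<close> says that \<open>w\<close> times a Gaussian has vanishing
  Fourier transform.\<close>

lemma gauss_packets_total:
  assumes orth: "\<And>c t. w \<bullet> L2_class (gauss_packet c t) = 0"
  shows "w = 0"
proof -
  let ?W = "L2_fun w"
  have int: "integrable lborel (\<lambda>x. ?W x * cnj (gauss_packet c t x))" for c t
    by (intro square_integrable_mult square_integrable_L2_fun square_integrable_cnj square_integrable_gauss_packet)
  have re: "Re (\<integral>x. ?W x * cnj (gauss_packet c t x) \<partial>lborel) = 0" for c t
    using L2_class_inner_Re[OF square_integrable_L2_fun square_integrable_gauss_packet int] orth[of c t] by simp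
  have "(\<integral>x. ?W x * cnj (gauss_packet \<i> t x) \<partial>lborel) = - \<i> * (\<integral>x. ?W x * cnj (gauss_packet 1 t x) \<partial>lborel)" for t
    by (subst integral_mult_right_zero[symmetric], intro Bochner_Integration.integral_cong refl)
      (simp add: gauss_packet_def)
  with re[of 1] re[of \<i>] have z: "(\<integral>x. ?W x * cnj (gauss_packet 1 t x) \<partial>lborel) = 0" for t
    by (simp add: complex_eq_iff)
  have "AE x in lborel. ?W x * cnj (gauss_packet 1 0 x) = 0"
  proof (rule fourier_zero[OF int])
    fix t
    have "(\<integral>x. exp (\<i> * of_real (t * x)) * (?W x * cnj (gauss_packet 1 0 x)) \<partial>lborel)
      = (\<integral>x. ?W x * cnj (gauss_packet 1 (- t) x) \<partial>lborel)"
      by (intro Bochner_Integration.integral_cong refl) (simp add: gauss_packet_def exp_cnj mult_ac)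
    then show "(\<integral>x. exp (\<i> * of_real (t * x)) * (?W x * cnj (gauss_packet 1 0 x)) \<partial>lborel) = 0"
      using z by simp
  qed
  then have "AE x in lborel. ?W x = 0"
    by eventually_elim (simp add: gauss_packet_def)
  with L2_fun_L2_class[OF square_integrable_zero] show ?thesis
    unfolding L2_eq_iff L2_class_zero by eventually_elim simp
qed

lemma fourier_adjoint_fourier_L2 [simp]: "fourier_adjoint (fourier_L2 u) = u"
proof -
  have "(fourier_adjoint (fourier_L2 u) - u) \<bullet> v = 0" if "fourier_adjoint (fourier_L2 v) = v" for v
  proof -
    have "fourier_adjoint (fourier_L2 u) \<bullet> v = v \<bullet> fourier_adjoint (fourier_L2 u)"
      by (rule inner_commute)
    also have "\<dots> = fourier_L2 v \<bullet> fourier_L2 u"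
      by (simp add: fourier_L2_inner)
    also have "\<dots> = fourier_L2 u \<bullet> fourier_L2 v"
      by (rule inner_commute)
    also have "\<dots> = u \<bullet> v"
      by (simp add: fourier_L2_inner that)
    finally show ?thesis by (simp add: inner_diff_left)
  qed
  then show ?thesis
    using gauss_packets_total[of "fourier_adjoint (fourier_L2 u) - u"] fourier_adjoint_gauss_packet by simp
qed

text \<open>Conjugating the left inverse identity by \<open>L2_cnj\<close> exchanges
  \<open>fourier_L2\<close> and \<open>fourier_adjoint\<close>. This gives surjectivity, so that
  \<open>inv fourier_L2\<close> is a genuine inverse.\<close>

lemma fourier_L2_fourier_adjoint [simp]: "fourier_L2 (fourier_adjoint u) = u"
proof -
  have "L2_cnj (fourier_adjoint (fourier_L2 (L2_cnj u))) = u" by simp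
  then show ?thesis by (simp add: fourier_adjoint_def del: fourier_adjoint_fourier_L2)
qed

lemma inv_fourier_L2: "inv fourier_L2 = fourier_adjoint"
  by (rule inv_unique_comp) (auto simp: fun_eq_iff)

lemma orthogonal_fourier_L2: "orthogonal_transformation fourier_L2"
  unfolding orthogonal_transformation_def
  by (simp add: fourier_L2_inner linearI fourier_L2_add fourier_L2_scaleR)

lemma orthogonal_fourier_adjoint: "orthogonal_transformation fourier_adjoint"
proof -
  have eq: "fourier_adjoint = L2_cnj \<circ> (fourier_L2 \<circ> L2_cnj)"
    by (simp add: fun_eq_iff fourier_adjoint_def)
  show ?thesis
    unfolding eq by (intro orthogonal_transformation_compose orthogonal_L2_cnj orthogonal_fourier_L2)
qed

section \<open>Unimodular multipliers and translations\<close>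

text \<open>One class covers the symbol of the free group, the characters that represent
  translations, and the constant i that serves as complex structure.\<close>

definition unimodular :: "(real \<Rightarrow> complex) \<Rightarrow> bool" where
  "unimodular m \<longleftrightarrow> m \<in> borel_measurable borel \<and> (\<forall>x. cmod (m x) = 1)"

definition L2_mult :: "(real \<Rightarrow> complex) \<Rightarrow> L2 \<Rightarrow> L2" where
  "L2_mult m u = L2_class (\<lambda>x. m x * L2_fun u x)"

lemma square_integrable_unimodular:
  assumes "unimodular m" "square_integrable f"
  shows "square_integrable (\<lambda>x. m x * f x)"
proof (rule square_integrable_phase[OF assms(2)])
  show "(\<lambda>x. m x * f x) \<in> borel_measurable lborel"
    using assms unfolding unimodular_def square_integrable_def by (intro borel_measurable_times) auto
qed (use assms in \<open>auto simp: unimodular_def norm_mult\<close>)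

lemma L2_mult_fun:
  assumes "unimodular m"
  shows "AE x in lborel. L2_fun (L2_mult m u) x = m x * L2_fun u x"
  unfolding L2_mult_def
  by (intro L2_fun_L2_class square_integrable_unimodular assms square_integrable_L2_fun)

lemma L2_mult_class:
  assumes "unimodular m" "square_integrable f"
  shows "L2_mult m (L2_class f) = L2_class (\<lambda>x. m x * f x)"
  unfolding L2_mult_def using L2_fun_L2_class[OF assms(2)] assms
  by (subst L2_class_eq_iff) (auto intro: square_integrable_unimodular square_integrable_L2_fun)

lemma orthogonal_L2_mult:
  assumes "unimodular m"
  shows "orthogonal_transformation (L2_mult m)"
  unfolding orthogonal_transformation
proof (intro conjI allI linearI)
  fix u v :: L2 and c :: real
  note AE = L2_mult_fun[OF assms]
  show "L2_mult m (u + v) = L2_mult m u + L2_mult m v"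
    unfolding L2_eq_iff
    using AE[of u] AE[of v] AE[of "u + v"] L2_fun_add[of u v] L2_fun_add[of "L2_mult m u" "L2_mult m v"]
    by eventually_elim (simp add: distrib_left)
  show "L2_mult m (c *\<^sub>R u) = c *\<^sub>R L2_mult m u"
    unfolding L2_eq_iff
    using AE[of u] AE[of "c *\<^sub>R u"] L2_fun_scaleR[of c u] L2_fun_scaleR[of c "L2_mult m u"]
    by eventually_elim simp
  have eq: "AE x in lborel. cmod (L2_fun (L2_mult m v) x) = cmod (L2_fun v x)"
    using AE[of v] by eventually_elim (use assms in \<open>simp add: unimodular_def norm_mult\<close>)
  show "norm (L2_mult m v) = norm v"
    by (intro antisym norm_L2_le[of _ 1, simplified]; use eq in eventually_elim) auto
qed

lemma L2_mult_L2_mult: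
  assumes "unimodular m" "unimodular m'"
  shows "L2_mult m (L2_mult m' u) = L2_mult (\<lambda>x. m x * m' x) u"
  unfolding L2_mult_def[of m'] L2_mult_def[of "\<lambda>x. m x * m' x"]
  using assms by (subst L2_mult_class) (auto intro: square_integrable_unimodular square_integrable_L2_fun simp: mult.assoc)

lemma L2_mult_one: "L2_mult (\<lambda>x. 1) u = u"
  by (simp add: L2_mult_def)

definition L2_translate :: "real \<Rightarrow> L2 \<Rightarrow> L2" where
  "L2_translate h u = L2_class (\<lambda>x. L2_fun u (x + h))"

lemma square_integrable_translate:
  assumes "square_integrable f"
  shows "square_integrable (\<lambda>x. f (x + h))"
  using assms lborel_integrable_real_affine[of "\<lambda>x. (cmod (f x))\<^sup>2" 1 h]
  by (auto simp: square_integrable_def add.commute)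

lemma L2_translate_fun: "AE x in lborel. L2_fun (L2_translate h u) x = L2_fun u (x + h)"
  unfolding L2_translate_def
  by (intro L2_fun_L2_class square_integrable_translate square_integrable_L2_fun)

lemma AE_translate:
  assumes "AE x in lborel. f x = g x" and [measurable]: "f \<in> borel_measurable borel" "g \<in> borel_measurable borel"
  shows "AE x in lborel. f (x + h :: real) = (g (x + h) :: complex)"
  using AE_borel_affine[of 1 "\<lambda>x. f x = g x" h] assms(1) by (simp add: add.commute)

lemma L2_translate_class:
  assumes "square_integrable f"
  shows "L2_translate h (L2_class f) = L2_class (\<lambda>x. f (x + h))"
  unfolding L2_translate_def
  using AE_translate[OF L2_fun_L2_class[OF assms], of h] assms
  by (subst L2_class_eq_iff) (auto simp: square_integrable_def[of f] intro: square_integrable_translate square_integrable_L2_fun)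

lemma orthogonal_L2_translate: "orthogonal_transformation (L2_translate h)"
  unfolding orthogonal_transformation
proof (intro conjI allI linearI)
  fix u v :: L2 and c :: real
  note si = square_integrable_L2_fun
  have *: "L2_translate h (L2_class f) = L2_class (\<lambda>x. f (x + h))" if "square_integrable f" for f
    using that by (rule L2_translate_class)
  have "L2_translate h (u + v) = L2_translate h (L2_class (\<lambda>x. L2_fun u x + L2_fun v x))"
    using L2_class_add[OF si[of u] si[of v]] by simp
  also have "\<dots> = L2_class (\<lambda>x. L2_fun u (x + h) + L2_fun v (x + h))"
    by (rule *) (intro square_integrable_add si)
  also have "\<dots> = L2_translate h u + L2_translate h v"
    by (simp add: L2_translate_def L2_class_add square_integrable_translate si)
  finally show "L2_translate h (u + v) = L2_translate h u + L2_translate h v" .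
  have "L2_translate h (c *\<^sub>R u) = L2_translate h (L2_class (\<lambda>x. c *\<^sub>R L2_fun u x))"
    using L2_class_scaleR[OF si[of u], of c] by simp
  also have "\<dots> = L2_class (\<lambda>x. c *\<^sub>R L2_fun u (x + h))"
    by (rule *) (intro square_integrable_scaleR si)
  also have "\<dots> = c *\<^sub>R L2_translate h u"
    by (simp only: L2_translate_def L2_class_scaleR square_integrable_translate si)
  finally show "L2_translate h (c *\<^sub>R u) = c *\<^sub>R L2_translate h u" .
  have "(norm (L2_translate h v))\<^sup>2 = (\<integral>x. (cmod (L2_fun v (x + h)))\<^sup>2 \<partial>lborel)"
    unfolding L2_translate_def by (simp add: norm_L2_class square_integrable_translate si)
  also have "\<dots> = (norm v)\<^sup>2"
    using lborel_integral_real_affine[of 1 "\<lambda>x. (cmod (L2_fun v x))\<^sup>2" h]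
    by (simp add: norm_L2_eq add.commute)
  finally show "norm (L2_translate h v) = norm v" by simp
qed

lemma unimodular_exp: "unimodular (\<lambda>k. exp (\<i> * of_real (h * k)))" "unimodular (\<lambda>k. exp (- \<i> * of_real (a * k\<^sup>2)))"
  by (auto simp: unimodular_def)

lemma unimodular_const: "unimodular (\<lambda>k. \<i>)"
  by (auto simp: unimodular_def)

lemma integrable_translate:
  fixes f :: "real \<Rightarrow> complex"
  assumes "integrable lborel f"
  shows "integrable lborel (\<lambda>x. f (x + h))"
  using lborel_integrable_real_affine[OF assms, of 1 h] by (simp add: add.commute)

lemma orthogonal_continuous_compose:
  assumes "orthogonal_transformation A" "orthogonal_transformation B"
  shows "continuous_on S (\<lambda>u. A (B u))"
  using orthogonal_continuous[OF orthogonal_transformation_compose[OF assms]] by (simp add: comp_def)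

text \<open>Being Fourier multipliers, translations commute with the free flow, which therefore
  passes translation estimates on.\<close>

lemma fourier_L2_translate:
  "fourier_L2 (L2_translate h u) = L2_mult (\<lambda>k. exp (\<i> * of_real (h * k))) (fourier_L2 u)"
proof (rule L2_continuous_eqI[of "\<lambda>u. fourier_L2 (L2_translate h u)"])
  fix f assume f: "integrable lborel f" "square_integrable f"
  have "fourier_L1 (\<lambda>x. f (x + h)) = (\<lambda>k. exp (\<i> * of_real (h * k)) * fourier_L1 f k)"
  proof
    fix k
    have "(\<integral>x. exp (- \<i> * of_real (k * x)) * f x \<partial>lborel) = (\<integral>x. exp (- \<i> * of_real (k * (h + x))) * f (h + x) \<partial>lborel)"
      using lborel_integral_real_affine[of 1 "\<lambda>x. exp (- \<i> * of_real (k * x)) * f x" h] by simp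
    then have "exp (\<i> * of_real (h * k)) * (\<integral>x. exp (- \<i> * of_real (k * x)) * f x \<partial>lborel)
      = (\<integral>x. exp (\<i> * of_real (h * k)) * (exp (- \<i> * of_real (k * (h + x))) * f (h + x)) \<partial>lborel)"
      by simp
    also have "\<dots> = (\<integral>x. exp (- \<i> * of_real (k * x)) * f (x + h) \<partial>lborel)"
      unfolding mult.assoc[symmetric] exp_add[symmetric] by (simp add: algebra_simps)
    finally show "fourier_L1 (\<lambda>x. f (x + h)) k = exp (\<i> * of_real (h * k)) * fourier_L1 f k"
      by (simp add: fourier_L1_def)
  qed
  then show "fourier_L2 (L2_translate h (L2_class f)) = L2_mult (\<lambda>k. exp (\<i> * of_real (h * k))) (fourier_L2 (L2_class f))"
    using f by (simp add: L2_translate_class fourier_L2_class square_integrable_translate integrable_translate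
        L2_mult_class unimodular_exp fourier_L1_contraction del: of_real_mult)
qed (intro orthogonal_continuous_compose orthogonal_fourier_L2 orthogonal_L2_translate orthogonal_L2_mult unimodular_exp)+

text \<open>With \<open>fourier_L2_scaleR\<close> this is complex linearity; it takes the form of a
  commutation because \<open>L2\<close> carries only a real vector space structure.\<close>

lemma fourier_L2_imaginary: "fourier_L2 (L2_mult (\<lambda>k. \<i>) u) = L2_mult (\<lambda>k. \<i>) (fourier_L2 u)"
proof (rule L2_continuous_eqI[of "\<lambda>u. fourier_L2 (L2_mult (\<lambda>k. \<i>) u)"])
  fix f assume f: "integrable lborel f" "square_integrable f"
  have "fourier_L1 (\<lambda>x. \<i> * f x) = (\<lambda>k. \<i> * fourier_L1 f k)"
    by (simp add: fun_eq_iff fourier_L1_cmult)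
  then show "fourier_L2 (L2_mult (\<lambda>k. \<i>) (L2_class f)) = L2_mult (\<lambda>k. \<i>) (fourier_L2 (L2_class f))"
    using f square_integrable_unimodular[OF unimodular_const f(2)]
    by (simp add: L2_mult_class unimodular_const fourier_L2_class fourier_L1_contraction)
qed (intro orthogonal_continuous_compose orthogonal_fourier_L2 orthogonal_L2_mult unimodular_const)+

section \<open>The free group as a Fourier multiplier\<close>

lemma schroedinger_multiplier_eq: "schroedinger_multiplier a = L2_mult (\<lambda>k. exp (- \<i> * of_real (a * k\<^sup>2)))"
proof
  fix u
  show "schroedinger_multiplier a u = L2_mult (\<lambda>k. exp (- \<i> * of_real (a * k\<^sup>2))) u"
    using schroedinger_multiplier.abs_eq[of "L2_fun u" a] square_integrable_L2_fun
    by (simp add: L2_rel_refl L2_mult_def flip: L2_class_def)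
qed

lemma free_schroedinger_eq:
  "free_schroedinger a u = fourier_adjoint (L2_mult (\<lambda>k. exp (- \<i> * of_real (a * k\<^sup>2))) (fourier_L2 u))"
  by (simp add: free_schroedinger_def inv_fourier_L2 schroedinger_multiplier_eq)

lemma orthogonal_free_schroedinger: "orthogonal_transformation (free_schroedinger a)"
proof -
  have eq: "free_schroedinger a = fourier_adjoint \<circ> (L2_mult (\<lambda>k. exp (- \<i> * of_real (a * k\<^sup>2))) \<circ> fourier_L2)"
    by (simp add: fun_eq_iff free_schroedinger_eq)
  show ?thesis
    unfolding eq by (intro orthogonal_transformation_compose orthogonal_fourier_adjoint orthogonal_fourier_L2
        orthogonal_L2_mult unimodular_exp)
qed

lemma free_schroedinger_inverse: "free_schroedinger (- a) (free_schroedinger a u) = u"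
proof -
  have "(\<lambda>k. exp (- \<i> * of_real (- a * k\<^sup>2)) * exp (- \<i> * of_real (a * k\<^sup>2))) = (\<lambda>k. 1)"
    by (simp flip: exp_add)
  then show ?thesis
    by (simp only: free_schroedinger_eq fourier_L2_fourier_adjoint L2_mult_L2_mult unimodular_exp
        L2_mult_one fourier_adjoint_fourier_L2)
qed

lemma fourier_L2_eq_iff: "fourier_L2 u = fourier_L2 v \<longleftrightarrow> u = v"
  by (metis fourier_adjoint_fourier_L2)

text \<open>On the Fourier side both maps are pointwise multiplications, which commute. It is
  applied to translations and to multiplication by i.\<close>

lemma free_schroedinger_commute:
  assumes "\<And>u. fourier_L2 (A u) = L2_mult m (fourier_L2 u)" "unimodular m"
  shows "free_schroedinger a (A u) = A (free_schroedinger a u)"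
proof -
  have "fourier_L2 (free_schroedinger a (A u)) = fourier_L2 (A (free_schroedinger a u))"
    unfolding free_schroedinger_eq assms(1) fourier_L2_fourier_adjoint
    by (simp only: L2_mult_L2_mult unimodular_exp assms(2) mult.commute)
  then show ?thesis by (simp only: fourier_L2_eq_iff)
qed

section \<open>A Sobolev embedding\<close>

lemma square_integrable_indicator:
  "square_integrable f \<Longrightarrow> square_integrable (\<lambda>x. indicator {a..<b} x *\<^sub>R f x)"
  by (rule square_integrable_bounded[of _ "\<lambda>x. (cmod (f x))\<^sup>2"])
    (auto simp: square_integrable_def indicator_def)

lemma square_integrable_unit_interval: "square_integrable (\<lambda>x. indicator {0..<1} x *\<^sub>R c)"
proof (rule square_integrable_bounded)
  show "integrable lborel (\<lambda>x. (cmod c)\<^sup>2 * indicator {0..<1::real} x)" by simp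
qed (auto simp: indicator_def)

lemma integrable_indicator_square_integrable:
  assumes "square_integrable f"
  shows "integrable lborel (\<lambda>x. indicator {0..<1} x *\<^sub>R f x)"
  using square_integrable_mult[OF square_integrable_unit_interval[of 1] assms]
  by (simp add: scaleR_conv_of_real)

lemma unit_interval_Cauchy_Schwarz:
  assumes f: "square_integrable f"
  shows "(cmod (\<integral>x. indicator {0..<1} x *\<^sub>R f x \<partial>lborel))\<^sup>2
    \<le> (\<integral>x. indicator {0..<1} x * (cmod (f x))\<^sup>2 \<partial>lborel)"
proof -
  let ?g = "\<lambda>x. indicator {0..<1} x *\<^sub>R f x"
  \<comment> \<open>Pairing with the constant z, the integral itself, produces the square of its
    modulus; one factor is cancelled at the end.\<close>
  define z where "z = (\<integral>x. ?g x \<partial>lborel)"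
  have g: "square_integrable ?g" by (rule square_integrable_indicator[OF f])
  have int: "integrable lborel (\<lambda>x. ?g x * cnj (indicator {0..<1} x *\<^sub>R z))"
    by (intro square_integrable_mult g square_integrable_cnj square_integrable_unit_interval)
  have "(\<integral>x. ?g x * cnj (indicator {0..<1} x *\<^sub>R z) \<partial>lborel) = (\<integral>x. ?g x * cnj z \<partial>lborel)"
    by (intro Bochner_Integration.integral_cong refl) (simp add: indicator_def)
  also have "\<dots> = z * cnj z" unfolding z_def by (rule Bochner_Integration.integral_mult_left_zero)
  finally have "L2_class ?g \<bullet> L2_class (\<lambda>x. indicator {0..<1} x *\<^sub>R z) = (cmod z)\<^sup>2"
    using L2_class_inner_Re[OF g square_integrable_unit_interval int]
    by (simp flip: complex_norm_square)
  then have "(cmod z)\<^sup>2 \<le> norm (L2_class ?g) * norm (L2_class (\<lambda>x. indicator {0..<1} x *\<^sub>R z))"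
    using norm_cauchy_schwarz by metis
  also have "norm (L2_class (\<lambda>x. indicator {0..<1} x *\<^sub>R z)) = cmod z"
  proof -
    have "(cmod (indicator {0..<1} x *\<^sub>R z))\<^sup>2 = indicator {0..<1} x *\<^sub>R (cmod z)\<^sup>2" for x :: real
      by (cases "x \<in> {0..<1}") simp_all
    then have "(norm (L2_class (\<lambda>x. indicator {0..<1} x *\<^sub>R z)))\<^sup>2 = (\<integral>x. indicator {0..<1::real} x *\<^sub>R (cmod z)\<^sup>2 \<partial>lborel)"
      by (simp only: norm_L2_class[OF square_integrable_unit_interval])
    also have "\<dots> = (cmod z)\<^sup>2" by simp
    finally show ?thesis by simp
  qed
  finally have "cmod z * cmod z \<le> norm (L2_class ?g) * cmod z"
    by (simp add: power2_eq_square)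
  then have "cmod z \<le> norm (L2_class ?g)"
    by (cases "cmod z = 0") auto
  then have "(cmod z)\<^sup>2 \<le> (norm (L2_class ?g))\<^sup>2" by (intro power_mono) auto
  also have "\<dots> = (\<integral>x. indicator {0..<1} x * (cmod (f x))\<^sup>2 \<partial>lborel)"
    unfolding norm_L2_class[OF g]
    by (intro Bochner_Integration.integral_cong refl) (simp add: indicator_def)
  finally show ?thesis by (simp add: z_def)
qed

section \<open>Dyadic averages\<close>

text \<open>The mean of g over the interval from x to x + r, for positive r, rescaled to the unit
  interval. With a half-open interval the two halves tile it exactly.\<close>

definition average :: "(real \<Rightarrow> complex) \<Rightarrow> real \<Rightarrow> real \<Rightarrow> complex" where
  "average g r x = (\<integral>t. indicator {0..<1} t *\<^sub>R g (x + r * t) \<partial>lborel)"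

lemma square_integrable_affine:
  assumes "square_integrable g" "0 < r"
  shows "square_integrable (\<lambda>t. g (x + r * t))"
  using assms lborel_integrable_real_affine[of "\<lambda>x. (cmod (g x))\<^sup>2" r x]
  by (auto simp: square_integrable_def)

text \<open>Cauchy-Schwarz on the unit interval; the substitution y = x + r t costs the factor 1 /
  r. The bound blows up for small r, so it is used only at the top scale and on differences that are
  themselves small.\<close>

lemma average_bound:
  assumes g: "square_integrable g" and r: "0 < r"
  shows "cmod (average g r x) \<le> norm (L2_class g) / sqrt r"
proof (rule power2_le_imp_le)
  note a = square_integrable_affine[OF g r, of x]
  have "(cmod (average g r x))\<^sup>2 \<le> (\<integral>t. indicator {0..<1} t * (cmod (g (x + r * t)))\<^sup>2 \<partial>lborel)"
    unfolding average_def by (rule unit_interval_Cauchy_Schwarz[OF a])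
  also have "\<dots> \<le> (\<integral>t. (cmod (g (x + r * t)))\<^sup>2 \<partial>lborel)"
  proof (rule integral_mono)
    show "integrable lborel (\<lambda>t. indicator {0..<1} t * (cmod (g (x + r * t)))\<^sup>2)"
      by (rule Bochner_Integration.integrable_bound[of _ "\<lambda>t. (cmod (g (x + r * t)))\<^sup>2"])
        (use a in \<open>auto simp: square_integrable_def indicator_def\<close>)
  qed (use a in \<open>auto simp: square_integrable_def indicator_def\<close>)
  also have "\<dots> = (norm (L2_class g))\<^sup>2 / r"
    using lborel_integral_real_affine[of r "\<lambda>y. (cmod (g y))\<^sup>2" x] r
    by (simp add: norm_L2_class[OF g])
  finally show "(cmod (average g r x))\<^sup>2 \<le> (norm (L2_class g) / sqrt r)\<^sup>2"
    using r by (simp add: power_divide)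
qed (use r in auto)

lemma average_halve:
  assumes g: "square_integrable g" and r: "0 < r"
  shows "average g r x = (average g (r / 2) x + average g (r / 2) (x + r / 2)) / 2"
proof -
  let ?F1 = "\<lambda>t. indicator {0..<1} (2 * t) *\<^sub>R g (x + r * t)"
  let ?F2 = "\<lambda>t. indicator {0..<1} (2 * t - 1) *\<^sub>R g (x + r * t)"
  have i: "integrable lborel (\<lambda>t. indicator {0..<1} t *\<^sub>R g (y + r / 2 * t))" for y
    using r by (intro integrable_indicator_square_integrable square_integrable_affine g) auto
  have F1: "integrable lborel ?F1"
    using i[of x] lborel_integrable_real_affine_iff[of "1/2" ?F1 0] by simp
  have F2: "integrable lborel ?F2"
    using i[of "x + r / 2"] lborel_integrable_real_affine_iff[of "1/2" ?F2 "1/2"]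
    by (simp add: algebra_simps)
  have "average g r x = (\<integral>t. ?F1 t + ?F2 t \<partial>lborel)"
    unfolding average_def by (intro Bochner_Integration.integral_cong refl) (auto simp: indicator_def)
  also have "\<dots> = (\<integral>t. ?F1 t \<partial>lborel) + (\<integral>t. ?F2 t \<partial>lborel)"
    using F1 F2 by (rule Bochner_Integration.integral_add)
  also have "(\<integral>t. ?F1 t \<partial>lborel) = average g (r / 2) x / 2"
    using lborel_integral_real_affine[of "1/2" ?F1 0]
    by (simp add: average_def scaleR_conv_of_real)
  also have "(\<integral>t. ?F2 t \<partial>lborel) = average g (r / 2) (x + r / 2) / 2"
    using lborel_integral_real_affine[of "1/2" ?F2 "1/2"]
    by (simp add: average_def algebra_simps)
  finally show ?thesis by simp
qed

text \<open>By difference quotients this characterizes H^1, with K in the role of the norm of the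
  derivative. It is formulated with translations because both substeps commute with them.\<close>

definition L2_lipschitz :: "real \<Rightarrow> L2 \<Rightarrow> bool" where
  "L2_lipschitz K u \<longleftrightarrow> (\<forall>h. norm (L2_translate h u - u) \<le> K * \<bar>h\<bar>)"

lemma L2_lipschitzD: "L2_lipschitz K u \<Longrightarrow> norm (L2_translate h u - u) \<le> K * \<bar>h\<bar>"
  by (simp add: L2_lipschitz_def)

lemma L2_lipschitz_nonneg: "L2_lipschitz K u \<Longrightarrow> 0 \<le> K"
  using L2_lipschitzD[of K u 1] order_trans[OF norm_ge_zero] by auto

text \<open>The difference is half the mean, over length r/2, of u minus its shift by r/2. That
  function has norm at most K r/2, which beats the factor (r/2)^(-1/2) from
  \<open>average_bound\<close>.\<close>

lemma average_halve_diff: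
  assumes u: "L2_lipschitz K u" and r: "0 < r"
  shows "cmod (average (L2_fun u) (r / 2) x - average (L2_fun u) r x) \<le> K / 2 * sqrt (r / 2)"
proof -
  let ?f = "L2_fun u"
  let ?g = "\<lambda>y. ?f y - ?f (y + r / 2)"
  note si = square_integrable_L2_fun[of u]
  have g: "square_integrable ?g"
    by (intro square_integrable_diff si square_integrable_translate)
  have i: "integrable lborel (\<lambda>t. indicator {0..<1} t *\<^sub>R ?f (y + r / 2 * t))" for y
    using r by (intro integrable_indicator_square_integrable square_integrable_affine si) auto
  have "average ?f (r / 2) x - average ?f r x = (average ?f (r / 2) x - average ?f (r / 2) (x + r / 2)) / 2"
    unfolding average_halve[OF si r] by (simp add: field_simps)
  also have "average ?f (r / 2) x - average ?f (r / 2) (x + r / 2) = average ?g (r / 2) x"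
    using i[of x] i[of "x + r / 2"]
    by (simp add: average_def scaleR_diff_right add_ac)
  finally have "cmod (average ?f (r / 2) x - average ?f r x) = cmod (average ?g (r / 2) x) / 2"
    by (simp only: norm_divide norm_numeral)
  also have "\<dots> \<le> norm (L2_class ?g) / sqrt (r / 2) / 2"
    using average_bound[OF g, of "r / 2" x] r by (intro divide_right_mono) auto
  also have "L2_class ?g = - (L2_translate (r / 2) u - u)"
    using L2_class_diff[OF si square_integrable_translate[OF si, of "r / 2"]]
    by (simp add: L2_translate_def)
  also have "norm (- (L2_translate (r / 2) u - u)) = norm (L2_translate (r / 2) u - u)"
    by (rule norm_minus_cancel)
  also have "\<dots> / sqrt (r / 2) / 2 \<le> (K * (r / 2)) / sqrt (r / 2) / 2"
    using L2_lipschitzD[OF u, of "r / 2"] r by (intro divide_right_mono) auto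
  also have "\<dots> = K / 2 * (r / 2 / sqrt (r / 2))"
    using r by (simp add: field_simps)
  also have "r / 2 / sqrt (r / 2) = sqrt (r / 2)"
    using r by (intro real_div_sqrt) simp
  finally show ?thesis .
qed

text \<open>Telescoping over dyadic scales: the starting average costs
  \<open>norm u / sqrt s\<close>, and the successive corrections form a geometric series
  proportional to \<open>K * sqrt s\<close>. The scale s stays free, to be chosen small when
  \<open>norm u\<close> is small.\<close>

lemma average_sup_bound:
  assumes u: "L2_lipschitz K u" and s: "0 < s"
  shows "cmod (average (L2_fun u) (s / 2 ^ j) x) \<le> norm u / sqrt s + 2 * K * sqrt s"
proof -
  note K = L2_lipschitz_nonneg[OF u]
  \<comment> \<open>The ratio of consecutive corrections. The bound 4/5 gives
    \<open>q / 2 \<le> 2 * (1 - q)\<close>, so each correction is at most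
    \<open>2 * K * sqrt s\<close> times a difference of consecutive powers of q, and these
    differences telescope.\<close>
  define q :: real where "q = sqrt (1 / 2)"
  have q: "0 \<le> q" "q \<le> 4 / 5"
  proof -
    show "q \<le> 4 / 5" unfolding q_def by (rule real_le_lsqrt) (simp_all add: power2_eq_square)
  qed (simp add: q_def)
  have "cmod (average (L2_fun u) (s / 2 ^ j) x) \<le> norm u / sqrt s + 2 * K * sqrt s * (1 - q ^ j)"
  proof (induction j)
    case 0
    show ?case using average_bound[OF square_integrable_L2_fun s, of u x] by simp
  next
    case (Suc j)
    have eq: "sqrt (s / 2 ^ j / 2) = sqrt s * q ^ j * q"
      by (simp add: q_def real_sqrt_divide real_sqrt_mult real_sqrt_power power_divide)
    have "cmod (average (L2_fun u) (s / 2 ^ j / 2) x - average (L2_fun u) (s / 2 ^ j) x)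
      \<le> K / 2 * (sqrt s * q ^ j * q)"
      unfolding eq[symmetric] using s by (intro average_halve_diff[OF u]) simp
    also have "\<dots> = (K * sqrt s * q ^ j) * (q / 2)" by simp
    also have "\<dots> \<le> (K * sqrt s * q ^ j) * (2 * (1 - q))"
      using K s q by (intro mult_left_mono) auto
    finally have "cmod (average (L2_fun u) (s / 2 ^ j / 2) x - average (L2_fun u) (s / 2 ^ j) x)
      \<le> 2 * K * sqrt s * (q ^ j - q ^ Suc j)" by (simp add: algebra_simps)
    then have "cmod (average (L2_fun u) (s / 2 ^ j / 2) x)
      \<le> norm u / sqrt s + 2 * K * sqrt s * (1 - q ^ j) + 2 * K * sqrt s * (q ^ j - q ^ Suc j)"
      using Suc norm_triangle_sub[of "average (L2_fun u) (s / 2 ^ j / 2) x" "average (L2_fun u) (s / 2 ^ j) x"]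
      by linarith
    also have "\<dots> = norm u / sqrt s + 2 * K * sqrt s * (1 - q ^ Suc j)"
      by (simp add: algebra_simps)
    finally show ?case by (simp add: mult.commute[of 2])
  qed
  also have "\<dots> \<le> norm u / sqrt s + 2 * K * sqrt s * 1"
    using K s q by (intro add_left_mono mult_left_mono) auto
  finally show ?thesis by simp
qed

lemma average_measurable [measurable]:
  assumes [measurable]: "g \<in> borel_measurable borel"
  shows "average g r \<in> borel_measurable borel"
  unfolding average_def by measurable

text \<open>By Cauchy-Schwarz the square passes inside the average; after exchanging the integrals,
  each shift r t with t < 1 contributes at most (K r)^2. Nonnegative integrals allow the exchange
  before integrability is known.\<close>

lemma average_approx:
  assumes u: "L2_lipschitz K u" and r: "0 < r"
  shows "(\<integral>\<^sup>+x. ennreal ((cmod (average (L2_fun u) r x - L2_fun u x))\<^sup>2) \<partial>lborel) \<le> ennreal ((K * r)\<^sup>2)"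
proof -
  note K = L2_lipschitz_nonneg[OF u]
  let ?f = "L2_fun u"
  note si = square_integrable_L2_fun[of u]
  have "(\<integral>\<^sup>+x. ennreal ((cmod (average ?f r x - ?f x))\<^sup>2) \<partial>lborel)
    \<le> (\<integral>\<^sup>+x. \<integral>\<^sup>+t. indicator {0..<1} t * ennreal ((cmod (?f (x + r * t) - ?f x))\<^sup>2) \<partial>lborel \<partial>lborel)"
  proof (rule nn_integral_mono)
    fix x
    let ?g = "\<lambda>t. indicator {0..<1} t *\<^sub>R ?f (x + r * t) - indicator {0..<1} t *\<^sub>R ?f x"
    have a: "square_integrable (\<lambda>t. ?f (x + r * t))"
      by (rule square_integrable_affine[OF si r])
    have g: "square_integrable ?g"
      using square_integrable_diff[OF square_integrable_indicator[OF a] square_integrable_unit_interval] .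
    have "average ?f r x - ?f x = (\<integral>t. ?g t \<partial>lborel)"
      using integrable_indicator_square_integrable[OF square_integrable_affine[OF si r, of x]]
      by (simp add: average_def)
    also have "\<dots> = (\<integral>t. indicator {0..<1} t *\<^sub>R ?g t \<partial>lborel)"
      by (intro Bochner_Integration.integral_cong refl) (simp add: indicator_def)
    finally have "(cmod (average ?f r x - ?f x))\<^sup>2 \<le> (\<integral>t. indicator {0..<1} t * (cmod (?g t))\<^sup>2 \<partial>lborel)"
      using unit_interval_Cauchy_Schwarz[OF g] by simp
    also have "\<dots> = (\<integral>t. (cmod (?g t))\<^sup>2 \<partial>lborel)"
      by (intro Bochner_Integration.integral_cong refl) (simp add: indicator_def)
    finally have "ennreal ((cmod (average ?f r x - ?f x))\<^sup>2) \<le> ennreal (\<integral>t. (cmod (?g t))\<^sup>2 \<partial>lborel)"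
      by (rule ennreal_leI)
    also have "\<dots> = (\<integral>\<^sup>+t. ennreal ((cmod (?g t))\<^sup>2) \<partial>lborel)"
      using g by (intro nn_integral_eq_integral[symmetric]) (auto simp: square_integrable_def)
    also have "\<dots> = (\<integral>\<^sup>+t. indicator {0..<1} t * ennreal ((cmod (?f (x + r * t) - ?f x))\<^sup>2) \<partial>lborel)"
      by (intro nn_integral_cong) (simp add: indicator_def)
    finally show "ennreal ((cmod (average ?f r x - ?f x))\<^sup>2)
      \<le> (\<integral>\<^sup>+t. indicator {0..<1} t * ennreal ((cmod (?f (x + r * t) - ?f x))\<^sup>2) \<partial>lborel)" .
  qed
  also have "\<dots> = (\<integral>\<^sup>+t. \<integral>\<^sup>+x. indicator {0..<1} t * ennreal ((cmod (?f (x + r * t) - ?f x))\<^sup>2) \<partial>lborel \<partial>lborel)"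
    by (rule lborel_pair.Fubini') measurable
  also have "\<dots> \<le> (\<integral>\<^sup>+t. indicator {0..<1::real} t * ennreal ((K * r)\<^sup>2) \<partial>lborel)"
  proof (rule nn_integral_mono)
    fix t :: real
    have "(\<integral>\<^sup>+x. ennreal ((cmod (?f (x + r * t) - ?f x))\<^sup>2) \<partial>lborel)
      = ennreal ((norm (L2_class (\<lambda>x. ?f (x + r * t)) - L2_class ?f))\<^sup>2)"
      by (subst norm_L2_class_diff)
        (auto intro!: nn_integral_eq_integral square_integrable_norm_diff square_integrable_translate si)
    also have "\<dots> = ennreal ((norm (L2_translate (r * t) u - u))\<^sup>2)"
      by (simp add: L2_translate_def)
    also have "\<dots> \<le> ennreal ((K * \<bar>r * t\<bar>)\<^sup>2)"
      by (intro ennreal_leI power_mono L2_lipschitzD u) auto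
    finally have le: "(\<integral>\<^sup>+x. ennreal ((cmod (?f (x + r * t) - ?f x))\<^sup>2) \<partial>lborel) \<le> ennreal ((K * \<bar>r * t\<bar>)\<^sup>2)" .
    show "(\<integral>\<^sup>+x. indicator {0..<1} t * ennreal ((cmod (?f (x + r * t) - ?f x))\<^sup>2) \<partial>lborel)
      \<le> indicator {0..<1} t * ennreal ((K * r)\<^sup>2)"
    proof (cases "t \<in> {0..<1}")
      case True
      then have "(K * \<bar>r * t\<bar>)\<^sup>2 \<le> (K * r)\<^sup>2"
        using K r by (intro power_mono mult_left_mono) (auto simp: mult_le_cancel_left1)
      then show ?thesis
        using True order_trans[OF le ennreal_leI] by simp
    qed simp
  qed
  also have "\<dots> = ennreal ((K * r)\<^sup>2)"
    by (simp add: nn_integral_multc)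
  finally show ?thesis .
qed

text \<open>The dyadic averages are uniformly bounded and converge to \<open>u\<close> in mean square, hence almost
  everywhere along a subsequence.\<close>

lemma L2_lipschitz_bounded:
  assumes u: "L2_lipschitz K u" and s: "0 < s"
  shows "AE x in lborel. cmod (L2_fun u x) \<le> norm u / sqrt s + 2 * K * sqrt s"
proof -
  let ?d = "\<lambda>j x. (cmod (average (L2_fun u) (s / 2 ^ j) x - L2_fun u x))\<^sup>2"
  have i: "integrable lborel (?d j)" for j
  proof (rule integrableI_bounded)
    have "(\<integral>\<^sup>+x. ennreal (norm (?d j x)) \<partial>lborel) \<le> ennreal ((K * (s / 2 ^ j))\<^sup>2)"
      using average_approx[OF u, of "s / 2 ^ j"] s by simp
    also have "\<dots> < \<infinity>" by simp
    finally show "(\<integral>\<^sup>+x. ennreal (norm (?d j x)) \<partial>lborel) < \<infinity>" .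
  qed measurable
  have le: "(\<integral>x. ?d j x \<partial>lborel) \<le> (K * (s / 2 ^ j))\<^sup>2" for j
    using average_approx[OF u, of "s / 2 ^ j"] s
    by (simp add: nn_integral_eq_integral[OF i[of j]])
  have lim: "(\<lambda>j. (K * (s / 2 ^ j))\<^sup>2) \<longlonglongrightarrow> 0"
  proof -
    have "(\<lambda>j. (K * (s * (1 / 2) ^ j))\<^sup>2) \<longlonglongrightarrow> (K * (s * 0))\<^sup>2"
      by (intro tendsto_intros LIMSEQ_realpow_zero) auto
    then show ?thesis by (simp add: power_divide)
  qed
  have "(\<lambda>j. \<integral>x. ?d j x \<partial>lborel) \<longlonglongrightarrow> 0"
  proof (rule tendsto_sandwich[OF _ _ tendsto_const lim])
    show "\<forall>\<^sub>F j in sequentially. (\<integral>x. ?d j x \<partial>lborel) \<le> (K * (s / 2 ^ j))\<^sup>2"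
      by (rule always_eventually) (use le in blast)
    show "\<forall>\<^sub>F j in sequentially. 0 \<le> (\<integral>x. ?d j x \<partial>lborel)"
      by (rule always_eventually) (simp add: Bochner_Integration.integral_nonneg)
  qed
  then have "(\<lambda>j. \<integral>x. norm (?d j x) \<partial>lborel) \<longlonglongrightarrow> 0" by simp
  from tendsto_L1_AE_subseq[OF i this] obtain r where "AE x in lborel. (\<lambda>j. ?d (r j) x) \<longlonglongrightarrow> 0" by auto
  then show ?thesis
  proof eventually_elim
    case (elim x)
    from tendsto_real_sqrt[OF elim] have "(\<lambda>j. average (L2_fun u) (s / 2 ^ r j) x) \<longlonglongrightarrow> L2_fun u x"
      by (simp add: tendsto_norm_zero_iff LIM_zero_iff)
    from tendsto_norm[OF this] show ?case
      by (rule LIMSEQ_le_const2) (use average_sup_bound[OF u s] in auto)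
  qed
qed

lemma cmod_exp_i_diff_le: "cmod (exp (\<i> * of_real x) - 1) \<le> \<bar>x\<bar>"
  using iexp_approx1[of x 0] by simp

text \<open>On the Fourier side, translation minus identity is multiplication by exp(i h k) - 1, of
  modulus at most |h k|. So the norm of k times the transform of u serves as K.\<close>

lemma L2_lipschitz_H1:
  assumes "u \<in> sobolev_H1"
  shows "\<exists>K. L2_lipschitz K u"
proof -
  let ?v = "\<lambda>k. of_real k * L2_fun (fourier_L2 u) k"
  have v: "square_integrable ?v" using assms by (simp add: sobolev_H1_def)
  have "norm (L2_translate h u - u) \<le> \<bar>h\<bar> * norm (L2_class ?v)" for h
  proof -
    let ?m = "\<lambda>k. exp (\<i> * of_real (h * k))"
    have "norm (L2_translate h u - u) = norm (fourier_L2 (L2_translate h u - u))"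
      using orthogonal_fourier_L2 by (simp add: orthogonal_transformation)
    also have "\<dots> = norm (L2_mult ?m (fourier_L2 u) - fourier_L2 u)"
      using bounded_linear.linear[OF bounded_linear_fourier_L2] by (simp add: linear_diff fourier_L2_translate)
    also have "\<dots> \<le> \<bar>h\<bar> * norm (L2_class ?v)"
    proof (rule norm_L2_le)
      show "AE k in lborel. cmod (L2_fun (L2_mult ?m (fourier_L2 u) - fourier_L2 u) k) \<le> \<bar>h\<bar> * cmod (L2_fun (L2_class ?v) k)"
        using L2_fun_diff[of "L2_mult ?m (fourier_L2 u)" "fourier_L2 u"] L2_mult_fun[OF unimodular_exp(1)[of h], of "fourier_L2 u"] L2_fun_L2_class[OF v]
      proof eventually_elim
        case (elim k)
        have "L2_fun (L2_mult ?m (fourier_L2 u) - fourier_L2 u) k = (?m k - 1) * L2_fun (fourier_L2 u) k"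
          unfolding elim(1,2) by (simp add: algebra_simps)
        then have "cmod (L2_fun (L2_mult ?m (fourier_L2 u) - fourier_L2 u) k) \<le> \<bar>h * k\<bar> * cmod (L2_fun (fourier_L2 u) k)"
          using mult_right_mono[OF cmod_exp_i_diff_le[of "h * k"], of "cmod (L2_fun (fourier_L2 u) k)"]
          by (simp add: norm_mult)
        then show ?case unfolding elim(3) by (simp add: norm_mult abs_mult mult.assoc)
      qed
    qed simp
    finally show ?thesis .
  qed
  then show ?thesis unfolding L2_lipschitz_def by (metis mult.commute)
qed

section \<open>The nonlinear step\<close>

text \<open>Compactness of the ball times the closed unit ball of directions bounds the derivative
  on unit directions; homogeneity does the rest.\<close>

lemma C1_bounded_on_cball:
  fixes f :: "complex \<Rightarrow> complex"
  assumes lin: "\<And>z. linear (f' z)" and cont: "continuous_on UNIV (\<lambda>p. f' (fst p) (snd p))"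
  obtains L where "0 \<le> L" "\<And>z v. cmod z \<le> C \<Longrightarrow> cmod (f' z v) \<le> L * cmod v"
proof -
  let ?K = "cball 0 C \<times> cball 0 1 :: (complex \<times> complex) set"
  have "compact ((\<lambda>p. f' (fst p) (snd p)) ` ?K)"
    by (intro compact_continuous_image continuous_on_subset[OF cont] compact_Times compact_cball) auto
  then have "bounded ((\<lambda>p. f' (fst p) (snd p)) ` ?K)"
    by (rule compact_imp_bounded)
  then obtain L where "0 < L" "\<forall>y \<in> (\<lambda>p. f' (fst p) (snd p)) ` ?K. cmod y \<le> L"
    unfolding bounded_pos by blast
  then have L: "0 < L" "\<And>p. p \<in> ?K \<Longrightarrow> cmod (f' (fst p) (snd p)) \<le> L"
    by auto
  have "cmod (f' z v) \<le> L * cmod v" if z: "cmod z \<le> C" for z v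
  proof (cases "v = 0")
    case True
    then show ?thesis using linear_0[OF lin] by simp
  next
    case False
    have "cmod (f' z (v /\<^sub>R cmod v)) \<le> L"
      using L(2)[of "(z, v /\<^sub>R cmod v)"] z False by simp
    moreover have "f' z (v /\<^sub>R cmod v) = f' z v /\<^sub>R cmod v"
      by (rule linear_cmul[OF lin])
    ultimately show ?thesis using False by (simp add: field_simps)
  qed
  with L(1) show thesis by (intro that[of L]) auto
qed

lemma C1_lipschitz_on_cball:
  fixes f :: "complex \<Rightarrow> complex"
  assumes deriv: "\<And>z. (f has_derivative f' z) (at z)" and cont: "continuous_on UNIV (\<lambda>p. f' (fst p) (snd p))"
  obtains L where "0 \<le> L" "\<And>z w. cmod z \<le> C \<Longrightarrow> cmod w \<le> C \<Longrightarrow> cmod (f z - f w) \<le> L * cmod (z - w)"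
proof -
  obtain L where L: "0 \<le> L" "\<And>z v. cmod z \<le> C \<Longrightarrow> cmod (f' z v) \<le> L * cmod v"
    using C1_bounded_on_cball[OF has_derivative_linear[OF deriv] cont] by metis
  have "cmod (f z - f w) \<le> L * cmod (z - w)" if "cmod z \<le> C" "cmod w \<le> C" for z w
  proof (rule differentiable_bound[of "cball 0 C" f f'])
    show "onorm (f' x) \<le> L" if "x \<in> cball 0 C" for x
      using L(2) that by (intro onorm_le) simp
  qed (use that deriv in \<open>auto intro: has_derivative_at_withinI\<close>)
  with L(1) show thesis by (rule that)
qed

text \<open>The derivative is uniformly continuous on the compact product of the ball and the unit
  directions, which controls the linearization error uniformly in the base point. Uniformity matters
  because the values of an L^2 function range over the whole ball.\<close>

lemma C1_uniform_on_cball: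
  fixes f :: "complex \<Rightarrow> complex"
  assumes deriv: "\<And>z. (f has_derivative f' z) (at z)" and cont: "continuous_on UNIV (\<lambda>p. f' (fst p) (snd p))"
    and e: "0 < e"
  obtains d where "0 < d" "\<And>z w. cmod z \<le> C \<Longrightarrow> cmod w \<le> C \<Longrightarrow> cmod (w - z) < d \<Longrightarrow>
    cmod (f w - f z - f' z (w - z)) \<le> e * cmod (w - z)"
proof -
  let ?K = "cball 0 C \<times> cball 0 1 :: (complex \<times> complex) set"
  note lin = has_derivative_linear[OF deriv]
  have uc: "uniformly_continuous_on ?K (\<lambda>p. f' (fst p) (snd p))"
    by (intro compact_uniformly_continuous continuous_on_subset[OF cont] compact_Times compact_cball) auto
  from uc[unfolded uniformly_continuous_on_def, rule_format, OF e]
  obtain d where d: "0 < d" "\<And>p q. p \<in> ?K \<Longrightarrow> q \<in> ?K \<Longrightarrow> dist q p < d \<Longrightarrow>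
      dist (f' (fst q) (snd q)) (f' (fst p) (snd p)) < e"
    by blast
  have unit: "cmod (f' w v - f' z v) \<le> e" if "cmod z \<le> C" "cmod w \<le> C" "cmod (w - z) < d" "cmod v \<le> 1" for z w v
    using d(2)[of "(z, v)" "(w, v)"] that by (simp add: dist_Pair_Pair dist_norm)
  have diff: "cmod (f' w v - f' z v) \<le> e * cmod v" if zw: "cmod z \<le> C" "cmod w \<le> C" "cmod (w - z) < d" for z w v
  proof (cases "v = 0")
    case True
    then show ?thesis using linear_0[OF lin] by simp
  next
    case False
    have "cmod (f' w (v /\<^sub>R cmod v) - f' z (v /\<^sub>R cmod v)) \<le> e"
      using zw False by (intro unit) auto
    then have "cmod ((f' w v - f' z v) /\<^sub>R cmod v) \<le> e"
      by (simp only: linear_cmul[OF lin] scaleR_diff_right)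
    then have "inverse (cmod v) * cmod (f' w v - f' z v) \<le> e"
      by (simp only: norm_scaleR abs_inverse abs_norm_cancel)
    then show ?thesis using False by (simp add: field_simps)
  qed
  have "cmod (f w - f z - f' z (w - z)) \<le> e * cmod (w - z)"
    if zw: "cmod z \<le> C" "cmod w \<le> C" "cmod (w - z) < d" for z w
  proof -
    \<comment> \<open>A convex set that contains the segment from z to w and on which the derivative
      stays e-close to the one at z.\<close>
    let ?S = "cball 0 C \<inter> ball z d"
    have S: "convex ?S" "z \<in> ?S" "w \<in> ?S"
      using zw d(1) by (auto simp: dist_norm norm_minus_commute intro!: convex_Int)
    have "norm (f w - f z - f' z (w - z)) \<le> norm (w - z) * e"
    proof (rule differentiable_bound_linearization[where S = ?S and f' = f' and ?x0.0 = z])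
      show "z + t *\<^sub>R (w - z) \<in> ?S" if "t \<in> {0..1}" for t
        using convexD_alt[OF S, of t] that by (simp add: algebra_simps)
      show "(f has_derivative f' x) (at x within ?S)" for x
        using deriv by (rule has_derivative_at_withinI)
      show "onorm (f' x - f' z) \<le> e" if "x \<in> ?S" for x
        using that zw by (intro onorm_le) (auto simp: dist_norm norm_minus_commute intro: diff)
    qed (rule S)
    then show ?thesis by (simp add: mult.commute)
  qed
  with d(1) show thesis by (rule that)
qed

section \<open>The phase map and its differential\<close>

definition phase_map :: "nat \<Rightarrow> real \<Rightarrow> complex \<Rightarrow> complex" where
  "phase_map \<sigma> \<tau> z = exp (\<i> * of_real (\<tau> * cmod z ^ (2 * \<sigma>))) * z"

text \<open>The second summand comes from differentiating \<open>cmod z ^ (2 * \<sigma>)\<close> in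
  direction v. For \<sigma> = 0 the truncated subtraction in the exponent is harmless, because the
  factor \<open>real \<sigma>\<close> vanishes.\<close>

definition phase_deriv :: "nat \<Rightarrow> real \<Rightarrow> complex \<Rightarrow> complex \<Rightarrow> complex" where
  "phase_deriv \<sigma> \<tau> z v = exp (\<i> * of_real (\<tau> * cmod z ^ (2 * \<sigma>)))
     * (v + \<i> * of_real (\<tau> * (real \<sigma> * cmod z ^ (2 * (\<sigma> - 1)) * (2 * (z \<bullet> v)))) * z)"

lemma phase_map_has_derivative: "(phase_map \<sigma> \<tau> has_derivative phase_deriv \<sigma> \<tau> z) (at z)"
proof -
  \<comment> \<open>\<open>z \<bullet> z\<close> replaces the squared modulus: \<open>cmod\<close>
    is not differentiable at the origin, whereas the inner product is polynomial.\<close>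
  let ?\<theta> = "\<lambda>z :: complex. \<tau> * (z \<bullet> z) ^ \<sigma>"
  let ?\<theta>' = "\<lambda>v :: complex. \<tau> * (real \<sigma> * (2 * (z \<bullet> v)) * (z \<bullet> z) ^ (\<sigma> - 1))"
  have 1: "(?\<theta> has_derivative ?\<theta>') (at z)"
    by (auto intro!: derivative_eq_intros simp: inner_commute)
  have "bounded_linear (\<lambda>x. \<i> * complex_of_real x)"
    by (intro bounded_linear_mult_right[THEN bounded_linear_compose] bounded_linear_of_real)
  from bounded_linear.has_derivative[OF this 1]
  have 2: "((\<lambda>z. \<i> * complex_of_real (?\<theta> z)) has_derivative (\<lambda>v. \<i> * complex_of_real (?\<theta>' v))) (at z)" .
  have "(exp has_derivative (*) (exp w)) (at w)" for w :: complex
    using DERIV_exp[of w] by (simp add: has_field_derivative_def)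
  from has_derivative_compose[OF 2 this]
  have 3: "((\<lambda>z. exp (\<i> * complex_of_real (?\<theta> z))) has_derivative
      (\<lambda>v. exp (\<i> * complex_of_real (?\<theta> z)) * (\<i> * complex_of_real (?\<theta>' v)))) (at z)" .
  have norm_eq: "(w \<bullet> w) ^ k = cmod w ^ (2 * k)" for w :: complex and k
    by (simp add: power2_norm_eq_inner power_mult)
  have eq: "phase_map \<sigma> \<tau> = (\<lambda>z. exp (\<i> * complex_of_real (?\<theta> z)) * z)"
    by (simp add: fun_eq_iff phase_map_def norm_eq)
  show ?thesis
    unfolding eq by (rule has_derivative_eq_rhs[OF has_derivative_mult[OF 3 has_derivative_ident]])
      (simp add: fun_eq_iff phase_deriv_def norm_eq algebra_simps)
qed

lemma phase_deriv_continuous: "continuous_on UNIV (\<lambda>p. phase_deriv \<sigma> \<tau> (fst p) (snd p))"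
  unfolding phase_deriv_def by (intro continuous_intros)

lemma phase_deriv_linear: "linear (phase_deriv \<sigma> \<tau> z)"
  using phase_map_has_derivative by (rule has_derivative_linear)

lemma phase_deriv_measurable [measurable]:
  assumes [measurable]: "f \<in> borel_measurable M" "g \<in> borel_measurable M"
  shows "(\<lambda>x. phase_deriv \<sigma> \<tau> (f x) (g x)) \<in> borel_measurable M"
  unfolding phase_deriv_def by measurable

text \<open>The differential of the phase map has determinant one: \<open>(\<i> a) \<bullet> b\<close> is the area form on
  \<open>\<complex>\<close>.\<close>

lemma phase_deriv_area: "(\<i> * phase_deriv \<sigma> \<tau> z a) \<bullet> phase_deriv \<sigma> \<tau> z b = (\<i> * a) \<bullet> b"
proof -
  define r where "r = \<tau> * (real \<sigma> * cmod z ^ (2 * (\<sigma> - 1))) * 2"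
  define e where "e = exp (\<i> * of_real (\<tau> * cmod z ^ (2 * \<sigma>)))"
  have e: "e * cnj e = 1"
    by (simp add: e_def flip: complex_norm_square)
  have pd: "phase_deriv \<sigma> \<tau> z v = e * (v + \<i> * of_real (r * (z \<bullet> v)) * z)" for v
    by (simp add: phase_deriv_def r_def e_def mult_ac)
  \<comment> \<open>Rotating both arguments by the phase preserves area, so only the shear along i z
    remains.\<close>
  have rot: "(\<i> * (e * A)) \<bullet> (e * B) = (\<i> * A) \<bullet> B" for A B
  proof -
    have "\<i> * (e * A) * cnj (e * B) = (e * cnj e) * (\<i> * A * cnj B)"
      by (simp add: mult_ac)
    then show ?thesis by (simp only: inner_complex_Re e mult_1_left)
  qed
  \<comment> \<open>The corrections to a and b are both multiples of i z. Their own area vanishes,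
    and the two cross terms are r (z, a) (z, b) with opposite signs, where (., .) is the real inner
    product.\<close>
  show ?thesis
    unfolding pd rot by (simp add: inner_complex_def algebra_simps)
qed

section \<open>The nonlinear step as an operator on L^2\<close>

lemma nonlinear_step_phase: "AE x in lborel. L2_fun (nonlinear_step \<sigma> \<tau> u) x = phase_map \<sigma> \<tau> (L2_fun u x)"
  using nonlinear_step_fun by (simp add: phase_map_def)

lemma norm_phase_map [simp]: "cmod (phase_map \<sigma> \<tau> z) = cmod z"
  by (simp add: phase_map_def norm_mult)

lemma norm_nonlinear_step: "norm (nonlinear_step \<sigma> \<tau> u) = norm u"
  using nonlinear_step_phase[of \<sigma> \<tau> u]
  by (intro antisym norm_L2_le[of _ 1, simplified]; elim eventually_mono) auto

lemma phase_map_measurable [measurable]: "phase_map \<sigma> \<tau> \<in> borel_measurable borel"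
  unfolding phase_map_def by measurable

lemma L2_translate_nonlinear_step:
  "AE x in lborel. L2_fun (L2_translate h (nonlinear_step \<sigma> \<tau> u)) x = phase_map \<sigma> \<tau> (L2_fun (L2_translate h u) x)"
proof -
  have "AE x in lborel. L2_fun (nonlinear_step \<sigma> \<tau> u) (x + h) = phase_map \<sigma> \<tau> (L2_fun u (x + h))"
    by (rule AE_translate[OF nonlinear_step_phase]) measurable
  with L2_translate_fun[of h u] L2_translate_fun[of h "nonlinear_step \<sigma> \<tau> u"] show ?thesis
    by eventually_elim simp
qed

lemma AE_translate_bound:
  assumes "AE x in lborel. cmod (L2_fun u x) \<le> C"
  shows "AE x in lborel. cmod (L2_fun (L2_translate h u) x) \<le> C"
proof -
  have "AE x in lborel. cmod (L2_fun u (h + 1 * x)) \<le> C"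
    by (rule AE_borel_affine[OF _ _ assms]) auto
  with L2_translate_fun[of h u] show ?thesis
    by eventually_elim (simp add: add.commute)
qed

text \<open>Translation commutes with a pointwise map. The bound C holds for u and for its
  translate, which keeps the values of both in a ball where the phase map is Lipschitz.\<close>

lemma L2_lipschitz_nonlinear_step:
  assumes u: "L2_lipschitz K u" and C: "AE x in lborel. cmod (L2_fun u x) \<le> C"
    and L: "0 \<le> L" "\<And>z w. cmod z \<le> C \<Longrightarrow> cmod w \<le> C \<Longrightarrow>
      cmod (phase_map \<sigma> \<tau> z - phase_map \<sigma> \<tau> w) \<le> L * cmod (z - w)"
  shows "L2_lipschitz (L * K) (nonlinear_step \<sigma> \<tau> u)"
  unfolding L2_lipschitz_def
proof
  fix h
  have "norm (L2_translate h (nonlinear_step \<sigma> \<tau> u) - nonlinear_step \<sigma> \<tau> u) \<le> L * norm (L2_translate h u - u)"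
  proof (rule norm_L2_le)
    show "AE x in lborel. cmod (L2_fun (L2_translate h (nonlinear_step \<sigma> \<tau> u) - nonlinear_step \<sigma> \<tau> u) x)
      \<le> L * cmod (L2_fun (L2_translate h u - u) x)"
      using L2_fun_diff[of "L2_translate h u" u] L2_fun_diff[of "L2_translate h (nonlinear_step \<sigma> \<tau> u)" "nonlinear_step \<sigma> \<tau> u"]
        L2_translate_nonlinear_step[of h \<sigma> \<tau> u] nonlinear_step_phase[of \<sigma> \<tau> u] C AE_translate_bound[OF C, of h]
      by eventually_elim (simp add: L(2))
  qed (rule L(1))
  also have "\<dots> \<le> L * (K * \<bar>h\<bar>)"
    by (intro mult_left_mono L2_lipschitzD u L)
  finally show "norm (L2_translate h (nonlinear_step \<sigma> \<tau> u) - nonlinear_step \<sigma> \<tau> u) \<le> L * K * \<bar>h\<bar>"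
    by (simp add: mult.assoc)
qed

text \<open>Meaningful when u is essentially bounded, as in \<open>nonlinear_deriv_fun\<close>;
  otherwise the pointwise expression may fail to be square integrable and its
  \<open>L2_class\<close> says nothing.\<close>

definition nonlinear_deriv :: "nat \<Rightarrow> real \<Rightarrow> L2 \<Rightarrow> L2 \<Rightarrow> L2" where
  "nonlinear_deriv \<sigma> \<tau> u v = L2_class (\<lambda>x. phase_deriv \<sigma> \<tau> (L2_fun u x) (L2_fun v x))"

lemma nonlinear_deriv_fun:
  assumes C: "AE x in lborel. cmod (L2_fun u x) \<le> C"
    and L: "\<And>z v. cmod z \<le> C \<Longrightarrow> cmod (phase_deriv \<sigma> \<tau> z v) \<le> L * cmod v"
  shows "AE x in lborel. L2_fun (nonlinear_deriv \<sigma> \<tau> u v) x = phase_deriv \<sigma> \<tau> (L2_fun u x) (L2_fun v x)"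
  unfolding nonlinear_deriv_def
proof (rule L2_fun_L2_class)
  have "integrable lborel (\<lambda>x. (cmod (phase_deriv \<sigma> \<tau> (L2_fun u x) (L2_fun v x)))\<^sup>2)"
  proof (rule Bochner_Integration.integrable_bound)
    show "integrable lborel (\<lambda>x. L\<^sup>2 * (cmod (L2_fun v x))\<^sup>2)"
      using square_integrable_L2_fun[of v] by (simp add: square_integrable_def)
    show "AE x in lborel. norm ((cmod (phase_deriv \<sigma> \<tau> (L2_fun u x) (L2_fun v x)))\<^sup>2) \<le> norm (L\<^sup>2 * (cmod (L2_fun v x))\<^sup>2)"
      using C
    proof eventually_elim
      case (elim x)
      from power_mono[OF L[OF elim, of "L2_fun v x"], of 2] show ?case
        by (simp add: power_mult_distrib)
    qed
  qed measurable
  then show "square_integrable (\<lambda>x. phase_deriv \<sigma> \<tau> (L2_fun u x) (L2_fun v x))"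
    by (simp add: square_integrable_def)
qed

text \<open>Along a curve that is bounded and uniformly translation-Lipschitz, \<open>c \<epsilon> - c 0\<close> tends to zero
  uniformly, by \<open>L2_lipschitz_bounded\<close> with a small \<open>s\<close>; hence the error of the pointwise
  linearization is uniformly small.\<close>

lemma nonlinear_step_has_vector_derivative:
  assumes c: "(c has_vector_derivative v) (at 0)"
    and norm: "\<And>\<epsilon>. \<bar>\<epsilon>\<bar> \<le> 1 \<Longrightarrow> norm (c \<epsilon>) \<le> K"
    and lip: "\<And>\<epsilon>. \<bar>\<epsilon>\<bar> \<le> 1 \<Longrightarrow> L2_lipschitz K (c \<epsilon>)"
  shows "((\<lambda>\<epsilon>. nonlinear_step \<sigma> \<tau> (c \<epsilon>)) has_vector_derivative nonlinear_deriv \<sigma> \<tau> (c 0) v) (at 0)"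
proof -
  let ?N = "nonlinear_step \<sigma> \<tau>" and ?D = "nonlinear_deriv \<sigma> \<tau> (c 0)"
  let ?f = "phase_map \<sigma> \<tau>" and ?f' = "phase_deriv \<sigma> \<tau>"
  have K: "0 \<le> K" using L2_lipschitz_nonneg[OF lip[of 0]] by simp
  \<comment> \<open>At scale s = 1 the sup bound is the norm plus 2 K, and the norm is at most
    K.\<close>
  define C where "C = 3 * K"
  have C: "AE x in lborel. cmod (L2_fun (c \<epsilon>) x) \<le> C" if "\<bar>\<epsilon>\<bar> \<le> 1" for \<epsilon>
    using L2_lipschitz_bounded[OF lip[OF that] zero_less_one]
    by (elim eventually_mono) (use norm[OF that] in \<open>auto simp: C_def\<close>)
  obtain L where L: "0 \<le> L" "\<And>z v. cmod z \<le> C \<Longrightarrow> cmod (?f' z v) \<le> L * cmod v"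
    using C1_bounded_on_cball[OF phase_deriv_linear phase_deriv_continuous] by metis
  note C0 = C[of 0, simplified]
  have Dfun: "AE x in lborel. L2_fun (?D w) x = ?f' (L2_fun (c 0) x) (L2_fun w x)" for w
    by (rule nonlinear_deriv_fun[OF C0]) (rule L(2))
  have Dbound: "norm (?D w) \<le> L * norm w" for w
  proof (rule norm_L2_le)
    show "AE x in lborel. cmod (L2_fun (?D w) x) \<le> L * cmod (L2_fun w x)"
      using Dfun[of w] C0 by eventually_elim (simp add: L(2))
  qed (rule L(1))
  have Dadd: "?D (a + b) = ?D a + ?D b" for a b
    unfolding L2_eq_iff
    using Dfun[of a] Dfun[of b] Dfun[of "a + b"] L2_fun_add[of a b] L2_fun_add[of "?D a" "?D b"]
    by eventually_elim (simp add: linear_add[OF phase_deriv_linear])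
  have Dscale: "?D (r *\<^sub>R a) = r *\<^sub>R ?D a" for a r
    unfolding L2_eq_iff
    using Dfun[of a] Dfun[of "r *\<^sub>R a"] L2_fun_scaleR[of r a] L2_fun_scaleR[of r "?D a"]
    by eventually_elim (simp add: linear_cmul[OF phase_deriv_linear])
  have Dlin: "linear ?D" by (intro linearI Dadd Dscale)
  have cder: "\<exists>d>0. \<forall>y. \<bar>y\<bar> < d \<longrightarrow> norm (c y - c 0 - y *\<^sub>R v) \<le> e * \<bar>y\<bar>" if "0 < e" for e
    using c that unfolding has_vector_derivative_def has_derivative_at_alt by (auto simp: real_norm_def)
  have "\<exists>d>0. \<forall>y. \<bar>y\<bar> < d \<longrightarrow> norm (?N (c y) - ?N (c 0) - y *\<^sub>R ?D v) \<le> e * \<bar>y\<bar>" if e: "0 < e" for e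
  proof -
    have nv: "norm v + 1 \<noteq> 0" using norm_ge_zero[of v] by linarith
    \<comment> \<open>Near 0 the increment of c is at most \<open>norm v + 1\<close> times |y|, the
      1 being the slack allowed by \<open>d1\<close> below. Hence the pointwise linearization error
      takes at most half of e.\<close>
    define \<eta> where "\<eta> = e / (2 * (norm v + 1))"
    have \<eta>: "0 < \<eta>" using e by (simp add: \<eta>_def add_nonneg_pos)
    obtain \<delta> where \<delta>: "0 < \<delta>" "\<And>z w. cmod z \<le> C \<Longrightarrow> cmod w \<le> C \<Longrightarrow> cmod (w - z) < \<delta> \<Longrightarrow>
        cmod (?f w - ?f z - ?f' z (w - z)) \<le> \<eta> * cmod (w - z)"
      using C1_uniform_on_cball[OF phase_map_has_derivative phase_deriv_continuous \<eta>] by metis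
    \<comment> \<open>Small enough that the Lipschitz part of the sup bound for
      \<open>c y - c 0\<close>, whose constant is 2 K, stays within half of \<delta>; K + 1 avoids
      division by zero.\<close>
    define s where "s = (\<delta> / (8 * (K + 1)))\<^sup>2"
    have s: "0 < s" "sqrt s = \<delta> / (8 * (K + 1))"
      using \<delta>(1) K by (auto simp: s_def)
    have s4: "4 * K * sqrt s \<le> \<delta> / 2"
      using \<delta>(1) K unfolding s(2) by (simp add: field_simps)
    obtain d1 where d1: "0 < d1" "\<And>y. \<bar>y\<bar> < d1 \<Longrightarrow> norm (c y - c 0 - y *\<^sub>R v) \<le> 1 * \<bar>y\<bar>"
      using cder[of 1] by auto
    obtain d2 where d2: "0 < d2" "\<And>y. \<bar>y\<bar> < d2 \<Longrightarrow> norm (c y - c 0 - y *\<^sub>R v) \<le> e / (2 * (L + 1)) * \<bar>y\<bar>"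
      using cder[of "e / (2 * (L + 1))"] e L(1) by auto
    \<comment> \<open>Keeps the norm part of that sup bound below the other half of
      \<delta>.\<close>
    define d3 where "d3 = \<delta> / 2 * sqrt s / (norm v + 1)"
    have d3: "0 < d3" using \<delta>(1) s(1) by (simp add: d3_def add_nonneg_pos)
    define d where "d = min (min d1 d2) (min d3 1)"
    have "0 < d" using d1 d2 d3 by (simp add: d_def)
    moreover have "norm (?N (c y) - ?N (c 0) - y *\<^sub>R ?D v) \<le> e * \<bar>y\<bar>" if "\<bar>y\<bar> < d" for y
    proof -
      have y: "\<bar>y\<bar> < d1" "\<bar>y\<bar> < d2" "\<bar>y\<bar> < d3" "\<bar>y\<bar> \<le> 1" using that by (auto simp: d_def)
      let ?h = "c y - c 0"
      have "norm ?h \<le> norm (c y - c 0 - y *\<^sub>R v) + norm (y *\<^sub>R v)"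
        using norm_triangle_ineq[of "c y - c 0 - y *\<^sub>R v" "y *\<^sub>R v"] by simp
      also have "\<dots> \<le> (norm v + 1) * \<bar>y\<bar>"
        using d1(2)[OF y(1)] by (simp add: algebra_simps)
      finally have h: "norm ?h \<le> (norm v + 1) * \<bar>y\<bar>" .
      have "L2_lipschitz (2 * K) ?h"
        unfolding L2_lipschitz_def
      proof
        fix t
        have "L2_translate t ?h - ?h = (L2_translate t (c y) - c y) - (L2_translate t (c 0) - c 0)"
          using orthogonal_transformation_linear[OF orthogonal_L2_translate] by (simp add: linear_diff)
        then have "norm (L2_translate t ?h - ?h) \<le> norm (L2_translate t (c y) - c y) + norm (L2_translate t (c 0) - c 0)"
          by (simp only: norm_triangle_ineq4)
        also have "\<dots> \<le> K * \<bar>t\<bar> + K * \<bar>t\<bar>"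
          by (intro add_mono L2_lipschitzD lip y(4)) simp
        finally show "norm (L2_translate t ?h - ?h) \<le> 2 * K * \<bar>t\<bar>" by simp
      qed
      from L2_lipschitz_bounded[OF this s(1)]
      have hsup: "AE x in lborel. cmod (L2_fun ?h x) < \<delta>"
      proof (rule eventually_mono)
        fix x assume "cmod (L2_fun ?h x) \<le> norm ?h / sqrt s + 2 * (2 * K) * sqrt s"
        moreover have "norm ?h / sqrt s < \<delta> / 2"
        proof -
          have "(norm v + 1) * \<bar>y\<bar> < (norm v + 1) * d3"
            using y(3) by (intro mult_strict_left_mono) (auto simp: add_nonneg_pos)
          also have "\<dots> = \<delta> / 2 * sqrt s"
            by (simp only: d3_def times_divide_eq_right nonzero_mult_div_cancel_left[OF nv])
          finally show ?thesis using h s(1) by (simp add: pos_divide_less_eq)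
        qed
        ultimately show "cmod (L2_fun ?h x) < \<delta>" using s4 by linarith
      qed
      have 1: "norm (?N (c y) - ?N (c 0) - ?D ?h) \<le> \<eta> * norm ?h"
      proof (rule norm_L2_le)
        show "AE x in lborel. cmod (L2_fun (?N (c y) - ?N (c 0) - ?D ?h) x) \<le> \<eta> * cmod (L2_fun ?h x)"
          using L2_fun_diff[of "?N (c y) - ?N (c 0)" "?D ?h"] L2_fun_diff[of "?N (c y)" "?N (c 0)"]
            nonlinear_step_phase[of \<sigma> \<tau> "c y"] nonlinear_step_phase[of \<sigma> \<tau> "c 0"] Dfun[of ?h]
            L2_fun_diff[of "c y" "c 0"] hsup C[OF y(4)] C0
          by eventually_elim (simp add: \<delta>(2))
      qed (use \<eta> in simp)
      \<comment> \<open>The linearization error along the true increment, plus the derivative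
        applied to the remainder of the curve itself; each takes half of e.\<close>
      have "?N (c y) - ?N (c 0) - y *\<^sub>R ?D v = (?N (c y) - ?N (c 0) - ?D ?h) + ?D (?h - y *\<^sub>R v)"
        by (simp add: linear_diff[OF Dlin] Dscale)
      then have "norm (?N (c y) - ?N (c 0) - y *\<^sub>R ?D v)
        \<le> norm (?N (c y) - ?N (c 0) - ?D ?h) + norm (?D (?h - y *\<^sub>R v))"
        by (simp only: norm_triangle_ineq)
      also have "\<dots> \<le> \<eta> * ((norm v + 1) * \<bar>y\<bar>) + L * (e / (2 * (L + 1)) * \<bar>y\<bar>)"
        using 1 \<eta> h Dbound[of "?h - y *\<^sub>R v"] d2(2)[OF y(2)] L(1)
        by (intro add_mono order_trans[OF 1] order_trans[OF Dbound] mult_left_mono) auto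
      also have "\<eta> * ((norm v + 1) * \<bar>y\<bar>) = e / 2 * \<bar>y\<bar>"
          using nv by (simp add: \<eta>_def divide_simps)
      also have "L * (e / (2 * (L + 1)) * \<bar>y\<bar>) \<le> e / 2 * \<bar>y\<bar>"
      proof -
        have "L * (e / (2 * (L + 1))) \<le> e / 2" using L(1) e by (simp add: field_simps)
        from mult_right_mono[OF this, of "\<bar>y\<bar>"] show ?thesis by simp
      qed
      finally show ?thesis by (simp add: algebra_simps)
    qed
    ultimately show ?thesis by blast
  qed
  then show ?thesis
    unfolding has_vector_derivative_def has_derivative_at_alt
    by (auto simp: bounded_linear_scaleR_left)
qed

section \<open>Conservation laws\<close>

text \<open>The directions vary with n because the pointwise difference quotients of a curve only
  tend to its velocity. Directional derivatives would not suffice here; the Frechet derivative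
  does.\<close>

lemma has_derivative_sequentially:
  fixes f :: "'a::real_normed_vector \<Rightarrow> 'b::real_normed_vector"
  assumes f: "(f has_derivative f') (at z)" and d: "d \<longlonglongrightarrow> v"
    and e: "e \<longlonglongrightarrow> 0" "\<And>n. 0 < e n"
  shows "(\<lambda>n. (f (z + e n *\<^sub>R d n) - f z) /\<^sub>R e n) \<longlonglongrightarrow> f' v"
proof -
  note bl = has_derivative_bounded_linear[OF f]
  obtain B where B: "0 < B" "\<And>n. norm (d n) \<le> B"
    using convergent_imp_Bseq[of d] d unfolding convergent_def Bseq_def by blast
  have "(\<lambda>n. (f (z + e n *\<^sub>R d n) - f z) /\<^sub>R e n - f' (d n)) \<longlonglongrightarrow> 0"
  proof (rule LIMSEQ_I)
    fix r :: real assume "0 < r"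
    then have r: "0 < r / (2 * B)" using B by simp
    obtain \<delta> where \<delta>: "0 < \<delta>" "\<And>y. norm (y - z) < \<delta> \<Longrightarrow> norm (f y - f z - f' (y - z)) \<le> r / (2 * B) * norm (y - z)"
      using f r unfolding has_derivative_at_alt by blast
    have "0 < \<delta> / B" using \<delta> B by simp
    then obtain N where N: "\<And>n. n \<ge> N \<Longrightarrow> e n < \<delta> / B"
      using order_tendstoD(2)[OF e(1)] unfolding eventually_sequentially by blast
    have "norm ((f (z + e n *\<^sub>R d n) - f z) /\<^sub>R e n - f' (d n) - 0) < r" if "n \<ge> N" for n
    proof -
      let ?y = "z + e n *\<^sub>R d n"
      have "norm (?y - z) \<le> e n * B"
        using e(2)[of n] B by (simp add: mult_left_mono)
      moreover have "e n * B < \<delta>"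
        using N[OF that] B by (simp add: pos_less_divide_eq)
      ultimately have "norm (f ?y - f z - f' (?y - z)) \<le> r / (2 * B) * norm (?y - z)"
        by (intro \<delta>(2)) simp
      also have "\<dots> \<le> r / (2 * B) * (e n * B)"
        using \<open>norm (?y - z) \<le> e n * B\<close> r by (intro mult_left_mono) auto
      also have "\<dots> = e n * (r / 2)" using B by simp
      finally have le: "norm (f ?y - f z - f' (e n *\<^sub>R d n)) \<le> e n * (r / 2)" by simp
      have "(f ?y - f z) /\<^sub>R e n - f' (d n) = (f ?y - f z - f' (e n *\<^sub>R d n)) /\<^sub>R e n"
        using e(2)[of n] linear_cmul[OF bounded_linear.linear[OF bl]]
        by (simp add: scaleR_diff_right)
      then have "norm ((f ?y - f z) /\<^sub>R e n - f' (d n)) = norm (f ?y - f z - f' (e n *\<^sub>R d n)) / e n"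
        using e(2)[of n] by (simp add: divide_inverse mult.commute)
      also have "\<dots> \<le> r / 2"
        using le e(2)[of n] by (simp add: pos_divide_le_eq mult.commute)
      finally show ?thesis using \<open>0 < r\<close> by simp
    qed
    then show "\<exists>no. \<forall>n\<ge>no. norm ((f (z + e n *\<^sub>R d n) - f z) /\<^sub>R e n - f' (d n) - 0) < r" by blast
  qed
  from tendsto_add[OF this bounded_linear.tendsto[OF bl d]] show ?thesis by simp
qed

lemma has_vector_derivative_sequentially:
  fixes c :: "real \<Rightarrow> 'a::real_normed_vector"
  assumes "(c has_vector_derivative v) (at 0)"
  shows "(\<lambda>n. (c (inverse (real (Suc n))) - c 0) /\<^sub>R inverse (real (Suc n))) \<longlonglongrightarrow> v"
proof -
  have "(c has_derivative (\<lambda>h. h *\<^sub>R v)) (at 0)"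
    using assms by (simp add: has_vector_derivative_def)
  from has_derivative_sequentially[OF this tendsto_const[of 1] LIMSEQ_inverse_real_of_nat]
  show ?thesis by simp
qed

text \<open>The two difference quotients converge almost everywhere along a common subsequence.\<close>

lemma nonlinear_step_derivative_eq:
  assumes c: "(c has_vector_derivative v) (at 0)"
    and w: "((\<lambda>\<epsilon>. nonlinear_step \<sigma> \<tau> (c \<epsilon>)) has_vector_derivative w) (at 0)"
  shows "AE x in lborel. L2_fun w x = phase_deriv \<sigma> \<tau> (L2_fun (c 0) x) (L2_fun v x)"
proof -
  let ?N = "nonlinear_step \<sigma> \<tau>"
  define e where "e n = inverse (real (Suc n))" for n
  define D where "D n = (c (e n) - c 0) /\<^sub>R e n" for n
  define E where "E n = (?N (c (e n)) - ?N (c 0)) /\<^sub>R e n" for n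
  have e: "0 < e n" for n by (simp add: e_def)
  have elim: "e \<longlonglongrightarrow> 0" unfolding e_def by (rule LIMSEQ_inverse_real_of_nat)
  have "D \<longlonglongrightarrow> v" unfolding D_def e_def by (rule has_vector_derivative_sequentially[OF c])
  then obtain r where r: "strict_mono r" "AE x in lborel. (\<lambda>n. L2_fun (D (r n)) x) \<longlonglongrightarrow> L2_fun v x"
    by (rule L2_AE_subseq)
  have "E \<longlonglongrightarrow> w" unfolding E_def e_def by (rule has_vector_derivative_sequentially[OF w])
  then have "(\<lambda>n. E (r n)) \<longlonglongrightarrow> w" using LIMSEQ_subseq_LIMSEQ[OF _ r(1)] by (simp add: comp_def)
  then obtain r' where r': "strict_mono r'" "AE x in lborel. (\<lambda>n. L2_fun (E (r (r' n))) x) \<longlonglongrightarrow> L2_fun w x"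
    by (rule L2_AE_subseq)
  have Dx: "AE x in lborel. \<forall>n. L2_fun (D n) x = (L2_fun (c (e n)) x - L2_fun (c 0) x) /\<^sub>R e n"
    unfolding AE_all_countable
  proof
    fix n
    show "AE x in lborel. L2_fun (D n) x = (L2_fun (c (e n)) x - L2_fun (c 0) x) /\<^sub>R e n"
      unfolding D_def using L2_fun_scaleR[of "inverse (e n)" "c (e n) - c 0"] L2_fun_diff[of "c (e n)" "c 0"]
      by eventually_elim simp
  qed
  have Ex: "AE x in lborel. \<forall>n. L2_fun (E n) x = (phase_map \<sigma> \<tau> (L2_fun (c (e n)) x) - phase_map \<sigma> \<tau> (L2_fun (c 0) x)) /\<^sub>R e n"
    unfolding AE_all_countable
  proof
    fix n
    show "AE x in lborel. L2_fun (E n) x = (phase_map \<sigma> \<tau> (L2_fun (c (e n)) x) - phase_map \<sigma> \<tau> (L2_fun (c 0) x)) /\<^sub>R e n"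
      unfolding E_def using L2_fun_scaleR[of "inverse (e n)" "?N (c (e n)) - ?N (c 0)"] L2_fun_diff[of "?N (c (e n))" "?N (c 0)"]
        nonlinear_step_phase[of \<sigma> \<tau> "c (e n)"] nonlinear_step_phase[of \<sigma> \<tau> "c 0"]
      by eventually_elim simp
  qed
  show ?thesis
    using r(2) r'(2) Dx Ex
  proof eventually_elim
    case (elim x)
    let ?z = "L2_fun (c 0) x" and ?d = "\<lambda>n. L2_fun (D (r (r' n))) x" and ?e = "\<lambda>n. e (r (r' n))"
    have z: "L2_fun (c (?e n)) x = ?z + ?e n *\<^sub>R ?d n" for n
      using elim(3) e[of "r (r' n)"] by simp
    have d: "?d \<longlonglongrightarrow> L2_fun v x"
      using LIMSEQ_subseq_LIMSEQ[OF elim(1) r'(1)] by (simp add: comp_def)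
    have "?e \<longlonglongrightarrow> 0"
      using LIMSEQ_subseq_LIMSEQ[OF LIMSEQ_subseq_LIMSEQ[OF \<open>e \<longlonglongrightarrow> 0\<close> r(1)] r'(1)] by (simp add: comp_def)
    from has_derivative_sequentially[OF phase_map_has_derivative d this e]
    have "(\<lambda>n. (phase_map \<sigma> \<tau> (L2_fun (c (?e n)) x) - phase_map \<sigma> \<tau> ?z) /\<^sub>R ?e n) \<longlonglongrightarrow> phase_deriv \<sigma> \<tau> ?z (L2_fun v x)"
      by (simp only: z)
    moreover have "(\<lambda>n. (phase_map \<sigma> \<tau> (L2_fun (c (?e n)) x) - phase_map \<sigma> \<tau> ?z) /\<^sub>R ?e n) \<longlonglongrightarrow> L2_fun w x"
      using elim(2,4) by simp
    ultimately show ?case by (rule LIMSEQ_unique[symmetric])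
  qed
qed

section \<open>The symplectic form and one step of the scheme\<close>

lemma variation_has_vector_derivative:
  "has_variation \<Phi> u0 \<xi> \<Longrightarrow> ((\<lambda>\<epsilon>. \<Phi> (u0 + \<epsilon> *\<^sub>R \<xi>)) has_vector_derivative variation \<Phi> u0 \<xi>) (at 0)"
  by (simp add: has_variation_def variation_def vector_derivative_works)

lemma has_variationI:
  "((\<lambda>\<epsilon>. \<Phi> (u0 + \<epsilon> *\<^sub>R \<xi>)) has_vector_derivative v) (at 0) \<Longrightarrow> has_variation \<Phi> u0 \<xi>"
  unfolding has_variation_def by (rule differentiableI_vector)

text \<open>On the complex plane, Re a Im b - Re b Im a is the real inner product of i a and b. In
  this form every linear isometry that commutes with multiplication by i visibly preserves the
  symplectic form.\<close>

lemma symplectic_form_eq: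
  "symplectic_form \<Phi> u0 \<xi> \<eta> = L2_mult (\<lambda>x. \<i>) (variation \<Phi> u0 \<xi>) \<bullet> variation \<Phi> u0 \<eta>"
proof -
  let ?v = "variation \<Phi> u0"
  have "L2_mult (\<lambda>x. \<i>) (?v \<xi>) \<bullet> ?v \<eta> = (\<integral>x. (\<i> * L2_fun (?v \<xi>) x) \<bullet> L2_fun (?v \<eta>) x \<partial>lborel)"
    unfolding inner_L2_eq using L2_mult_fun[OF unimodular_const, of "?v \<xi>"]
    by (intro integral_cong_AE) (auto elim: eventually_mono)
  also have "\<dots> = symplectic_form \<Phi> u0 \<xi> \<eta>"
    unfolding symplectic_form_def wedge_def dp_def dq_def
    by (intro Bochner_Integration.integral_cong refl) (simp add: inner_complex_def)
  finally show ?thesis ..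
qed

lemma symplectic_step:
  assumes var: "\<And>\<zeta>. \<zeta> \<in> {\<xi>, \<eta>} \<Longrightarrow> has_variation \<Phi> u0 \<zeta>"
    "\<And>\<zeta>. \<zeta> \<in> {\<xi>, \<eta>} \<Longrightarrow> has_variation (\<lambda>u. free_schroedinger a (nonlinear_step \<sigma> \<tau> (\<Phi> u))) u0 \<zeta>"
  shows "symplectic_form (\<lambda>u. free_schroedinger a (nonlinear_step \<sigma> \<tau> (\<Phi> u))) u0 \<xi> \<eta> = symplectic_form \<Phi> u0 \<xi> \<eta>"
proof -
  let ?S = "free_schroedinger a" and ?J = "L2_mult (\<lambda>x. \<i>)"
  let ?\<Psi> = "\<lambda>u. ?S (nonlinear_step \<sigma> \<tau> (\<Phi> u))"
  \<comment> \<open>The hypotheses give variations before and after the full step only. Undoing the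
    free flow recovers the variation after the nonlinear substep, so its existence needs no separate
    argument.\<close>
  define w where "w \<zeta> = free_schroedinger (- a) (variation ?\<Psi> u0 \<zeta>)" for \<zeta>
  have Sw: "variation ?\<Psi> u0 \<zeta> = ?S (w \<zeta>)" for \<zeta>
    using free_schroedinger_inverse[of "- a"] by (simp add: w_def)
  have w: "AE x in lborel. L2_fun (w \<zeta>) x = phase_deriv \<sigma> \<tau> (L2_fun (\<Phi> u0) x) (L2_fun (variation \<Phi> u0 \<zeta>) x)"
    if \<zeta>: "\<zeta> \<in> {\<xi>, \<eta>}" for \<zeta>
  proof -
    have bl: "bounded_linear (free_schroedinger (- a))"
      using orthogonal_free_schroedinger[of "- a"] unfolding orthogonal_transformation
      by (intro bounded_linear_intro[where K = 1]) (auto simp: linear_add linear_cmul)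
    have "((\<lambda>\<epsilon>. nonlinear_step \<sigma> \<tau> (\<Phi> (u0 + \<epsilon> *\<^sub>R \<zeta>))) has_vector_derivative w \<zeta>) (at 0)"
      using bounded_linear.has_vector_derivative[OF bl variation_has_vector_derivative[OF var(2)[OF \<zeta>]]]
      by (simp add: free_schroedinger_inverse w_def)
    from nonlinear_step_derivative_eq[OF variation_has_vector_derivative[OF var(1)[OF \<zeta>]] this]
    show ?thesis by simp
  qed
  have "symplectic_form ?\<Psi> u0 \<xi> \<eta> = ?J (?S (w \<xi>)) \<bullet> ?S (w \<eta>)"
    by (simp add: symplectic_form_eq Sw)
  also have "?J (?S (w \<xi>)) = ?S (?J (w \<xi>))"
    using free_schroedinger_commute[OF fourier_L2_imaginary unimodular_const] by simp
  also have "?S (?J (w \<xi>)) \<bullet> ?S (w \<eta>) = ?J (w \<xi>) \<bullet> w \<eta>"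
    using orthogonal_free_schroedinger by (simp add: orthogonal_transformation_def)
  also have "\<dots> = ?J (variation \<Phi> u0 \<xi>) \<bullet> variation \<Phi> u0 \<eta>"
    unfolding inner_L2_eq
  proof (rule integral_cong_AE)
    show "AE x in lborel. L2_fun (?J (w \<xi>)) x \<bullet> L2_fun (w \<eta>) x
      = L2_fun (?J (variation \<Phi> u0 \<xi>)) x \<bullet> L2_fun (variation \<Phi> u0 \<eta>) x"
      using w[of \<xi>, simplified] w[of \<eta>, simplified] L2_mult_fun[OF unimodular_const, of "w \<xi>"]
        L2_mult_fun[OF unimodular_const, of "variation \<Phi> u0 \<xi>"]
      by eventually_elim (simp add: phase_deriv_area)
  qed measurable
  finally show ?thesis by (simp add: symplectic_form_eq)
qed

section \<open>Existence of variations for H^1 data\<close>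

text \<open>The invariant of the induction over time steps. To the derivative at 0 it adds bounds
  uniform on a whole parameter interval, with which the nonlinear step can be differentiated along
  the curve.\<close>

definition regular_curve :: "(real \<Rightarrow> L2) \<Rightarrow> bool" where
  "regular_curve c \<longleftrightarrow> (\<exists>v. (c has_vector_derivative v) (at 0)) \<and>
     (\<exists>K. \<forall>\<epsilon>. \<bar>\<epsilon>\<bar> \<le> 1 \<longrightarrow> norm (c \<epsilon>) \<le> K \<and> L2_lipschitz K (c \<epsilon>))"

lemma L2_lipschitz_mono: "L2_lipschitz K u \<Longrightarrow> K \<le> K' \<Longrightarrow> L2_lipschitz K' u"
  unfolding L2_lipschitz_def by (meson abs_ge_zero mult_right_mono order_trans)

lemma regular_curve_line:
  assumes "u \<in> sobolev_H1" "\<xi> \<in> sobolev_H1"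
  shows "regular_curve (\<lambda>\<epsilon>. u + \<epsilon> *\<^sub>R \<xi>)"
proof -
  obtain K K' where K: "L2_lipschitz K u" "L2_lipschitz K' \<xi>"
    using L2_lipschitz_H1 assms by blast
  note K0 = L2_lipschitz_nonneg[OF K(1)] L2_lipschitz_nonneg[OF K(2)]
  define B where "B = max (norm u + norm \<xi>) (K + K')"
  have "norm (u + \<epsilon> *\<^sub>R \<xi>) \<le> B \<and> L2_lipschitz B (u + \<epsilon> *\<^sub>R \<xi>)" if \<epsilon>: "\<bar>\<epsilon>\<bar> \<le> 1" for \<epsilon>
  proof
    have "norm (u + \<epsilon> *\<^sub>R \<xi>) \<le> norm u + \<bar>\<epsilon>\<bar> * norm \<xi>"
      using norm_triangle_ineq[of u "\<epsilon> *\<^sub>R \<xi>"] by simp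
    also have "\<dots> \<le> norm u + 1 * norm \<xi>"
      using \<epsilon> by (intro add_left_mono mult_right_mono) auto
    finally show "norm (u + \<epsilon> *\<^sub>R \<xi>) \<le> B" by (simp add: B_def)
    have "L2_lipschitz (K + K') (u + \<epsilon> *\<^sub>R \<xi>)"
      unfolding L2_lipschitz_def
    proof
      fix h
      note lin = orthogonal_transformation_linear[OF orthogonal_L2_translate[of h]]
      have eq: "L2_translate h (u + \<epsilon> *\<^sub>R \<xi>) - (u + \<epsilon> *\<^sub>R \<xi>) = (L2_translate h u - u) + \<epsilon> *\<^sub>R (L2_translate h \<xi> - \<xi>)"
        by (simp add: linear_add[OF lin] linear_cmul[OF lin] scaleR_diff_right)
      have "norm (L2_translate h (u + \<epsilon> *\<^sub>R \<xi>) - (u + \<epsilon> *\<^sub>R \<xi>)) \<le> norm (L2_translate h u - u) + \<bar>\<epsilon>\<bar> * norm (L2_translate h \<xi> - \<xi>)"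
        unfolding eq using norm_triangle_ineq[of "L2_translate h u - u" "\<epsilon> *\<^sub>R (L2_translate h \<xi> - \<xi>)"] by simp
      also have "\<dots> \<le> K * \<bar>h\<bar> + 1 * (K' * \<bar>h\<bar>)"
        using \<epsilon> K0 by (intro add_mono mult_mono L2_lipschitzD K) auto
      finally show "norm (L2_translate h (u + \<epsilon> *\<^sub>R \<xi>) - (u + \<epsilon> *\<^sub>R \<xi>)) \<le> (K + K') * \<bar>h\<bar>"
        by (simp add: distrib_right)
    qed
    then show "L2_lipschitz B (u + \<epsilon> *\<^sub>R \<xi>)" by (rule L2_lipschitz_mono) (simp add: B_def)
  qed
  moreover have "((\<lambda>\<epsilon>. u + \<epsilon> *\<^sub>R \<xi>) has_vector_derivative \<xi>) (at 0)"
    by (auto intro!: derivative_eq_intros)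
  ultimately show ?thesis unfolding regular_curve_def by blast
qed

lemma regular_curve_nonlinear_step:
  assumes "regular_curve c"
  shows "regular_curve (\<lambda>\<epsilon>. nonlinear_step \<sigma> \<tau> (c \<epsilon>))"
proof -
  obtain v K where c: "(c has_vector_derivative v) (at 0)"
    and K: "\<And>\<epsilon>. \<bar>\<epsilon>\<bar> \<le> 1 \<Longrightarrow> norm (c \<epsilon>) \<le> K" "\<And>\<epsilon>. \<bar>\<epsilon>\<bar> \<le> 1 \<Longrightarrow> L2_lipschitz K (c \<epsilon>)"
    using assms unfolding regular_curve_def by blast
  obtain L where L: "0 \<le> L" "\<And>z w. cmod z \<le> 3 * K \<Longrightarrow> cmod w \<le> 3 * K \<Longrightarrow>
      cmod (phase_map \<sigma> \<tau> z - phase_map \<sigma> \<tau> w) \<le> L * cmod (z - w)"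
    using C1_lipschitz_on_cball[OF phase_map_has_derivative phase_deriv_continuous, of "3 * K" \<sigma> \<tau>] by blast
  \<comment> \<open>The norm is conserved while the translation constant is multiplied by L; the
    maximum serves both.\<close>
  have "norm (nonlinear_step \<sigma> \<tau> (c \<epsilon>)) \<le> max K (L * K) \<and> L2_lipschitz (max K (L * K)) (nonlinear_step \<sigma> \<tau> (c \<epsilon>))"
    if \<epsilon>: "\<bar>\<epsilon>\<bar> \<le> 1" for \<epsilon>
  proof
    show "norm (nonlinear_step \<sigma> \<tau> (c \<epsilon>)) \<le> max K (L * K)"
      using K(1)[OF \<epsilon>] by (simp add: norm_nonlinear_step)
    have "AE x in lborel. cmod (L2_fun (c \<epsilon>) x) \<le> 3 * K"
      using L2_lipschitz_bounded[OF K(2)[OF \<epsilon>] zero_less_one]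
      by (elim eventually_mono) (use K(1)[OF \<epsilon>] in auto)
    from L2_lipschitz_nonlinear_step[OF K(2)[OF \<epsilon>] this L]
    show "L2_lipschitz (max K (L * K)) (nonlinear_step \<sigma> \<tau> (c \<epsilon>))"
      by (rule L2_lipschitz_mono) auto
  qed
  then show ?thesis
    using nonlinear_step_has_vector_derivative[OF c K] unfolding regular_curve_def by blast
qed

text \<open>The free flow is a linear isometry that commutes with translations, so both bounds carry
  over unchanged.\<close>

lemma regular_curve_free_schroedinger:
  assumes "regular_curve c"
  shows "regular_curve (\<lambda>\<epsilon>. free_schroedinger a (c \<epsilon>))"
proof -
  let ?S = "free_schroedinger a"
  have S: "linear ?S" "\<And>u. norm (?S u) = norm u"
    using orthogonal_free_schroedinger by (auto simp: orthogonal_transformation)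
  have bl: "bounded_linear ?S"
    using S by (intro bounded_linear_intro[where K = 1]) (auto simp: linear_add linear_cmul)
  have "L2_lipschitz K (?S u)" if "L2_lipschitz K u" for K u
    unfolding L2_lipschitz_def
  proof
    fix h
    have "L2_translate h (?S u) = ?S (L2_translate h u)"
      using free_schroedinger_commute[OF fourier_L2_translate unimodular_exp(1)] by simp
    then have "norm (L2_translate h (?S u) - ?S u) = norm (L2_translate h u - u)"
      using S by (simp flip: linear_diff)
    then show "norm (L2_translate h (?S u) - ?S u) \<le> K * \<bar>h\<bar>"
      using L2_lipschitzD[OF that] by simp
  qed
  then show ?thesis
    using assms bounded_linear.has_vector_derivative[OF bl] unfolding regular_curve_def by (metis S(2))
qed

lemma norm_lie_splitting_Suc: "norm (lie_splitting \<sigma> T N w (Suc n) u) = norm (lie_splitting \<sigma> T N w n u)"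
  using orthogonal_free_schroedinger by (simp add: Let_def norm_nonlinear_step orthogonal_transformation)

lemma regular_curve_lie_splitting:
  "u \<in> sobolev_H1 \<Longrightarrow> \<xi> \<in> sobolev_H1 \<Longrightarrow> regular_curve (\<lambda>\<epsilon>. lie_splitting \<sigma> T N w n (u + \<epsilon> *\<^sub>R \<xi>))"
  by (induction n)
    (auto simp: Let_def intro: regular_curve_line regular_curve_free_schroedinger regular_curve_nonlinear_step)

text \<open>The symplectic identity is conditional on the variations that occur in it, because not
  every direction of L^2 admits one. The last conjunct shows that the condition is met for all data
  and directions in H^1, so the identity is not vacuous.\<close>

theorem proposition3p3:
  fixes M :: "'a measure" and F :: "real \<Rightarrow> 'a measure" and W :: "real \<Rightarrow> 'a \<Rightarrow> real"
    and T :: real and N \<sigma> :: nat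
    and u :: "'a \<Rightarrow> nat \<Rightarrow> L2 \<Rightarrow> L2"
  assumes "brownian_motion M F W" and "0 < T" and "1 \<le> N" and "1 \<le> \<sigma>" and "\<sigma> \<le> 2"
  defines "u \<equiv> (\<lambda>\<omega>. lie_splitting \<sigma> T N (\<lambda>t. W t \<omega>))"
  shows "AE \<omega> in M.
    (\<forall>n<N. \<forall>u0. charge (u \<omega> (Suc n) u0) = charge (u \<omega> n u0)) \<and>
    (\<forall>n<N. \<forall>u0 \<xi> \<eta>.
       (\<forall>m\<in>{n, Suc n}. \<forall>\<zeta>\<in>{\<xi>, \<eta>}. has_variation (u \<omega> m) u0 \<zeta>) \<longrightarrow>
       symplectic_form (u \<omega> (Suc n)) u0 \<xi> \<eta> = symplectic_form (u \<omega> n) u0 \<xi> \<eta>) \<and>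
    (\<forall>n\<le>N. \<forall>u0\<in>sobolev_H1. \<forall>\<xi>\<in>sobolev_H1. has_variation (u \<omega> n) u0 \<xi>)"
proof (rule AE_I2, intro conjI allI impI ballI)
  \<comment> \<open>All claims are proved for each sample point separately: along a fixed path, the
    increment of W is just the real parameter of the free group.\<close>
  fix \<omega> n u0
  show "charge (u \<omega> (Suc n) u0) = charge (u \<omega> n u0)"
    unfolding u_def charge_eq norm_lie_splitting_Suc ..
next
  fix \<omega> n u0 \<xi> \<eta>
  assume var: "\<forall>m\<in>{n, Suc n}. \<forall>\<zeta>\<in>{\<xi>, \<eta>}. has_variation (u \<omega> m) u0 \<zeta>"
  have step: "u \<omega> (Suc n) = (\<lambda>v. free_schroedinger (W (real (Suc n) * (T / real N)) \<omega> - W (real n * (T / real N)) \<omega>)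
      (nonlinear_step \<sigma> (T / real N) (u \<omega> n v)))"
    by (simp add: fun_eq_iff u_def Let_def)
  show "symplectic_form (u \<omega> (Suc n)) u0 \<xi> \<eta> = symplectic_form (u \<omega> n) u0 \<xi> \<eta>"
    unfolding step
  proof (rule symplectic_step)
    fix \<zeta> assume \<zeta>: "\<zeta> \<in> {\<xi>, \<eta>}"
    then show "has_variation (u \<omega> n) u0 \<zeta>" using var by blast
    show "has_variation (\<lambda>v. free_schroedinger (W (real (Suc n) * (T / real N)) \<omega> - W (real n * (T / real N)) \<omega>)
        (nonlinear_step \<sigma> (T / real N) (u \<omega> n v))) u0 \<zeta>"
      unfolding step[symmetric] using var \<zeta> by blast
  qed
next
  fix \<omega> n u0 \<xi>
  assume "u0 \<in> sobolev_H1" "\<xi> \<in> sobolev_H1"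
  from regular_curve_lie_splitting[OF this] show "has_variation (u \<omega> n) u0 \<xi>"
    unfolding regular_curve_def u_def by (blast intro: has_variationI)
qed

end
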